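(* Let $\gamma\in\Phi_{\mathrm{re}}^+$, $D\in\mathbb Z_{>0}$, let $\lambda\in\mathfrak h_{\mathbb Z}^*$ lie in $H_{\gamma,D}$, and let $\mu=\lambda-D\gamma$. There is a nonzero homomorphism $M(\mu)_{\mathbb Z}\to M(\lambda)_{\mathbb Z}$ of $U_{\mathbb Z}$-modules given by $$v_\mu^+\mapsto Zv_\lambda^+,$$ where $Z=Z(\gamma,D)$ is the integral Shapovalov element.
   Context: Setting. Let $A=(a_{ij})_{i,j\in I}$, $I=\{0,1,\dots,r\}$, be a symmetrizable generalized Cartan matrix of affine type (possibly twisted) and rank $r$; $\mathfrak g_{\mathbb C}$ is the affine Kac–Moody algebra of $A$ with generators $e_i,f_i$ $(i\in I)$, simple roots $\alpha_i$, simple coroots $h_i$, Cartan subalgebra $\mathfrak h_{\mathbb C}$ spanned by $h_0,\dots,h_r$ and a scaling element $d$; $\mathfrak n^{\pm}_{\mathbb C}$ are generated by the $e_i$ (resp. $f_i$), $\mathfrak b^\pm_{\mathbb C}=\mathfrak h_{\mathbb C}\oplus\mathfrak n_{\mathbb C}^\pm$. $\rho(h_i)=1$ for all $i$. $\Phi^+$, $\Phi^+_{\mathrm{re}}$ are the positive and positive real roots; for $\gamma\in\Phi_{\mathrm{re}}^+$, $h_\gamma=\sum_ig_i^\vee h_i$ is its coroot, $\langle\lambda,\gamma^\vee\rangle=\lambda(h_\gamma)$, and $H_{\gamma,D}=\{\lambda:\langle\lambda+\rho,\gamma^\vee\rangle=D\}$. $U=U(\mathfrak g_{\mathbb C})$;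 $\mathfrak h_{\mathbb Z}$ is the $\mathbb Z$-span of $d,h_0,\dots,h_r$ and $\mathfrak h_{\mathbb Z}^*$ the weights taking integer values on it; $U_{\mathbb Z}\subset U$ is the subring generated by $e_i^{(n)}=e_i^n/n!$, $f_i^{(n)}=f_i^n/n!$, $\binom hn$ ($h\in\mathfrak h_{\mathbb Z}$); $U^-_{\mathbb Z}$ is generated by the $f_i^{(n)}$; $\mathfrak n_{\mathbb Z}^-=\mathfrak n^-_{\mathbb C}\cap U^-_{\mathbb Z}$, $\mathfrak b^-_{\mathbb Z}=\mathfrak n^-_{\mathbb Z}\oplus\mathfrak h_{\mathbb Z}$. For $\lambda\in\mathfrak h_{\mathbb Z}^*$, $M(\lambda)_{\mathbb Z}=U_{\mathbb Z}/I(\lambda)_{\mathbb Z}$, where $I(\lambda)_{\mathbb Z}$ is the left ideal of $U_{\mathbb Z}$ generated by all $e_j^{(m)}$ ($j\in I,m\ge1$) and all $\binom{h-\lambda(h)}{m}$ ($h\in\{h_0,\dots,h_r,d\}$, $m\ge1$), and $v_\lambda^+=1+I(\lambda)_{\mathbb Z}$. PBW basis. $\Phi^+_M=\{(\gamma,i):\gamma\in\Phi^+,1\le i\le\dim\mathfrak g_{\mathbb C,\gamma}\}$ is totally ordered; root vectors $f_{\gamma,i}$ of weight $-\gamma$ are taken from Mitzman's Chevalley basis of $\mathfrak g_{\mathbb C}$, with $f_{\alpha_i,1}=f_i$. With $\sum_{s\ge0}\Lambda_s(x_1,x_2,\dots)\zeta^s=\exp(\sum_{j\ge1}x_j\zeta^j/j)$,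 put $f_{\gamma,1}^{(s)}=f_{\gamma,1}^s/s!$ for $\gamma$ real and $f_{\gamma,i}^{(s)}=\Lambda_s(f_{\gamma,i},f_{2\gamma,i},\dots)$ for $\gamma$ imaginary. $\mathcal P$ is the set of finitely supported functions $\Phi_M^+\to\mathbb Z_{\ge0}$; for $\pi$ with support $(\gamma_1,i_1)<\dots<(\gamma_m,i_m)$, $\mathrm{wt}(\pi)=\sum_j\pi(\gamma_j,i_j)\gamma_j$, $\deg\pi=\sum_j\pi(\gamma_j,i_j)$, $F_\pi=\prod_j\pi(\gamma_j,i_j)!\,f_{\gamma_j,i_j}^{(\pi(\gamma_j,i_j))}$ (ordered product, called a PBW monomial). The root vectors are scaled so that for each simple root $\alpha$, with root vector $f_\alpha$, and $\omega\in\mathcal P$ one has $f_\alpha^mF_\omega=\sum_{\pi:\pi(\alpha,1)=0}\sum_{i\in\mathbb Z}F_\pi f_\alpha^{m-i}C_{\omega,\pi,i}(m)$ ($m>0$) with $C_{\omega,\pi,i}\in\mathbb Z[m]$. Integral Shapovalov element. For $\gamma=\sum_ig_i\alpha_i\in\Phi_{\mathrm{re}}^+$ and $D\in\mathbb Z_{>0}$, an integral Shapovalov element $Z=Z(\gamma,D)\in U(\mathfrak b^-_{\mathbb C})$ is one with: (Z1) $Z=\sum_{\pi\in\mathcal P}F_\pi Q_\pi$ with $\mathrm{wt}(\pi)=D\gamma$, $Q_\pi\in\mathbb Z[h_0,\dots,h_r]$; (Z2) $e_i^{(n)}Z\in\sum_{j\in I,m\ge1}U_{\mathbb Z}e_j^{(m)}+U(\mathfrak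 b^-_{\mathbb Z})(h_\gamma+\rho(h_\gamma)-D)$ for all $i\in I$, $n>0$; (Z3) the highest degree PBW monomial in $Z$ is a product of the $f_i^{Dg_i}$ for all $i\in I$. *)

theory Defs
  imports
    "HOL-Analysis.Analysis"
    "HOL-Library.Poly_Mapping"
    "HOL-Computational_Algebra.Polynomial"
    "Jordan_Normal_Form.DL_Rank"
begin

section \<open>Complex Lie algebras\<close>

class complex_lie_algebra = ab_group_add +
  fixes scaleC :: "complex \<Rightarrow> 'a \<Rightarrow> 'a"  (infixr \<open>*\<^sub>C\<close> 75)
    and lie :: "'a \<Rightarrow> 'a \<Rightarrow> 'a"
  assumes scaleC_add_right: "a *\<^sub>C (x + y) = a *\<^sub>C x + a *\<^sub>C y"
    and scaleC_add_left: "(a + b) *\<^sub>C x = a *\<^sub>C x + b *\<^sub>C x"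
    and scaleC_scaleC: "a *\<^sub>C b *\<^sub>C x = (a * b) *\<^sub>C x"
    and scaleC_one: "1 *\<^sub>C x = x"
    and lie_add_left: "lie (x + y) z = lie x z + lie y z"
    and lie_add_right: "lie x (y + z) = lie x y + lie x z"
    and lie_scale_left: "lie (a *\<^sub>C x) y = a *\<^sub>C lie x y"
    and lie_scale_right: "lie x (a *\<^sub>C y) = a *\<^sub>C lie x y"
    and lie_self: "lie x x = 0"
    and lie_jacobi: "lie x (lie y z) + lie y (lie z x) + lie z (lie x y) = 0"

global_interpretation cvs:
  Vector_Spaces.vector_space "scaleC :: complex \<Rightarrow> 'a \<Rightarrow> 'a::complex_lie_algebra"
  defines cdependent = cvs.dependent
    and cspan = cvs.span
    and cdim = cvs.dim
  by unfold_locales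
    (simp_all add: scaleC_add_right scaleC_add_left scaleC_scaleC scaleC_one)

inductive_set lie_subalgebra_gen :: "'g::complex_lie_algebra set \<Rightarrow> 'g set" for S where
  gen: "x \<in> S \<Longrightarrow> x \<in> lie_subalgebra_gen S"
| zero: "0 \<in> lie_subalgebra_gen S"
| add: "x \<in> lie_subalgebra_gen S \<Longrightarrow> y \<in> lie_subalgebra_gen S \<Longrightarrow> x + y \<in> lie_subalgebra_gen S"
| scale: "x \<in> lie_subalgebra_gen S \<Longrightarrow> c *\<^sub>C x \<in> lie_subalgebra_gen S"
| bracket: "x \<in> lie_subalgebra_gen S \<Longrightarrow> y \<in> lie_subalgebra_gen S \<Longrightarrow> lie x y \<in> lie_subalgebra_gen S"

definition lie_ideal :: "'g::complex_lie_algebra set \<Rightarrow> bool" where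
  "lie_ideal J \<longleftrightarrow> 0 \<in> J \<and> (\<forall>x\<in>J. \<forall>y\<in>J. x + y \<in> J) \<and> (\<forall>c. \<forall>x\<in>J. c *\<^sub>C x \<in> J) \<and>
     (\<forall>x. \<forall>y\<in>J. lie x y \<in> J)"


section \<open>The universal enveloping algebra\<close>

text \<open>
  \<open>'g uea\<close> is the quotient of the free associative complex algebra on the underlying set of the
  Lie algebra, i.e. the monoid algebra of the free monoid, by the two-sided ideal that makes the
  canonical map linear and turns Lie brackets into commutators. This is the tensor algebra
  modulo \<open>x \<otimes> y - y \<otimes> x - [x,y]\<close>.
\<close>

datatype 'g free_monoid = Word (letters: "'g list")

instantiation free_monoid :: (type) monoid_add
begin
definition "0 = Word []"
definition "u + v = Word (letters u @ letters v)"
instance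
  by standard (simp_all add: zero_free_monoid_def plus_free_monoid_def)
end

type_synonym 'g free_algebra = "'g free_monoid \<Rightarrow>\<^sub>0 complex"

definition letter :: "'g \<Rightarrow> 'g free_algebra" where
  "letter x = Poly_Mapping.single (Word [x]) 1"

inductive_set uea_ideal :: "'g::complex_lie_algebra free_algebra set" where
  add_rel: "letter (x + y) - letter x - letter y \<in> uea_ideal"
| scale_rel: "letter (c *\<^sub>C x) - Poly_Mapping.single 0 c * letter x \<in> uea_ideal"
| bracket_rel: "letter x * letter y - letter y * letter x - letter (lie x y) \<in> uea_ideal"
| zero: "0 \<in> uea_ideal"
| add: "a \<in> uea_ideal \<Longrightarrow> b \<in> uea_ideal \<Longrightarrow> a + b \<in> uea_ideal"
| mult_left: "a \<in> uea_ideal \<Longrightarrow> p * a \<in> uea_ideal"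
| mult_right: "a \<in> uea_ideal \<Longrightarrow> a * p \<in> uea_ideal"

lemma uea_ideal_minus: "a \<in> uea_ideal \<Longrightarrow> - a \<in> uea_ideal"
  using uea_ideal.mult_left[of a "-1"] by simp

lemma uea_ideal_minus_iff: "a - b \<in> uea_ideal \<Longrightarrow> b - a \<in> uea_ideal"
  using uea_ideal_minus[of "a - b"] by simp

lemma free_monoid_add_eq_0: "(0 :: 'g free_monoid) = u + v \<longleftrightarrow> u = 0 \<and> v = 0"
  by (cases u; cases v) (auto simp: zero_free_monoid_def plus_free_monoid_def)

lemma lookup_mult_zero:
  fixes p q :: "'g free_algebra"
  shows "Poly_Mapping.lookup (p * q) 0 = Poly_Mapping.lookup p 0 * Poly_Mapping.lookup q 0"
proof -
  have "Sum_any (\<lambda>v. Poly_Mapping.lookup q v when 0 = l + v) =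
      (Poly_Mapping.lookup q 0 when l = 0)" for l :: "'g free_monoid"
  proof -
    have "(\<lambda>v. Poly_Mapping.lookup q v when 0 = l + v) =
        (\<lambda>v. (Poly_Mapping.lookup q 0 when l = 0) when v = 0)"
      by (auto simp: fun_eq_iff when_def free_monoid_add_eq_0)
    hence "Sum_any (\<lambda>v. Poly_Mapping.lookup q v when 0 = l + v) =
        Sum_any (\<lambda>v :: 'g free_monoid. (Poly_Mapping.lookup q 0 when l = 0) when v = 0)"
      by (rule arg_cong)
    thus ?thesis by (simp only: Sum_any_when_equal)
  qed
  thus ?thesis
    unfolding lookup_mult by (simp add: mult_when)
qed

lemma lookup_letter_zero: "Poly_Mapping.lookup (letter x) 0 = 0"
  by (simp add: letter_def lookup_single zero_free_monoid_def)

lemma uea_ideal_augmentation: "a \<in> uea_ideal \<Longrightarrow> Poly_Mapping.lookup a 0 = 0"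
  by (induction rule: uea_ideal.induct)
    (simp_all add: lookup_minus lookup_add lookup_mult_zero lookup_letter_zero)

definition uea_eq :: "'g::complex_lie_algebra free_algebra \<Rightarrow> 'g free_algebra \<Rightarrow> bool" where
  "uea_eq a b \<longleftrightarrow> a - b \<in> uea_ideal"

lemma equivp_uea_eq:
  "equivp (uea_eq :: 'g::complex_lie_algebra free_algebra \<Rightarrow> 'g free_algebra \<Rightarrow> bool)"
    (is "equivp ?R")
proof (rule equivpI)
  show "reflp ?R" by (auto simp: reflp_def uea_eq_def uea_ideal.zero)
  show "symp ?R" by (auto simp: symp_def uea_eq_def intro: uea_ideal_minus_iff)
  show "transp ?R"
  proof (rule transpI)
    fix a b c :: "'g free_algebra"
    assume "uea_eq a b" "uea_eq b c"
    hence "(a - b) + (b - c) \<in> uea_ideal" unfolding uea_eq_def by (rule uea_ideal.add)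
    thus "uea_eq a c" by (simp add: uea_eq_def)
  qed
qed

quotient_type (overloaded) 'g uea = "'g::complex_lie_algebra free_algebra" / uea_eq
  by (rule equivp_uea_eq)

instantiation uea :: (complex_lie_algebra) ring_1
begin

lift_definition zero_uea :: "'a uea" is 0 .
lift_definition one_uea :: "'a uea" is 1 .

lift_definition plus_uea :: "'a uea \<Rightarrow> 'a uea \<Rightarrow> 'a uea" is "(+)"
proof -
  fix a a' b b' :: "'a free_algebra"
  assume "uea_eq a a'" "uea_eq b b'"
  hence "(a - a') + (b - b') \<in> uea_ideal" unfolding uea_eq_def by (rule uea_ideal.add)
  thus "uea_eq (a + b) (a' + b')" by (simp add: uea_eq_def algebra_simps)
qed

lift_definition minus_uea :: "'a uea \<Rightarrow> 'a uea \<Rightarrow> 'a uea" is "(-)"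
proof -
  fix a a' b b' :: "'a free_algebra"
  assume "uea_eq a a'" "uea_eq b b'"
  hence "(a - a') + - (b - b') \<in> uea_ideal"
    unfolding uea_eq_def by (intro uea_ideal.add uea_ideal_minus)
  thus "uea_eq (a - b) (a' - b')" by (simp add: uea_eq_def algebra_simps)
qed

lift_definition uminus_uea :: "'a uea \<Rightarrow> 'a uea" is uminus
proof -
  fix a a' :: "'a free_algebra"
  assume "uea_eq a a'"
  hence "- (a - a') \<in> uea_ideal" unfolding uea_eq_def by (rule uea_ideal_minus)
  thus "uea_eq (- a) (- a')" by (simp add: uea_eq_def algebra_simps)
qed

lift_definition times_uea :: "'a uea \<Rightarrow> 'a uea \<Rightarrow> 'a uea" is "(*)"
proof -
  fix a a' b b' :: "'a free_algebra"
  assume "uea_eq a a'" "uea_eq b b'"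
  hence "(a - a') * b + a' * (b - b') \<in> uea_ideal"
    unfolding uea_eq_def by (intro uea_ideal.add uea_ideal.mult_left uea_ideal.mult_right)
  thus "uea_eq (a * b) (a' * b')" by (simp add: uea_eq_def algebra_simps)
qed

instance
proof
  show "(0 :: 'a uea) \<noteq> 1"
  proof
    assume "(0 :: 'a uea) = 1"
    hence "uea_eq (0 :: 'a free_algebra) 1" by transfer
    hence "Poly_Mapping.lookup (0 - 1 :: 'a free_algebra) 0 = 0"
      unfolding uea_eq_def by (rule uea_ideal_augmentation)
    thus False by (simp add: lookup_minus lookup_one)
  qed
qed (transfer; simp add: algebra_simps uea_eq_def uea_ideal.zero)+

end

lift_definition uea_incl :: "'g::complex_lie_algebra \<Rightarrow> 'g uea"  (\<open>\<iota>\<close>) is letter .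

lift_definition uea_const :: "complex \<Rightarrow> 'g::complex_lie_algebra uea" is
  "\<lambda>c. Poly_Mapping.single 0 c" .

inductive_set subring_gen :: "'a::ring_1 set \<Rightarrow> 'a set" for S where
  gen: "x \<in> S \<Longrightarrow> x \<in> subring_gen S"
| one: "1 \<in> subring_gen S"
| diff: "x \<in> subring_gen S \<Longrightarrow> y \<in> subring_gen S \<Longrightarrow> x - y \<in> subring_gen S"
| mult: "x \<in> subring_gen S \<Longrightarrow> y \<in> subring_gen S \<Longrightarrow> x * y \<in> subring_gen S"

inductive_set left_ideal_gen :: "'a::ring_1 set \<Rightarrow> 'a set \<Rightarrow> 'a set" for R S where
  zero: "0 \<in> left_ideal_gen R S"
| add: "u \<in> R \<Longrightarrow> s \<in> S \<Longrightarrow> x \<in> left_ideal_gen R S \<Longrightarrow> u * s + x \<in> left_ideal_gen R S"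

definition divided_power :: "'g::complex_lie_algebra uea \<Rightarrow> nat \<Rightarrow> 'g uea" where
  "divided_power x n = uea_const (1 / fact n) * x ^ n"

definition uea_binomial :: "'g::complex_lie_algebra uea \<Rightarrow> nat \<Rightarrow> 'g uea" where
  "uea_binomial x n = uea_const (1 / fact n) * prod_list (map (\<lambda>k. x - of_nat k) [0..<n])"


section \<open>Cartan matrices of affine type\<close>

definition generalized_cartan_matrix :: "nat \<Rightarrow> int mat \<Rightarrow> bool" where
  "generalized_cartan_matrix n A \<longleftrightarrow> A \<in> carrier_mat n n \<and>
     (\<forall>i<n. A $$ (i,i) = 2) \<and>
     (\<forall>i<n. \<forall>j<n. i \<noteq> j \<longrightarrow> A $$ (i,j) \<le> 0 \<and> (A $$ (i,j) = 0 \<longrightarrow> A $$ (j,i) = 0))"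

definition symmetrizable :: "nat \<Rightarrow> int mat \<Rightarrow> bool" where
  "symmetrizable n A \<longleftrightarrow> (\<exists>D B :: real mat. D \<in> carrier_mat n n \<and> B \<in> carrier_mat n n \<and>
     diagonal_mat D \<and> invertible_mat D \<and> transpose_mat B = B \<and> map_mat of_int A = D * B)"

definition indecomposable :: "nat \<Rightarrow> int mat \<Rightarrow> bool" where
  "indecomposable n A \<longleftrightarrow> (\<forall>S. S \<subseteq> {..<n} \<and> S \<noteq> {} \<and> S \<noteq> {..<n} \<longrightarrow>
     (\<exists>i\<in>S. \<exists>j\<in>{..<n} - S. A $$ (i,j) \<noteq> 0 \<or> A $$ (j,i) \<noteq> 0))"

definition affine_type :: "nat \<Rightarrow> int mat \<Rightarrow> bool" where
  "affine_type r A \<longleftrightarrow> generalized_cartan_matrix (Suc r) A \<and> indecomposable (Suc r) A \<and>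
     vec_space.rank (Suc r) (map_mat of_int A :: real mat) = r \<and>
     (\<exists>u :: real vec. u \<in> carrier_vec (Suc r) \<and> (\<forall>i<Suc r. u $ i > 0) \<and>
        map_mat of_int A *\<^sub>v u = 0\<^sub>v (Suc r)) \<and>
     (\<forall>v :: real vec. v \<in> carrier_vec (Suc r) \<and> (\<forall>i<Suc r. (map_mat of_int A *\<^sub>v v) $ i \<ge> 0) \<longrightarrow>
        map_mat of_int A *\<^sub>v v = 0\<^sub>v (Suc r))"


section \<open>Affine Kac--Moody algebras\<close>

record 'g km_data =
  rk :: nat
  gcm :: "int mat"
  ee :: "nat \<Rightarrow> 'g"
  ff :: "nat \<Rightarrow> 'g"
  hh :: "nat \<Rightarrow> 'g"
  dd :: 'g
  alpha :: "nat \<Rightarrow> 'g \<Rightarrow> complex"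

definition cartan :: "('g::complex_lie_algebra, 'z) km_data_scheme \<Rightarrow> 'g set" where
  "cartan K = cspan (insert (dd K) (hh K ` {..rk K}))"

text \<open>
  A linear functional on the Cartan subalgebra is represented by a function on the whole Lie
  algebra; its values outside the Cartan subalgebra are irrelevant and never used.
\<close>

definition cartan_dual :: "('g::complex_lie_algebra, 'z) km_data_scheme \<Rightarrow> ('g \<Rightarrow> complex) set" where
  "cartan_dual K = {l. (\<forall>x\<in>cartan K. \<forall>y\<in>cartan K. l (x + y) = l x + l y) \<and>
     (\<forall>c. \<forall>x\<in>cartan K. l (c *\<^sub>C x) = c * l x)}"

text \<open>
  The Kac--Moody algebra of a matrix in the sense of Kac: it is generated by the Cartan subalgebra
  of a realization and the elements \<open>e\<^sub>i\<close>, \<open>f\<^sub>i\<close>, satisfies the Weyl relations, and has no nonzero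
  ideal meeting the Cartan subalgebra trivially. These conditions determine it up to isomorphism.
  The convention is \<open>\<alpha>\<^sub>j(h\<^sub>i) = a\<^sub>i\<^sub>j\<close>, and the scaling element \<open>d\<close> satisfies
  \<open>\<alpha>\<^sub>0(d) = 1\<close> and \<open>\<alpha>\<^sub>i(d) = 0\<close> for \<open>i > 0\<close>.
\<close>

definition affine_kac_moody :: "('g::complex_lie_algebra, 'z) km_data_scheme \<Rightarrow> bool" where
  "affine_kac_moody K \<longleftrightarrow>
     affine_type (rk K) (gcm K) \<and> symmetrizable (Suc (rk K)) (gcm K) \<and>
     inj_on (hh K) {..rk K} \<and> dd K \<notin> hh K ` {..rk K} \<and>
     \<not> cdependent (insert (dd K) (hh K ` {..rk K})) \<and>
     (\<forall>j\<le>rk K. alpha K j \<in> cartan_dual K \<and>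
        (\<forall>i\<le>rk K. alpha K j (hh K i) = of_int (gcm K $$ (i,j))) \<and>
        alpha K j (dd K) = (if j = 0 then 1 else 0)) \<and>
     (\<forall>x\<in>cartan K. \<forall>y\<in>cartan K. lie x y = 0) \<and>
     (\<forall>x\<in>cartan K. \<forall>i\<le>rk K. lie x (ee K i) = alpha K i x *\<^sub>C ee K i \<and>
        lie x (ff K i) = (- alpha K i x) *\<^sub>C ff K i) \<and>
     (\<forall>i\<le>rk K. \<forall>j\<le>rk K. lie (ee K i) (ff K j) = (if i = j then hh K i else 0)) \<and>
     lie_subalgebra_gen (cartan K \<union> ee K ` {..rk K} \<union> ff K ` {..rk K}) = UNIV \<and>
     (\<forall>J. lie_ideal J \<and> J \<inter> cartan K = {0} \<longrightarrow> J = {0})"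

definition n_minus :: "('g::complex_lie_algebra, 'z) km_data_scheme \<Rightarrow> 'g set" where
  "n_minus K = lie_subalgebra_gen (ff K ` {..rk K})"

definition b_minus :: "('g::complex_lie_algebra, 'z) km_data_scheme \<Rightarrow> 'g set" where
  "b_minus K = {x + y | x y. x \<in> n_minus K \<and> y \<in> cartan K}"

text \<open>The element \<open>\<Sum>\<^sub>i \<gamma>\<^sub>i \<alpha>\<^sub>i\<close> of the root lattice is encoded by its coefficient function \<open>\<gamma>\<close>.\<close>

definition simple_root :: "nat \<Rightarrow> nat \<Rightarrow> int" where
  "simple_root i = (\<lambda>j. if j = i then 1 else 0)"

definition root_functional ::
  "('g::complex_lie_algebra, 'z) km_data_scheme \<Rightarrow> (nat \<Rightarrow> int) \<Rightarrow> 'g \<Rightarrow> complex" where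
  "root_functional K \<gamma> x = (\<Sum>i\<le>rk K. of_int (\<gamma> i) * alpha K i x)"

definition root_space ::
  "('g::complex_lie_algebra, 'z) km_data_scheme \<Rightarrow> (nat \<Rightarrow> int) \<Rightarrow> 'g set" where
  "root_space K \<gamma> = {x. \<forall>y\<in>cartan K. lie y x = root_functional K \<gamma> y *\<^sub>C x}"

definition roots :: "('g::complex_lie_algebra, 'z) km_data_scheme \<Rightarrow> (nat \<Rightarrow> int) set" where
  "roots K = {\<gamma>. (\<forall>i>rk K. \<gamma> i = 0) \<and> \<gamma> \<noteq> (\<lambda>_. 0) \<and> root_space K \<gamma> \<noteq> {0}}"

definition positive_roots :: "('g::complex_lie_algebra, 'z) km_data_scheme \<Rightarrow> (nat \<Rightarrow> int) set" where
  "positive_roots K = {\<gamma> \<in> roots K. \<forall>i. \<gamma> i \<ge> 0}"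

text \<open>
  Pairs \<open>(w \<alpha>\<^sub>i, w h\<^sub>i)\<close> for \<open>w\<close> in the Weyl group, as coefficient functions with respect to the simple
  roots and the simple coroots: the fundamental reflections act by
  \<open>\<gamma> \<mapsto> \<gamma> - \<gamma>(h\<^sub>i) \<alpha>\<^sub>i\<close> and \<open>h \<mapsto> h - \<alpha>\<^sub>i(h) h\<^sub>i\<close>.
\<close>

inductive root_coroot ::
  "('g::complex_lie_algebra, 'z) km_data_scheme \<Rightarrow> (nat \<Rightarrow> int) \<Rightarrow> (nat \<Rightarrow> int) \<Rightarrow> bool" for K where
  simple: "i \<le> rk K \<Longrightarrow> root_coroot K (simple_root i) (simple_root i)"
| reflect: "root_coroot K \<gamma> c \<Longrightarrow> i \<le> rk K \<Longrightarrow>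
     root_coroot K (\<gamma>(i := \<gamma> i - (\<Sum>j\<le>rk K. \<gamma> j * gcm K $$ (i,j))))
                   (c(i := c i - (\<Sum>j\<le>rk K. c j * gcm K $$ (j,i))))"

definition real_roots :: "('g::complex_lie_algebra, 'z) km_data_scheme \<Rightarrow> (nat \<Rightarrow> int) set" where
  "real_roots K = {\<gamma>. \<exists>c. root_coroot K \<gamma> c}"

definition positive_real_roots ::
  "('g::complex_lie_algebra, 'z) km_data_scheme \<Rightarrow> (nat \<Rightarrow> int) set" where
  "positive_real_roots K = positive_roots K \<inter> real_roots K"

definition coroot :: "('g::complex_lie_algebra, 'z) km_data_scheme \<Rightarrow> (nat \<Rightarrow> int) \<Rightarrow> 'g" where
  "coroot K \<gamma> = (\<Sum>i\<le>rk K. of_int ((THE c. root_coroot K \<gamma> c) i) *\<^sub>C hh K i)"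

definition is_rho :: "('g::complex_lie_algebra, 'z) km_data_scheme \<Rightarrow> ('g \<Rightarrow> complex) \<Rightarrow> bool" where
  "is_rho K \<rho> \<longleftrightarrow> \<rho> \<in> cartan_dual K \<and> (\<forall>i\<le>rk K. \<rho> (hh K i) = 1)"

definition hyperplane ::
  "('g::complex_lie_algebra, 'z) km_data_scheme \<Rightarrow> ('g \<Rightarrow> complex) \<Rightarrow> (nat \<Rightarrow> int) \<Rightarrow> nat \<Rightarrow>
     ('g \<Rightarrow> complex) set" where
  "hyperplane K \<rho> \<gamma> D =
     {l \<in> cartan_dual K. l (coroot K \<gamma>) + \<rho> (coroot K \<gamma>) = of_nat D}"


section \<open>The integral form and its Verma modules\<close>

definition h_int :: "('g::complex_lie_algebra, 'z) km_data_scheme \<Rightarrow> 'g set" where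
  "h_int K = {(\<Sum>i\<le>rk K. of_int (c i) *\<^sub>C hh K i) + of_int k *\<^sub>C dd K | (c :: nat \<Rightarrow> int) (k :: int). True}"

definition integral_weights ::
  "('g::complex_lie_algebra, 'z) km_data_scheme \<Rightarrow> ('g \<Rightarrow> complex) set" where
  "integral_weights K = {l \<in> cartan_dual K. \<forall>x\<in>h_int K. l x \<in> \<int>}"

definition U_int :: "('g::complex_lie_algebra, 'z) km_data_scheme \<Rightarrow> 'g uea set" where
  "U_int K = subring_gen
     ({divided_power (\<iota> (ee K i)) n | i n. i \<le> rk K} \<union>
      {divided_power (\<iota> (ff K i)) n | i n. i \<le> rk K} \<union>
      {uea_binomial (\<iota> x) n | x n. x \<in> h_int K})"

definition U_minus_int :: "('g::complex_lie_algebra, 'z) km_data_scheme \<Rightarrow> 'g uea set" where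
  "U_minus_int K = subring_gen {divided_power (\<iota> (ff K i)) n | i n. i \<le> rk K}"

definition n_minus_int :: "('g::complex_lie_algebra, 'z) km_data_scheme \<Rightarrow> 'g set" where
  "n_minus_int K = {x \<in> n_minus K. \<iota> x \<in> U_minus_int K}"

definition b_minus_int :: "('g::complex_lie_algebra, 'z) km_data_scheme \<Rightarrow> 'g set" where
  "b_minus_int K = {x + y | x y. x \<in> n_minus_int K \<and> y \<in> h_int K}"

text \<open>
  Enveloping algebras of subalgebras are regarded, as usual, as subrings of the enveloping algebra
  of the whole Lie algebra: over the complex numbers for the first, over the integers for the second.
\<close>

definition U_b_minus :: "('g::complex_lie_algebra, 'z) km_data_scheme \<Rightarrow> 'g uea set" where
  "U_b_minus K = subring_gen (range uea_const \<union> \<iota> ` b_minus K)"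

definition U_b_minus_int :: "('g::complex_lie_algebra, 'z) km_data_scheme \<Rightarrow> 'g uea set" where
  "U_b_minus_int K = subring_gen (\<iota> ` b_minus_int K)"

definition verma_ideal ::
  "('g::complex_lie_algebra, 'z) km_data_scheme \<Rightarrow> ('g \<Rightarrow> complex) \<Rightarrow> 'g uea set" where
  "verma_ideal K l = left_ideal_gen (U_int K)
     ({divided_power (\<iota> (ee K j)) m | j m. j \<le> rk K \<and> m \<ge> 1} \<union>
      {uea_binomial (\<iota> x - uea_const (l x)) m | x m. x \<in> insert (dd K) (hh K ` {..rk K}) \<and> m \<ge> 1})"

definition verma_coset ::
  "('g::complex_lie_algebra, 'z) km_data_scheme \<Rightarrow> ('g \<Rightarrow> complex) \<Rightarrow> 'g uea \<Rightarrow> 'g uea set" where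
  "verma_coset K l u = {u + x | x. x \<in> verma_ideal K l}"

definition verma ::
  "('g::complex_lie_algebra, 'z) km_data_scheme \<Rightarrow> ('g \<Rightarrow> complex) \<Rightarrow> 'g uea set set" where
  "verma K l = verma_coset K l ` U_int K"

definition verma_zero ::
  "('g::complex_lie_algebra, 'z) km_data_scheme \<Rightarrow> ('g \<Rightarrow> complex) \<Rightarrow> 'g uea set" where
  "verma_zero K l = verma_coset K l 0"

definition verma_vec ::
  "('g::complex_lie_algebra, 'z) km_data_scheme \<Rightarrow> ('g \<Rightarrow> complex) \<Rightarrow> 'g uea set" where
  "verma_vec K l = verma_coset K l 1"

definition coset_add :: "'a::ring_1 set \<Rightarrow> 'a set \<Rightarrow> 'a set" where
  "coset_add X Y = {x + y | x y. x \<in> X \<and> y \<in> Y}"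

definition verma_act ::
  "('g::complex_lie_algebra, 'z) km_data_scheme \<Rightarrow> ('g \<Rightarrow> complex) \<Rightarrow> 'g uea \<Rightarrow> 'g uea set \<Rightarrow> 'g uea set"
  where "verma_act K l u X = {u * x + y | x y. x \<in> X \<and> y \<in> verma_ideal K l}"

definition verma_hom ::
  "('g::complex_lie_algebra, 'z) km_data_scheme \<Rightarrow> ('g \<Rightarrow> complex) \<Rightarrow> ('g \<Rightarrow> complex) \<Rightarrow>
     ('g uea set \<Rightarrow> 'g uea set) \<Rightarrow> bool" where
  "verma_hom K m l \<phi> \<longleftrightarrow>
     (\<forall>X\<in>verma K m. \<phi> X \<in> verma K l) \<and>
     (\<forall>X\<in>verma K m. \<forall>Y\<in>verma K m. \<phi> (coset_add X Y) = coset_add (\<phi> X) (\<phi> Y)) \<and>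
     (\<forall>u\<in>U_int K. \<forall>X\<in>verma K m. \<phi> (verma_act K m u X) = verma_act K l u (\<phi> X))"


section \<open>PBW monomials\<close>

type_synonym root_index = "(nat \<Rightarrow> int) \<times> nat"

definition root_indices :: "('g::complex_lie_algebra, 'z) km_data_scheme \<Rightarrow> root_index set" where
  "root_indices K = {(\<gamma>, i). \<gamma> \<in> positive_roots K \<and> 1 \<le> i \<and> i \<le> cdim (root_space K \<gamma>)}"

text \<open>
  The properties of the negative part of a Chevalley basis that are used here: for every positive
  root \<open>\<gamma>\<close> the vectors \<open>f\<^sub>\<gamma>\<^sub>,\<^sub>i\<close> form a basis of the root space of \<open>-\<gamma>\<close> and lie in the integral form.
  No particular normalization (choice of signs or of a realization) is imposed except that
  \<open>f\<^sub>\<alpha>\<^sub>,\<^sub>1 = f\<^sub>i\<close> for a simple root \<open>\<alpha> = \<alpha>\<^sub>i\<close>; Mitzman's Chevalley basis is the intended example.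
\<close>

definition integral_root_vectors ::
  "('g::complex_lie_algebra, 'z) km_data_scheme \<Rightarrow> ((nat \<Rightarrow> int) \<Rightarrow> nat \<Rightarrow> 'g) \<Rightarrow> bool" where
  "integral_root_vectors K rv \<longleftrightarrow>
     (\<forall>\<gamma>\<in>positive_roots K.
        let I = {1..cdim (root_space K \<gamma>)} in
          inj_on (rv \<gamma>) I \<and> \<not> cdependent (rv \<gamma> ` I) \<and>
          cspan (rv \<gamma> ` I) = root_space K (\<lambda>j. - \<gamma> j) \<and>
          rv \<gamma> ` I \<subseteq> n_minus_int K) \<and>
     (\<forall>i\<le>rk K. rv (simple_root i) 1 = ff K i)"

text \<open>
  \<open>\<Lambda>\<^sub>s(x\<^sub>1, x\<^sub>2, \<dots>)\<close> is the coefficient of \<open>\<zeta>\<^sup>s\<close> in \<open>exp (\<Sum>\<^sub>j x\<^sub>j \<zeta>\<^sup>j / j) = \<Prod>\<^sub>j exp (x\<^sub>j \<zeta>\<^sup>j / j)\<close>, a polynomial in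
  commuting variables. It is only evaluated at commuting root vectors; the monomials are written in
  the order of increasing \<open>j\<close>, and \<open>m\<close> is the exponent vector of a monomial.
\<close>

definition Lambda :: "nat \<Rightarrow> (nat \<Rightarrow> 'g::complex_lie_algebra uea) \<Rightarrow> 'g uea" where
  "Lambda s x =
     (\<Sum>m\<in>{m :: nat \<Rightarrow> nat. (\<forall>j. m j \<noteq> 0 \<longrightarrow> j \<in> {1..s}) \<and> (\<Sum>j=1..s. j * m j) = s}.
        uea_const (\<Prod>j=1..s. 1 / (of_nat j ^ m j * fact (m j))) *
        prod_list (map (\<lambda>j. x j ^ m j) [1..<Suc s]))"

text \<open>
  For imaginary \<open>\<gamma>\<close> all pairs \<open>(j\<gamma>, i)\<close> with \<open>(\<gamma>, i)\<close> an index are again indices; the value \<open>0\<close> below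
  for other pairs only serves to make the function total.
\<close>

definition root_divided_power ::
  "('g::complex_lie_algebra, 'z) km_data_scheme \<Rightarrow> ((nat \<Rightarrow> int) \<Rightarrow> nat \<Rightarrow> 'g) \<Rightarrow>
     root_index \<Rightarrow> nat \<Rightarrow> 'g uea" where
  "root_divided_power K rv = (\<lambda>(\<gamma>, i) s.
     if \<gamma> \<in> real_roots K then divided_power (\<iota> (rv \<gamma> i)) s
     else Lambda s (\<lambda>j. let \<beta> = (\<lambda>k. int j * \<gamma> k) in
       if (\<beta>, i) \<in> root_indices K then \<iota> (rv \<beta> i) else 0))"

type_synonym kpart = "root_index \<Rightarrow> nat"

definition kpart_supp :: "kpart \<Rightarrow> root_index set" where
  "kpart_supp p = {b. p b \<noteq> 0}"

definition kparts :: "('g::complex_lie_algebra, 'z) km_data_scheme \<Rightarrow> kpart set" where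
  "kparts K = {p. finite (kpart_supp p) \<and> kpart_supp p \<subseteq> root_indices K}"

definition kpart_wt :: "kpart \<Rightarrow> nat \<Rightarrow> int" where
  "kpart_wt p = (\<lambda>k. \<Sum>b\<in>kpart_supp p. int (p b) * fst b k)"

definition kpart_deg :: "kpart \<Rightarrow> nat" where
  "kpart_deg p = (\<Sum>b\<in>kpart_supp p. p b)"

definition ordered_list :: "root_index rel \<Rightarrow> root_index set \<Rightarrow> root_index list" where
  "ordered_list ord S = (THE bs. set bs = S \<and> distinct bs \<and> sorted_wrt (\<lambda>a b. (a, b) \<in> ord) bs)"

definition pbw ::
  "('g::complex_lie_algebra, 'z) km_data_scheme \<Rightarrow> root_index rel \<Rightarrow>
     ((nat \<Rightarrow> int) \<Rightarrow> nat \<Rightarrow> 'g) \<Rightarrow> kpart \<Rightarrow> 'g uea" where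
  "pbw K ord rv p =
     prod_list (map (\<lambda>b. of_nat (fact (p b)) * root_divided_power K rv b (p b)) (ordered_list ord (kpart_supp p)))"

text \<open>
  \<open>f\<^sub>\<alpha>\<^sup>m F\<^sub>\<omega> = \<Sum>\<^sub>\<pi> \<Sum>\<^sub>k F\<^sub>\<pi> f\<^sub>\<alpha>\<^sup>m\<^sup>-\<^sup>k C\<^sub>\<omega>\<^sub>,\<^sub>\<pi>\<^sub>,\<^sub>k(m)\<close> with polynomials \<open>C\<^sub>\<omega>\<^sub>,\<^sub>\<pi>\<^sub>,\<^sub>k\<close> independent of \<open>m\<close>, almost all zero.
  Since \<open>k\<close> ranges over all integers, this includes that \<open>C\<^sub>\<omega>\<^sub>,\<^sub>\<pi>\<^sub>,\<^sub>k(m) = 0\<close> whenever \<open>m - k < 0\<close>.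
\<close>

definition polynomial_exchange ::
  "('g::complex_lie_algebra, 'z) km_data_scheme \<Rightarrow> root_index rel \<Rightarrow>
     ((nat \<Rightarrow> int) \<Rightarrow> nat \<Rightarrow> 'g) \<Rightarrow> bool" where
  "polynomial_exchange K ord rv \<longleftrightarrow>
     (\<forall>i\<le>rk K. \<forall>\<omega>\<in>kparts K. \<exists>C :: kpart \<Rightarrow> int \<Rightarrow> int poly.
        finite {(p, k). C p k \<noteq> 0} \<and>
        (\<forall>p k. C p k \<noteq> 0 \<longrightarrow> p \<in> kparts K \<and> p (simple_root i, 1) = 0) \<and>
        (\<forall>m::nat. m > 0 \<longrightarrow>
           (\<forall>p k. k > int m \<longrightarrow> poly (C p k) (int m) = 0) \<and>
           \<iota> (rv (simple_root i) 1) ^ m * pbw K ord rv \<omega> =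
             (\<Sum>(p, k) \<in> {(p, k). C p k \<noteq> 0}.
                pbw K ord rv p * \<iota> (rv (simple_root i) 1) ^ nat (int m - k) *
                of_int (poly (C p k) (int m)))))"


section \<open>Integral Shapovalov elements\<close>

definition leading_kpart ::
  "('g::complex_lie_algebra, 'z) km_data_scheme \<Rightarrow> (nat \<Rightarrow> int) \<Rightarrow> nat \<Rightarrow> kpart" where
  "leading_kpart K \<gamma> D =
     (\<lambda>b. \<Sum>i\<le>rk K. if b = (simple_root i, 1) then D * nat (\<gamma> i) else 0)"

text \<open>
  \<open>q p\<close> is the coefficient, a polynomial in the \<open>h\<^sub>i\<close>, of the monomial of \<open>p\<close>. The last condition says
  that the unique term of highest degree of \<open>Z\<close> is the ordered product of the \<open>f\<^sub>i\<close> to the powers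
  \<open>D g\<^sub>i\<close>, up to a nonzero integer factor \<open>c\<close> (in the normalized case \<open>c = 1\<close>).
\<close>

definition integral_shapovalov ::
  "('g::complex_lie_algebra, 'z) km_data_scheme \<Rightarrow> ('g \<Rightarrow> complex) \<Rightarrow> root_index rel \<Rightarrow>
     ((nat \<Rightarrow> int) \<Rightarrow> nat \<Rightarrow> 'g) \<Rightarrow> (nat \<Rightarrow> int) \<Rightarrow> nat \<Rightarrow> 'g uea \<Rightarrow> bool" where
  "integral_shapovalov K \<rho> ord rv \<gamma> D Z \<longleftrightarrow>
     Z \<in> U_b_minus K \<and>
     (\<exists>q :: kpart \<Rightarrow> 'g uea.
        finite {p. q p \<noteq> 0} \<and>
        (\<forall>p. q p \<noteq> 0 \<longrightarrow> p \<in> kparts K \<and> kpart_wt p = (\<lambda>k. int D * \<gamma> k)) \<and>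
        (\<forall>p. q p \<in> subring_gen ((\<lambda>i. \<iota> (hh K i)) ` {..rk K})) \<and>
        Z = (\<Sum>p | q p \<noteq> 0. pbw K ord rv p * q p) \<and>
        (\<exists>c::int. c \<noteq> 0 \<and> q (leading_kpart K \<gamma> D) = of_int c) \<and>
        (\<forall>p. q p \<noteq> 0 \<and> p \<noteq> leading_kpart K \<gamma> D \<longrightarrow> kpart_deg p < kpart_deg (leading_kpart K \<gamma> D))) \<and>
     (\<forall>i\<le>rk K. \<forall>n>0.
        \<exists>x \<in> left_ideal_gen (U_int K) {divided_power (\<iota> (ee K j)) m | j m. j \<le> rk K \<and> m \<ge> 1}.
        \<exists>u \<in> U_b_minus_int K.
          divided_power (\<iota> (ee K i)) n * Z =
            x + u * (\<iota> (coroot K \<gamma>) + uea_const (\<rho> (coroot K \<gamma>)) - of_nat D))"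

end

theory Submission
  imports Defs
begin

text \<open>
  The homomorphism is right multiplication by \<open>Z\<close>. It is well defined because \<open>Z\<close> lies in the integral
  form, because \<open>h Z = Z (h - D \<gamma>(h))\<close>, and because \<open>h\<^sub>\<gamma> + \<rho>(h\<^sub>\<gamma>) - D\<close> acts by \<open>0\<close> on the highest weight
  vector when the weight lies in the hyperplane.

  It is nonzero because \<open>Z\<close> does not vanish under the character of \<open>\<nn>\<^sup>-\<close> with \<open>f\<^sub>i \<mapsto> 1\<close> for all \<open>i\<close>, which
  kills all root vectors of nonsimple roots and hence all terms of \<open>Z\<close> except the leading one.
  To see that this character gives a functional on the Verma module without the
  Poincare--Birkhoff--Witt theorem, let the generators act on the dual of the free algebra in the
  \<open>f\<^sub>i\<close>, as on the Verma module of the Lie algebra without Serre relations. The functional with value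
  \<open>1\<close> on all words is annihilated by the operators of those Lie words that vanish in the Kac--Moody
  algebra: by the triangular decomposition, such a Lie word acts on the highest weight vector as one
  in the \<open>f\<^sub>i\<close> whose linear part is zero.
\<close>


section \<open>Enveloping algebras\<close>

text \<open>A quotient of the integral form could a priori collapse, so nonvanishing needs a
  functional on the enveloping algebra that kills the whole left ideal but not Z. The Kac-Moody
  algebra is given only by generators and properties, so there is no direct way to check that
  operators on words respect all its relations. Therefore no map into operators is defined: a Lie
  algebra of pairs (element, operator) takes its place, and it becomes an honest action on the
  functions killed by the fibre over 0. The character with all f_i sent to 1 suits this because
  brackets act on it by 0, so only linear parts must be controlled, and the grading by weights does
  that. The grading requires that weights be separated on the Cartan subalgebra. The simple coroots
  cannot see the null root; the scaling element d can. Degree singles out the leading term because,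
  among monomials of the fixed weight D gamma, those in simple root vectors alone have the largest
  degree. On the integral side, the factorials in the PBW monomials clear the denominators of
  divided powers and of Lambda_s, which puts Z into the integral form.\<close>

lemma uea_incl_add: "\<iota> (x + y) = \<iota> x + \<iota> y"
  by transfer (use uea_ideal.add_rel in \<open>simp add: uea_eq_def algebra_simps\<close>)

lemma uea_incl_scale: "\<iota> (c *\<^sub>C x) = uea_const c * \<iota> x"
  by transfer (use uea_ideal.scale_rel in \<open>simp add: uea_eq_def\<close>)

lemma uea_incl_lie: "\<iota> (lie x y) = \<iota> x * \<iota> y - \<iota> y * \<iota> x"
  by transfer (rule uea_ideal_minus_iff[of "_ - _" "_ :: 'a free_algebra", folded uea_eq_def], 
    simp add: uea_eq_def uea_ideal.bracket_rel)

lemma poly_mapping_add_induct [case_names zero single add]: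
  assumes "P 0" "\<And>k v. P (Poly_Mapping.single k v)" "\<And>f g. P f \<Longrightarrow> P g \<Longrightarrow> P (f + g)"
  shows "P f"
proof (induction f rule: update_induct)
  case (update f a b)
  have "Poly_Mapping.update a b f = f + Poly_Mapping.single a b"
    using update(1) by (intro poly_mapping_eqI)
      (auto simp: lookup_update lookup_add lookup_single when_def in_keys_iff)
  thus ?case using assms update by simp
qed (rule assms(1))

lemma single_zero_commutes:
  fixes p :: "'a::monoid_add \<Rightarrow>\<^sub>0 'b::comm_semiring_1"
  shows "Poly_Mapping.single 0 c * p = p * Poly_Mapping.single 0 c"
  by (induction p rule: poly_mapping_add_induct) (simp_all add: mult_single mult.commute algebra_simps)

lemma uea_const_commutes: "uea_const c * u = u * uea_const c"
  by transfer (simp add: single_zero_commutes uea_eq_def uea_ideal.zero)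

lemma uea_const_add: "uea_const (a + b) = uea_const a + uea_const b"
  by transfer (simp add: single_add uea_eq_def uea_ideal.zero)

lemma uea_const_mult: "uea_const (a * b) = uea_const a * uea_const b"
  by transfer (simp add: mult_single uea_eq_def uea_ideal.zero)

lemma uea_const_0 [simp]: "uea_const 0 = 0"
  by transfer (simp add: uea_eq_def uea_ideal.zero)

lemma uea_const_1 [simp]: "uea_const 1 = 1"
  by transfer (simp add: uea_eq_def uea_ideal.zero)

lemma uea_const_minus: "uea_const (- a) = - uea_const a"
  using uea_const_add[of a "- a"] by (simp add: eq_neg_iff_add_eq_0 add.commute)

lemma uea_const_diff: "uea_const (a - b) = uea_const a - uea_const b"
  using uea_const_add[of a "- b"] by (simp add: uea_const_minus)

lemma uea_const_of_nat: "uea_const (of_nat n) = of_nat n"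
  by (induction n) (simp_all add: uea_const_add)

lemma uea_const_of_int: "uea_const (of_int n) = of_int n"
  by (cases n) (simp_all add: uea_const_of_nat uea_const_minus uea_const_diff)

lemma uea_const_sum: "uea_const (sum f A) = (\<Sum>x\<in>A. uea_const (f x))"
  by (induction A rule: infinite_finite_induct) (simp_all add: uea_const_add)

lemma uea_incl_0 [simp]: "\<iota> 0 = 0"
  using uea_incl_add[of 0 0] by simp

lemma uea_incl_sum: "\<iota> (sum f A) = (\<Sum>x\<in>A. \<iota> (f x))"
  by (induction A rule: infinite_finite_induct) (simp_all add: uea_incl_add)

lemma of_nat_fact_mult_divided_power: "of_nat (fact n) * divided_power x n = x ^ n"
proof -
  have "of_nat (fact n) * divided_power x n = uea_const (of_nat (fact n) * (1 / fact n)) * x ^ n"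
    unfolding divided_power_def uea_const_mult uea_const_of_nat by (simp add: mult.assoc)
  thus ?thesis by simp
qed

lemma uea_binomial_1: "uea_binomial x (Suc 0) = x"
  by (simp add: uea_binomial_def)


section \<open>Subrings and left ideals\<close>

lemma subring_gen_0: "0 \<in> subring_gen S"
  using subring_gen.diff[OF subring_gen.one subring_gen.one] by simp

lemma subring_gen_uminus: "x \<in> subring_gen S \<Longrightarrow> - x \<in> subring_gen S"
  using subring_gen.diff[OF subring_gen_0] by force

lemma subring_gen_add: "x \<in> subring_gen S \<Longrightarrow> y \<in> subring_gen S \<Longrightarrow> x + y \<in> subring_gen S"
  using subring_gen.diff[of x S "- y"] by (simp add: subring_gen_uminus)

lemma subring_gen_of_nat: "of_nat n \<in> subring_gen S"
  by (induction n) (auto intro: subring_gen_0 subring_gen_add subring_gen.one)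

lemma subring_gen_of_int: "of_int n \<in> subring_gen S"
  by (cases n) (auto intro: subring_gen_of_nat subring_gen_uminus subring_gen.diff subring_gen.one)

lemma subring_gen_power: "x \<in> subring_gen S \<Longrightarrow> x ^ n \<in> subring_gen S"
  by (induction n) (auto intro: subring_gen.mult subring_gen.one)

lemma subring_gen_sum: "(\<And>x. x \<in> A \<Longrightarrow> f x \<in> subring_gen S) \<Longrightarrow> sum f A \<in> subring_gen S"
  by (induction A rule: infinite_finite_induct) (auto intro: subring_gen_0 subring_gen_add)

lemma subring_gen_prod_list: "(\<And>x. x \<in> set xs \<Longrightarrow> x \<in> subring_gen S) \<Longrightarrow> prod_list xs \<in> subring_gen S"
  by (induction xs) (auto intro: subring_gen.mult subring_gen.one)

lemma subring_gen_least:
  assumes "S \<subseteq> subring_gen T"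
  shows "subring_gen S \<subseteq> subring_gen T"
proof
  fix x assume "x \<in> subring_gen S"
  thus "x \<in> subring_gen T"
    by induction (use assms in \<open>auto intro: subring_gen.intros\<close>)
qed

lemma left_ideal_gen_add:
  "x \<in> left_ideal_gen R S \<Longrightarrow> y \<in> left_ideal_gen R S \<Longrightarrow> x + y \<in> left_ideal_gen R S"
  by (induction rule: left_ideal_gen.induct)
    (simp_all add: add.assoc left_ideal_gen.add)

lemma left_ideal_gen_mult:
  assumes "x \<in> left_ideal_gen R S" "u \<in> R" "\<And>a b. a \<in> R \<Longrightarrow> b \<in> R \<Longrightarrow> a * b \<in> R"
  shows "u * x \<in> left_ideal_gen R S"
  using assms(1)
proof induction
  case (add v s x)
  hence "(u * v) * s + u * x \<in> left_ideal_gen R S"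
    using assms(2,3) by (intro left_ideal_gen.add)
  thus ?case by (simp add: algebra_simps)
qed (simp add: left_ideal_gen.zero)

lemma left_ideal_gen_base: "u \<in> R \<Longrightarrow> s \<in> S \<Longrightarrow> u * s \<in> left_ideal_gen R S"
  using left_ideal_gen.add[OF _ _ left_ideal_gen.zero] by force

lemma left_ideal_gen_mono: "S \<subseteq> T \<Longrightarrow> x \<in> left_ideal_gen R S \<Longrightarrow> x \<in> left_ideal_gen R T"
  by (rotate_tac, induction rule: left_ideal_gen.induct) (auto intro: left_ideal_gen.intros)

text \<open>Left coefficients are untouched by right multiplication, so it is enough to test
  generators. With \<open>z\<close> the Shapovalov element this yields well-definedness on the Verma
  quotient.\<close>

lemma left_ideal_gen_mult_right:
  assumes "x \<in> left_ideal_gen R S" "\<And>a b. a \<in> R \<Longrightarrow> b \<in> R \<Longrightarrow> a * b \<in> R"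
    and "\<And>s. s \<in> S \<Longrightarrow> s * z \<in> left_ideal_gen R T"
  shows "x * z \<in> left_ideal_gen R T"
  using assms(1)
  by induction
    (auto simp: distrib_right mult.assoc intro: left_ideal_gen.zero left_ideal_gen_add left_ideal_gen_mult assms(2,3))


section \<open>The integral form\<close>

lemma U_int_mult: "u \<in> U_int K \<Longrightarrow> v \<in> U_int K \<Longrightarrow> u * v \<in> U_int K"
  and U_int_add: "u \<in> U_int K \<Longrightarrow> v \<in> U_int K \<Longrightarrow> u + v \<in> U_int K"
  and U_int_1: "1 \<in> U_int K"
  and U_int_0: "0 \<in> U_int K"
  and U_int_of_int: "of_int n \<in> U_int K"
  unfolding U_int_def
  by (auto intro: subring_gen.intros subring_gen_0 subring_gen_add subring_gen_uminus subring_gen_of_int)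

lemma U_minus_int_subset: "U_minus_int K \<subseteq> U_int K"
  unfolding U_minus_int_def U_int_def
  by (rule subring_gen_least) (blast intro: subring_gen.gen)

lemma subring_gen_subset_U_int: "S \<subseteq> U_int K \<Longrightarrow> subring_gen S \<subseteq> U_int K"
  unfolding U_int_def by (rule subring_gen_least)

lemma U_int_h_int: "x \<in> h_int K \<Longrightarrow> \<iota> x \<in> U_int K"
  unfolding U_int_def by (rule subring_gen.gen) (metis (mono_tags, lifting) UnI2 mem_Collect_eq uea_binomial_1)

lemma hh_in_h_int: assumes "i \<le> rk K" shows "hh K i \<in> h_int K"
proof -
  have "hh K i = (\<Sum>j\<le>rk K. of_int (if j = i then 1 else 0) *\<^sub>C hh K j) + of_int 0 *\<^sub>C dd K"
  proof -
    have "(\<Sum>j\<le>rk K. of_int (if j = i then 1 else 0) *\<^sub>C hh K j) = (\<Sum>j\<le>rk K. if j = i then hh K j else 0)"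
      by (rule sum.cong) auto
    thus ?thesis using assms by simp
  qed
  thus ?thesis unfolding h_int_def mem_Collect_eq
    by (intro exI[of _ "\<lambda>j. if j = i then 1 else 0"] exI[of _ 0] conjI TrueI)
qed

lemma U_b_minus_int_subset: "U_b_minus_int K \<subseteq> U_int K"
proof -
  have "\<iota> (x + y) \<in> U_int K" if "x \<in> n_minus_int K" "y \<in> h_int K" for x y
    using that U_minus_int_subset[of K] U_int_h_int
    by (auto simp: uea_incl_add n_minus_int_def intro!: U_int_add)
  hence "\<iota> ` b_minus_int K \<subseteq> U_int K"
    unfolding b_minus_int_def by blast
  thus ?thesis
    unfolding U_b_minus_int_def U_int_def by (rule subring_gen_least)
qed

section \<open>Denominators of the polynomials Lambda_s\<close>

lemma power_mult_fact_dvd_fact: "0 < j \<Longrightarrow> j ^ m * fact m dvd (fact (j * m) :: nat)"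
proof (induction m)
  case (Suc m)
  \<comment> \<open>The last factor j (m + 1) of the factorial supplies the new factors j and m + 1;
    what remains is divisible by the factorial of j m.\<close>
  have "j * Suc m = Suc (j * m + (j - 1))"
    using Suc.prems by simp
  hence fact: "fact (j * Suc m) = fact (j * m + (j - 1)) * (j * Suc m)"
    by (metis fact_Suc mult.commute of_nat_id)
  have "j ^ m * fact m dvd (fact (j * m + (j - 1)) :: nat)"
    using Suc.IH[OF Suc.prems] by (rule dvd_trans) (rule fact_dvd, simp)
  hence "(j ^ m * fact m) * (j * Suc m) dvd (fact (j * m + (j - 1)) :: nat) * (j * Suc m)"
    by (rule mult_dvd_mono) (rule dvd_refl)
  moreover have "j ^ Suc m * fact (Suc m) = (j ^ m * fact m) * (j * Suc m)"
    by (simp only: power_Suc fact_Suc of_nat_id mult_ac)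
  ultimately show ?case by (simp only: fact)
qed simp

lemma prod_fact_dvd_fact_sum: "finite A \<Longrightarrow> (\<Prod>j\<in>A. fact (f j)) dvd (fact (\<Sum>j\<in>A. f j) :: nat)"
proof (induction A rule: finite_induct)
  case (insert x A)
  have "fact (f x) * (\<Prod>j\<in>A. fact (f j)) dvd (fact (f x) * fact (sum f A) :: nat)"
    by (intro mult_dvd_mono insert.IH) simp
  also have "\<dots> dvd fact (f x + sum f A)"
    by (rule fact_fact_dvd_fact)
  finally show ?case using insert.hyps by simp
qed simp

text \<open>The product is the order of the centralizer of a permutation of s points with
  \<open>m j\<close> cycles of length j; the quotient counts the permutations of this cycle type.
  The proof enlarges each factor to \<open>fact (j * m j)\<close> and then uses the integrality of
  multinomial coefficients.\<close>

lemma cycle_type_weight_dvd_fact: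
  assumes "(\<Sum>j=1..s. j * m j) = s"
  shows "(\<Prod>j=1..s. j ^ m j * fact (m j)) dvd (fact s :: nat)"
proof -
  have "(\<Prod>j=1..s. j ^ m j * fact (m j)) dvd (\<Prod>j=1..s. fact (j * m j) :: nat)"
    by (rule prod_dvd_prod) (auto intro: power_mult_fact_dvd_fact)
  also have "\<dots> dvd fact (\<Sum>j=1..s. j * m j)"
    by (rule prod_fact_dvd_fact_sum) simp
  finally show ?thesis using assms by simp
qed

text \<open>\<open>Lambda\<close> is a cycle index polynomial whose denominators all divide
  \<open>fact s\<close>. Hence the factorial in front of each factor of a PBW monomial gives an
  integral polynomial in root vectors, for imaginary roots as well.\<close>

lemma fact_mult_Lambda_in_subring_gen:
  assumes "\<And>j. x j \<in> subring_gen S"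
  shows "of_nat (fact s) * Lambda s x \<in> subring_gen S"
  unfolding Lambda_def sum_distrib_left
proof (rule subring_gen_sum)
  fix m :: "nat \<Rightarrow> nat"
  assume "m \<in> {m. (\<forall>j. m j \<noteq> 0 \<longrightarrow> j \<in> {1..s}) \<and> (\<Sum>j=1..s. j * m j) = s}"
  hence "(\<Sum>j=1..s. j * m j) = s" by blast
  from cycle_type_weight_dvd_fact[OF this]
  obtain k :: nat where k: "fact s = (\<Prod>j=1..s. j ^ m j * fact (m j)) * k"
    by (elim dvdE)
  define P :: complex where "P = (\<Prod>j=1..s. of_nat j ^ m j * fact (m j))"
  have nz: "P \<noteq> 0"
    unfolding P_def by (subst prod_zero_iff) auto
  have fact_s: "of_nat (fact s) = P * of_nat k"
    unfolding k P_def of_nat_mult of_nat_prod of_nat_power of_nat_fact by (rule refl)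
  have "(\<Prod>j=1..s. 1 / (of_nat j ^ m j * fact (m j))) = 1 / P"
    unfolding P_def prod_dividef by (simp only: prod.neutral_const)
  hence "of_nat (fact s) * (\<Prod>j=1..s. 1 / (of_nat j ^ m j * fact (m j))) = (of_nat k :: complex)"
    unfolding fact_s using nz by simp
  hence "of_nat (fact s) * uea_const (\<Prod>j=1..s. 1 / (of_nat j ^ m j * fact (m j))) = (of_nat k :: 'a uea)"
    by (simp only: uea_const_mult[symmetric] uea_const_of_nat[symmetric])
  moreover have "of_nat k * prod_list (map (\<lambda>j. x j ^ m j) [1..<Suc s]) \<in> subring_gen S"
  proof (intro subring_gen.mult subring_gen_of_nat subring_gen_prod_list)
    fix y assume "y \<in> set (map (\<lambda>j. x j ^ m j) [1..<Suc s])"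
    thus "y \<in> subring_gen S" by (auto intro: subring_gen_power assms simp del: upt_Suc)
  qed
  ultimately show "of_nat (fact s) * (uea_const (\<Prod>j=1..s. 1 / (of_nat j ^ m j * fact (m j))) *
      prod_list (map (\<lambda>j. x j ^ m j) [1..<Suc s])) \<in> subring_gen S"
    by (simp only: mult.assoc[symmetric])
qed


section \<open>PBW monomials\<close>

lemma sorted_wrt_distinct_set_unique:
  assumes "antisym r" "sorted_wrt (\<lambda>a b. (a, b) \<in> r) xs" "sorted_wrt (\<lambda>a b. (a, b) \<in> r) ys"
    and "distinct xs" "distinct ys" "set xs = set ys"
  shows "xs = ys"
  using assms(2-)
proof (induction xs arbitrary: ys)
  case (Cons x xs)
  then obtain y zs where ys: "ys = y # zs" by (cases ys) auto
  have "x = y"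
  proof (rule ccontr)
    assume "x \<noteq> y"
    hence "(x, y) \<in> r" "(y, x) \<in> r" using Cons.prems unfolding ys by auto
    thus False using \<open>x \<noteq> y\<close> assms(1) by (auto dest: antisymD)
  qed
  moreover have "set xs = set zs" using Cons.prems \<open>x = y\<close> unfolding ys by auto
  ultimately show ?case using Cons.IH[of zs] Cons.prems unfolding ys by simp
qed simp

lemma ordered_list_exists:
  assumes lin: "linear_order_on A r" and "finite S" "S \<subseteq> A"
  shows "\<exists>bs. set bs = S \<and> distinct bs \<and> sorted_wrt (\<lambda>a b. (a, b) \<in> r) bs"
  using assms(2,3)
proof (induction S rule: finite_induct)
  case (insert x S)
  then obtain bs where bs: "set bs = S" "distinct bs" "sorted_wrt (\<lambda>a b. (a, b) \<in> r) bs"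
    by auto
  have "trans r" "antisym r" "total_on A r" "refl_on A r"
    using lin by (auto simp: linear_order_on_def partial_order_on_def preorder_on_def)
  let ?cs = "filter (\<lambda>b. (b, x) \<in> r) bs @ [x] @ filter (\<lambda>b. (b, x) \<notin> r) bs"
  have ge: "(x, b) \<in> r" if "b \<in> set bs" "(b, x) \<notin> r" for b
    using \<open>total_on A r\<close> that insert bs by (auto simp: total_on_def)
  have "sorted_wrt (\<lambda>a b. (a, b) \<in> r) ?cs"
    unfolding sorted_wrt_append using bs(3) ge transD[OF \<open>trans r\<close>]
    by (simp add: sorted_wrt_filter) blast
  moreover have "set ?cs = insert x S" "distinct ?cs"
    using bs insert by auto
  ultimately show ?case by blast
qed simp

text \<open>\<open>ordered_list\<close> is a definite description, so the factors of a PBW monomial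
  become accessible only through existence and uniqueness of the sorted enumeration.\<close>

lemma ordered_list:
  assumes "linear_order_on A r" "finite S" "S \<subseteq> A"
  shows set_ordered_list: "set (ordered_list r S) = S"
    and distinct_ordered_list: "distinct (ordered_list r S)"
proof -
  have "\<exists>!bs. set bs = S \<and> distinct bs \<and> sorted_wrt (\<lambda>a b. (a, b) \<in> r) bs"
  proof (rule ex_ex1I[OF ordered_list_exists[OF assms]])
    have "antisym r"
      using assms(1) by (auto simp: linear_order_on_def partial_order_on_def)
    thus "bs = cs" if "set bs = S \<and> distinct bs \<and> sorted_wrt (\<lambda>a b. (a, b) \<in> r) bs"
      "set cs = S \<and> distinct cs \<and> sorted_wrt (\<lambda>a b. (a, b) \<in> r) cs" for bs cs
      using that by (intro sorted_wrt_distinct_set_unique[of r]) auto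
  qed
  from theI'[OF this, folded ordered_list_def]
  show "set (ordered_list r S) = S" "distinct (ordered_list r S)" by auto
qed

text \<open>This says that [h, u] = w u. Written with the shifted h on the right, it composes under
  products without subtraction and moves polynomials in h past u directly.\<close>

definition ad_weight :: "'g::complex_lie_algebra \<Rightarrow> complex \<Rightarrow> 'g uea \<Rightarrow> bool" where
  "ad_weight h w u \<longleftrightarrow> \<iota> h * u = u * (\<iota> h + uea_const w)"

lemma ad_weight_const: "ad_weight h 0 (uea_const c)"
  by (simp add: ad_weight_def uea_const_commutes)

lemma ad_weight_of_nat: "ad_weight h 0 (of_nat n)"
  using ad_weight_const[of h "of_nat n"] by (simp add: uea_const_of_nat)

lemma ad_weight_1: "ad_weight h 0 1"
  by (simp add: ad_weight_def)

lemma ad_weight_0: "ad_weight h w 0"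
  by (simp add: ad_weight_def)

lemma ad_weight_add: "ad_weight h w u \<Longrightarrow> ad_weight h w v \<Longrightarrow> ad_weight h w (u + v)"
  by (simp add: ad_weight_def distrib_left distrib_right)

lemma ad_weight_diff: "ad_weight h w u \<Longrightarrow> ad_weight h w v \<Longrightarrow> ad_weight h w (u - v)"
  by (simp add: ad_weight_def left_diff_distrib right_diff_distrib)

lemma ad_weight_sum: "(\<And>x. x \<in> A \<Longrightarrow> ad_weight h w (f x)) \<Longrightarrow> ad_weight h w (sum f A)"
  by (induction A rule: infinite_finite_induct) (auto intro: ad_weight_0 ad_weight_add)

lemma ad_weight_mult:
  assumes "ad_weight h a u" "ad_weight h b v"
  shows "ad_weight h (a + b) (u * v)"
proof -
  have "\<iota> h * (u * v) = (\<iota> h * u) * v" by (simp only: mult.assoc)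
  also have "\<dots> = u * (\<iota> h * v + uea_const a * v)"
    using assms(1) by (simp only: ad_weight_def mult.assoc distrib_right)
  also have "uea_const a * v = v * uea_const a" by (rule uea_const_commutes)
  also have "\<iota> h * v = v * (\<iota> h + uea_const b)"
    using assms(2) by (simp only: ad_weight_def)
  also have "u * (v * (\<iota> h + uea_const b) + v * uea_const a) = u * v * (\<iota> h + uea_const (a + b))"
    by (simp add: uea_const_add distrib_left add_ac mult.assoc)
  finally show ?thesis by (simp add: ad_weight_def)
qed

lemma ad_weight_power: "ad_weight h a u \<Longrightarrow> ad_weight h (of_nat n * a) (u ^ n)"
  by (induction n) (auto simp: algebra_simps ad_weight_1 dest: ad_weight_mult)

lemma ad_weight_prod_list:
  "(\<And>x. x \<in> set xs \<Longrightarrow> ad_weight h (w x) (f x)) \<Longrightarrow>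
     ad_weight h (\<Sum>x\<leftarrow>xs. w x) (\<Prod>x\<leftarrow>xs. f x)"
  by (induction xs) (auto intro: ad_weight_1 ad_weight_mult)

lemma ad_weight_uea_incl: "lie h x = 0 \<Longrightarrow> ad_weight h 0 (\<iota> x)"
  using uea_incl_lie[of h x] by (simp add: ad_weight_def)

text \<open>Each linear factor passes \<open>Z\<close> separately, and its constant drops by
  \<open>w\<close>. For the Shapovalov element \<open>w\<close> is -D gamma(h), so if
  \<open>l\<close> is the value of lambda at h, the constant on the left is the value of mu.\<close>

lemma uea_binomial_mult_ad_weight:
  assumes "ad_weight h w Z"
  shows "uea_binomial (\<iota> h - uea_const (l + w)) n * Z = Z * uea_binomial (\<iota> h - uea_const l) n"
proof -
  have step: "(\<iota> h - uea_const (l + w) - of_nat k) * Z = Z * (\<iota> h - uea_const l - of_nat k)" for k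
  proof -
    have "(\<iota> h - uea_const (l + w) - of_nat k) * Z = \<iota> h * Z - uea_const (l + w + of_nat k) * Z"
      by (simp only: left_diff_distrib uea_const_add[of "l + w"] uea_const_of_nat distrib_right diff_diff_eq)
    also have "\<dots> = Z * (\<iota> h + uea_const w) - Z * uea_const (l + w + of_nat k)"
      using assms by (simp only: ad_weight_def uea_const_commutes)
    also have "\<dots> = Z * (\<iota> h - uea_const l - of_nat k)"
      by (simp add: uea_const_add uea_const_of_nat algebra_simps)
    finally show ?thesis .
  qed
  have "prod_list (map (\<lambda>k. \<iota> h - uea_const (l + w) - of_nat k) ks) * Z =
      Z * prod_list (map (\<lambda>k. \<iota> h - uea_const l - of_nat k) ks)" for ks
    by (induction ks) (simp_all add: mult.assoc, simp add: step flip: mult.assoc)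
  note prod = this
  show ?thesis
    unfolding uea_binomial_def mult.assoc prod
    by (simp only: mult.assoc[symmetric] uea_const_commutes[of _ Z])
qed

lemma root_functional_uminus: "root_functional K (\<lambda>j. - k j) x = - root_functional K k x"
  by (simp add: root_functional_def sum_negf)

lemma root_functional_int_mult:
  "root_functional K (\<lambda>j. c * k j) x = of_int c * root_functional K k x"
  by (simp add: root_functional_def sum_distrib_left mult.assoc)

lemma ad_weight_root_space:
  assumes "x \<in> root_space K k" "h \<in> cartan K"
  shows "ad_weight h (root_functional K k h) (\<iota> x)"
proof -
  have "\<iota> h * \<iota> x - \<iota> x * \<iota> h = uea_const (root_functional K k h) * \<iota> x"
    using assms by (simp add: root_space_def uea_incl_scale flip: uea_incl_lie)
  thus ?thesis
    by (simp add: ad_weight_def uea_const_commutes algebra_simps)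
qed

lemma root_functional_kpart_wt:
  "root_functional K (kpart_wt p) h = (\<Sum>b\<in>kpart_supp p. of_nat (p b) * root_functional K (fst b) h)"
  unfolding root_functional_def kpart_wt_def
  by (simp add: sum_distrib_left sum_distrib_right mult.assoc, subst sum.swap, rule refl)

locale root_vectors =
  fixes K :: "('g::complex_lie_algebra, 'z) km_data_scheme"
    and ord :: "root_index rel" and rv :: "(nat \<Rightarrow> int) \<Rightarrow> nat \<Rightarrow> 'g"
  assumes linear_order: "linear_order_on (root_indices K) ord"
    and root_vectors: "integral_root_vectors K rv"
begin

lemma
  assumes "(\<beta>, i) \<in> root_indices K"
  shows rv_in_root_space: "rv \<beta> i \<in> root_space K (\<lambda>j. - \<beta> j)"
    and rv_in_n_minus_int: "rv \<beta> i \<in> n_minus_int K"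
proof -
  have "\<beta> \<in> positive_roots K" "i \<in> {1..cdim (root_space K \<beta>)}"
    using assms by (auto simp: root_indices_def)
  moreover from root_vectors \<open>\<beta> \<in> _\<close>
  have "cspan (rv \<beta> ` {1..cdim (root_space K \<beta>)}) = root_space K (\<lambda>j. - \<beta> j)"
    and "rv \<beta> ` {1..cdim (root_space K \<beta>)} \<subseteq> n_minus_int K"
    by (simp_all add: integral_root_vectors_def Let_def)
  ultimately show "rv \<beta> i \<in> n_minus_int K" "rv \<beta> i \<in> root_space K (\<lambda>j. - \<beta> j)"
    using cvs.span_base[of "rv \<beta> i" "rv \<beta> ` {1..cdim (root_space K \<beta>)}"] by (metis imageI subset_iff)+
qed

lemma rv_simple_root: "i \<le> rk K \<Longrightarrow> rv (simple_root i) 1 = ff K i"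
  using root_vectors by (simp add: integral_root_vectors_def)

lemma rv_in_U_int: "(\<beta>, i) \<in> root_indices K \<Longrightarrow> \<iota> (rv \<beta> i) \<in> U_int K"
  using rv_in_n_minus_int U_minus_int_subset[of K] by (auto simp: n_minus_int_def)

lemma ad_weight_rv:
  "(\<beta>, i) \<in> root_indices K \<Longrightarrow> h \<in> cartan K \<Longrightarrow>
     ad_weight h (- root_functional K \<beta> h) (\<iota> (rv \<beta> i))"
  using ad_weight_root_space[OF rv_in_root_space] by (simp add: root_functional_uminus)

lemma fact_mult_root_divided_power_in_U_int:
  assumes "(\<beta>, i) \<in> root_indices K"
  shows "of_nat (fact s) * root_divided_power K rv (\<beta>, i) s \<in> U_int K"
proof (cases "\<beta> \<in> real_roots K")
  case True
  thus ?thesis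
    using rv_in_U_int[OF assms] subring_gen_power
    by (simp add: root_divided_power_def of_nat_fact_mult_divided_power U_int_def)
next
  case False
  have "(let \<beta>' = \<lambda>k. int j * \<beta> k in if (\<beta>', i) \<in> root_indices K then \<iota> (rv \<beta>' i) else 0) \<in> U_int K" for j
    by (simp add: Let_def rv_in_U_int U_int_0)
  with False show ?thesis
    unfolding root_divided_power_def U_int_def by (auto intro!: fact_mult_Lambda_in_subring_gen)
qed

text \<open>In the imaginary case the j-th variable has weight -j beta, and every monomial of
  Lambda_s satisfies sum j m_j = s; so all its monomials have weight -s beta. Variables set to 0 do
  no harm, because 0 has every weight.\<close>

lemma ad_weight_root_divided_power:
  assumes "(\<beta>, i) \<in> root_indices K" "h \<in> cartan K"
  shows "ad_weight h (- (of_nat s * root_functional K \<beta> h)) (root_divided_power K rv (\<beta>, i) s)"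
proof (cases "\<beta> \<in> real_roots K")
  case True
  have "ad_weight h (0 + of_nat s * - root_functional K \<beta> h) (divided_power (\<iota> (rv \<beta> i)) s)"
    unfolding divided_power_def
    by (intro ad_weight_mult ad_weight_const ad_weight_power ad_weight_rv assms)
  with True show ?thesis by (simp add: root_divided_power_def)
next
  case False
  define x where "x j = (let \<beta>' = \<lambda>k. int j * \<beta> k in
    if (\<beta>', i) \<in> root_indices K then \<iota> (rv \<beta>' i) else 0)" for j :: nat
  have x: "ad_weight h (- (of_nat j * root_functional K \<beta> h)) (x j)" for j
    using ad_weight_rv[of "\<lambda>k. int j * \<beta> k" i h] assms(2)
    by (simp add: x_def Let_def ad_weight_0 root_functional_int_mult)
  have "ad_weight h (- (of_nat s * root_functional K \<beta> h)) (Lambda s x)"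
    unfolding Lambda_def
  proof (rule ad_weight_sum)
    fix m :: "nat \<Rightarrow> nat"
    assume "m \<in> {m. (\<forall>j. m j \<noteq> 0 \<longrightarrow> j \<in> {1..s}) \<and> (\<Sum>j=1..s. j * m j) = s}"
    hence s: "(\<Sum>j=1..s. j * m j) = s" by blast
    have "ad_weight h (0 + (\<Sum>j\<leftarrow>[1..<Suc s]. of_nat (m j) * - (of_nat j * root_functional K \<beta> h)))
        (uea_const (\<Prod>j=1..s. 1 / (of_nat j ^ m j * fact (m j))) * (\<Prod>j\<leftarrow>[1..<Suc s]. x j ^ m j))"
      by (intro ad_weight_mult ad_weight_const ad_weight_prod_list ad_weight_power x)
    also have "0 + (\<Sum>j\<leftarrow>[1..<Suc s]. of_nat (m j) * - (of_nat j * root_functional K \<beta> h)) =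
        - (of_nat (\<Sum>j=1..s. j * m j) * root_functional K \<beta> h)"
      by (simp add: interv_sum_list_conv_sum_set_nat atLeastLessThanSuc_atLeastAtMost sum_negf
          sum_distrib_left sum_distrib_right algebra_simps del: upt_Suc)
    finally show "ad_weight h (- (of_nat s * root_functional K \<beta> h))
        (uea_const (\<Prod>j=1..s. 1 / (of_nat j ^ m j * fact (m j))) * (\<Prod>j\<leftarrow>[1..<Suc s]. x j ^ m j))"
      unfolding s .
  qed
  with False show ?thesis
    by (simp add: root_divided_power_def x_def[abs_def])
qed

lemma
  assumes "p \<in> kparts K"
  shows set_ordered_list_kpart: "set (ordered_list ord (kpart_supp p)) = kpart_supp p"
    and distinct_ordered_list_kpart: "distinct (ordered_list ord (kpart_supp p))"
  using ordered_list[OF linear_order] assms by (auto simp: kparts_def)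

lemma pbw_in_U_int:
  assumes "p \<in> kparts K"
  shows "pbw K ord rv p \<in> U_int K"
proof -
  have "of_nat (fact (p b)) * root_divided_power K rv b (p b) \<in> U_int K" if "b \<in> kpart_supp p" for b
    using that assms fact_mult_root_divided_power_in_U_int[of "fst b" "snd b" "p b"]
    by (auto simp: kparts_def)
  thus ?thesis
    unfolding pbw_def U_int_def
    by (intro subring_gen_prod_list) (auto simp: set_ordered_list_kpart[OF assms])
qed

lemma ad_weight_pbw:
  assumes "p \<in> kparts K" "h \<in> cartan K"
  shows "ad_weight h (- root_functional K (kpart_wt p) h) (pbw K ord rv p)"
proof -
  have "ad_weight h (\<Sum>b\<leftarrow>ordered_list ord (kpart_supp p). 0 + - (of_nat (p b) * root_functional K (fst b) h))
      (pbw K ord rv p)"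
    unfolding pbw_def
  proof (intro ad_weight_prod_list ad_weight_mult ad_weight_of_nat)
    fix b assume "b \<in> set (ordered_list ord (kpart_supp p))"
    hence "b \<in> root_indices K"
      using assms(1) by (auto simp: set_ordered_list_kpart kparts_def)
    thus "ad_weight h (- (of_nat (p b) * root_functional K (fst b) h)) (root_divided_power K rv b (p b))"
      using ad_weight_root_divided_power[of "fst b" "snd b"] assms(2) by simp
  qed
  also have "(\<Sum>b\<leftarrow>ordered_list ord (kpart_supp p). 0 + - (of_nat (p b) * root_functional K (fst b) h)) =
      - root_functional K (kpart_wt p) h"
    using assms(1)
    by (simp add: sum_list_distinct_conv_sum_set distinct_ordered_list_kpart set_ordered_list_kpart
        root_functional_kpart_wt sum_negf)
  finally show ?thesis .
qed

end


section \<open>Verma modules over the integral form\<close>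

lemma verma_ideal_0: "0 \<in> verma_ideal K l"
  unfolding verma_ideal_def by (rule left_ideal_gen.zero)

lemma verma_ideal_add: "x \<in> verma_ideal K l \<Longrightarrow> y \<in> verma_ideal K l \<Longrightarrow> x + y \<in> verma_ideal K l"
  unfolding verma_ideal_def by (rule left_ideal_gen_add)

lemma verma_ideal_mult: "u \<in> U_int K \<Longrightarrow> x \<in> verma_ideal K l \<Longrightarrow> u * x \<in> verma_ideal K l"
  unfolding verma_ideal_def by (rule left_ideal_gen_mult) (auto intro: U_int_mult)

lemma mult_uea_binomial_in_verma_ideal:
  assumes "u \<in> U_int K" "x \<in> insert (dd K) (hh K ` {..rk K})" "m \<ge> 1"
  shows "u * uea_binomial (\<iota> x - uea_const (l x)) m \<in> verma_ideal K l"
  unfolding verma_ideal_def by (rule left_ideal_gen_base) (use assms in blast)+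

lemma verma_coset_self: "u \<in> verma_coset K l u"
  unfolding verma_coset_def using verma_ideal_0 by force

lemma mem_verma_coset: "x \<in> verma_coset K l u \<longleftrightarrow> x - u \<in> verma_ideal K l"
  unfolding verma_coset_def by (auto intro!: exI[of _ "x - u"])

lemma coset_add_verma_coset:
  "coset_add (verma_coset K l u) (verma_coset K l v) = verma_coset K l (u + v)"
proof (intro Set.set_eqI iffI)
  fix x assume "x \<in> coset_add (verma_coset K l u) (verma_coset K l v)"
  then obtain a b where "x = a + b" "a - u \<in> verma_ideal K l" "b - v \<in> verma_ideal K l"
    by (auto simp: coset_add_def mem_verma_coset)
  thus "x \<in> verma_coset K l (u + v)"
    using verma_ideal_add[of "a - u" K l "b - v"] by (simp add: mem_verma_coset algebra_simps)
next
  fix x assume "x \<in> verma_coset K l (u + v)"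
  hence "x - v \<in> verma_coset K l u" by (simp add: mem_verma_coset algebra_simps)
  thus "x \<in> coset_add (verma_coset K l u) (verma_coset K l v)"
    unfolding coset_add_def using verma_coset_self[of v] by force
qed

lemma verma_act_verma_coset:
  assumes "u \<in> U_int K"
  shows "verma_act K l u (verma_coset K l v) = verma_coset K l (u * v)"
proof (intro Set.set_eqI iffI)
  fix x assume "x \<in> verma_act K l u (verma_coset K l v)"
  then obtain a b where "x = u * a + b" "a - v \<in> verma_ideal K l" "b \<in> verma_ideal K l"
    by (auto simp: verma_act_def mem_verma_coset)
  thus "x \<in> verma_coset K l (u * v)"
    using verma_ideal_add[OF verma_ideal_mult[OF assms, of "a - v" l], of b]
    by (simp add: mem_verma_coset algebra_simps)
next
  fix x assume "x \<in> verma_coset K l (u * v)"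
  hence "x = u * v + (x - u * v)" "x - u * v \<in> verma_ideal K l"
    by (simp_all add: mem_verma_coset)
  thus "x \<in> verma_act K l u (verma_coset K l v)"
    unfolding verma_act_def using verma_coset_self[of v] by blast
qed

lemma verma_hom_right_mult:
  assumes "Z \<in> U_int K" and "\<And>x. x \<in> verma_ideal K m \<Longrightarrow> x * Z \<in> verma_ideal K l"
  obtains \<phi> where "verma_hom K m l \<phi>" "\<And>u. \<phi> (verma_coset K m u) = verma_coset K l (u * Z)"
proof
  \<comment> \<open>Adding the target ideal makes each value a full coset and avoids choosing
    representatives.\<close>
  define \<phi> where "\<phi> X = {x * Z + y | x y. x \<in> X \<and> y \<in> verma_ideal K l}" for X
  show eq: "\<phi> (verma_coset K m u) = verma_coset K l (u * Z)" for u
  proof (intro Set.set_eqI iffI)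
    fix x assume "x \<in> \<phi> (verma_coset K m u)"
    then obtain a b where "x = a * Z + b" "a - u \<in> verma_ideal K m" "b \<in> verma_ideal K l"
      by (auto simp: \<phi>_def mem_verma_coset)
    thus "x \<in> verma_coset K l (u * Z)"
      using verma_ideal_add[OF assms(2)[of "a - u"], of b] by (simp add: mem_verma_coset algebra_simps)
  next
    fix x assume "x \<in> verma_coset K l (u * Z)"
    hence "x = u * Z + (x - u * Z)" "x - u * Z \<in> verma_ideal K l"
      by (simp_all add: mem_verma_coset)
    thus "x \<in> \<phi> (verma_coset K m u)"
      unfolding \<phi>_def using verma_coset_self[of u] by blast
  qed
  show "verma_hom K m l \<phi>"
    unfolding verma_hom_def verma_def
    by (auto simp: eq coset_add_verma_coset verma_act_verma_coset distrib_right mult.assoc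
        intro!: U_int_mult assms(1))
qed


section \<open>Kac--Moody algebras and their Cartan subalgebras\<close>

lemma subspace_cartan: "cvs.subspace (cartan K)"
  unfolding cartan_def by (rule cvs.subspace_span)

lemma hh_in_cartan: "i \<le> rk K \<Longrightarrow> hh K i \<in> cartan K"
  and dd_in_cartan: "dd K \<in> cartan K"
  unfolding cartan_def by (auto intro: cvs.span_base)

lemma cartan_dual_scale: "l \<in> cartan_dual K \<Longrightarrow> x \<in> cartan K \<Longrightarrow> l (c *\<^sub>C x) = c * l x"
  and cartan_dual_add: "l \<in> cartan_dual K \<Longrightarrow> x \<in> cartan K \<Longrightarrow> y \<in> cartan K \<Longrightarrow> l (x + y) = l x + l y"
  by (auto simp: cartan_dual_def)

lemma cartan_dual_0: "l \<in> cartan_dual K \<Longrightarrow> l 0 = 0"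
  using cartan_dual_scale[OF _ cvs.subspace_0[OF subspace_cartan], of l K 0] by simp

lemma cartan_dual_sum:
  assumes "l \<in> cartan_dual K" "\<And>x. x \<in> A \<Longrightarrow> f x \<in> cartan K"
  shows "l (sum f A) = (\<Sum>x\<in>A. l (f x))"
  using assms(2)
proof (induction A rule: infinite_finite_induct)
  case (insert x A)
  hence "sum f A \<in> cartan K" by (intro cvs.subspace_sum[OF subspace_cartan]) auto
  thus ?case using insert by (simp add: cartan_dual_add[OF assms(1)])
qed (simp_all add: cartan_dual_0[OF assms(1)])

locale kac_moody =
  fixes K :: "('g::complex_lie_algebra, 'z) km_data_scheme"
  assumes affine_kac_moody: "affine_kac_moody K"
begin

lemma gcm: "generalized_cartan_matrix (Suc (rk K)) (gcm K)"
  and indecomposable: "indecomposable (Suc (rk K)) (gcm K)"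
  using affine_kac_moody by (auto simp: affine_kac_moody_def affine_type_def)

lemma alpha_in_cartan_dual: "j \<le> rk K \<Longrightarrow> alpha K j \<in> cartan_dual K"
  and alpha_hh: "i \<le> rk K \<Longrightarrow> j \<le> rk K \<Longrightarrow> alpha K j (hh K i) = of_int (gcm K $$ (i, j))"
  and alpha_dd: "j \<le> rk K \<Longrightarrow> alpha K j (dd K) = (if j = 0 then 1 else 0)"
  and lie_cartan_cartan: "x \<in> cartan K \<Longrightarrow> y \<in> cartan K \<Longrightarrow> lie x y = 0"
  and lie_cartan_ee: "x \<in> cartan K \<Longrightarrow> i \<le> rk K \<Longrightarrow> lie x (ee K i) = alpha K i x *\<^sub>C ee K i"
  and lie_cartan_ff: "x \<in> cartan K \<Longrightarrow> i \<le> rk K \<Longrightarrow> lie x (ff K i) = (- alpha K i x) *\<^sub>C ff K i"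
  and lie_ee_ff: "i \<le> rk K \<Longrightarrow> j \<le> rk K \<Longrightarrow> lie (ee K i) (ff K j) = (if i = j then hh K i else 0)"
  and generated: "lie_subalgebra_gen (cartan K \<union> ee K ` {..rk K} \<union> ff K ` {..rk K}) = UNIV"
  using affine_kac_moody by (simp_all add: affine_kac_moody_def)

lemma hh_nonzero: "i \<le> rk K \<Longrightarrow> hh K i \<noteq> 0"
  using affine_kac_moody cvs.dependent_zero[of "insert (dd K) (hh K ` {..rk K})"]
  by (force simp: affine_kac_moody_def)

lemma ad_weight_subring_gen_hh:
  assumes "h \<in> cartan K" "q \<in> subring_gen ((\<lambda>i. \<iota> (hh K i)) ` {..rk K})"
  shows "ad_weight h 0 q"
  using assms(2)
proof induction
  case (gen x)
  thus ?case using lie_cartan_cartan[OF assms(1) hh_in_cartan] by (auto intro: ad_weight_uea_incl)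
next
  case (mult x y)
  thus ?case using ad_weight_mult[of h 0 x 0 y] by simp
qed (simp_all add: ad_weight_1 ad_weight_diff)

end

section \<open>Shapovalov elements and Verma ideals\<close>

locale kac_moody_root_vectors = kac_moody K + root_vectors K ord rv
  for K :: "('g::complex_lie_algebra, 'z) km_data_scheme"
    and ord :: "root_index rel" and rv :: "(nat \<Rightarrow> int) \<Rightarrow> nat \<Rightarrow> 'g"
begin

lemma shapovalov_in_U_int:
  assumes "integral_shapovalov K \<rho> ord rv \<gamma> D Z"
  shows "Z \<in> U_int K"
proof -
  from assms obtain q where q: "\<And>p. q p \<noteq> 0 \<Longrightarrow> p \<in> kparts K"
      "\<And>p. q p \<in> subring_gen ((\<lambda>i. \<iota> (hh K i)) ` {..rk K})"
    and Z: "Z = (\<Sum>p | q p \<noteq> 0. pbw K ord rv p * q p)"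
    unfolding integral_shapovalov_def by blast
  have "subring_gen ((\<lambda>i. \<iota> (hh K i)) ` {..rk K}) \<subseteq> U_int K"
    by (intro subring_gen_subset_U_int) (auto intro: U_int_h_int hh_in_h_int)
  hence "pbw K ord rv p * q p \<in> U_int K" if "q p \<noteq> 0" for p
    using q that by (intro U_int_mult pbw_in_U_int) auto
  thus ?thesis
    unfolding Z U_int_def by (intro subring_gen_sum) (simp only: mem_Collect_eq)
qed

lemma ad_weight_shapovalov:
  assumes "integral_shapovalov K \<rho> ord rv \<gamma> D Z" "h \<in> cartan K"
  shows "ad_weight h (- (of_nat D * root_functional K \<gamma> h)) Z"
proof -
  from assms obtain q
    where q: "\<And>p. q p \<noteq> 0 \<Longrightarrow> p \<in> kparts K \<and> kpart_wt p = (\<lambda>k. int D * \<gamma> k)"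
      "\<And>p. q p \<in> subring_gen ((\<lambda>i. \<iota> (hh K i)) ` {..rk K})"
    and Z: "Z = (\<Sum>p | q p \<noteq> 0. pbw K ord rv p * q p)"
    unfolding integral_shapovalov_def by blast
  have "ad_weight h (- root_functional K (kpart_wt p) h + 0) (pbw K ord rv p * q p)" if "q p \<noteq> 0" for p
    using q that assms(2) by (intro ad_weight_mult ad_weight_pbw ad_weight_subring_gen_hh) auto
  thus ?thesis
    unfolding Z using q by (intro ad_weight_sum) (auto simp: root_functional_int_mult)
qed

text \<open>The coroot is an integer combination of simple coroots, and the binomials with m = 1 are
  linear, so the difference is an integer combination of generators of the ideal.\<close>

lemma coroot_minus_weight_in_verma_ideal:
  assumes "lam \<in> cartan_dual K"
  shows "\<iota> (coroot K \<gamma>) - uea_const (lam (coroot K \<gamma>)) \<in> verma_ideal K lam"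
proof -
  define c where "c = (THE c. root_coroot K \<gamma> c)"
  have "lam (coroot K \<gamma>) = (\<Sum>i\<le>rk K. of_int (c i) * lam (hh K i))"
    unfolding coroot_def c_def[symmetric]
    by (subst cartan_dual_sum[OF assms])
      (auto intro!: sum.cong cartan_dual_scale[OF assms] cvs.subspace_scale[OF subspace_cartan] hh_in_cartan)
  hence "uea_const (lam (coroot K \<gamma>)) = (\<Sum>i\<le>rk K. of_int (c i) * uea_const (lam (hh K i)))"
    by (simp add: uea_const_sum uea_const_mult uea_const_of_int)
  moreover have "\<iota> (coroot K \<gamma>) = (\<Sum>i\<le>rk K. of_int (c i) * \<iota> (hh K i))"
    unfolding coroot_def c_def[symmetric] by (simp add: uea_incl_sum uea_incl_scale uea_const_of_int)
  ultimately have "\<iota> (coroot K \<gamma>) - uea_const (lam (coroot K \<gamma>)) =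
      (\<Sum>i\<le>rk K. of_int (c i) * (\<iota> (hh K i) - uea_const (lam (hh K i))))"
    by (simp add: right_diff_distrib sum_subtractf)
  also have "\<dots> = (\<Sum>i\<le>rk K. of_int (c i) * uea_binomial (\<iota> (hh K i) - uea_const (lam (hh K i))) 1)"
    by (simp add: uea_binomial_1)
  also have "\<dots> \<in> verma_ideal K lam"
  proof -
    have "of_int (c i) * uea_binomial (\<iota> (hh K i) - uea_const (lam (hh K i))) 1 \<in> verma_ideal K lam"
      if "i \<le> rk K" for i
      using that by (intro mult_uea_binomial_in_verma_ideal U_int_of_int) auto
    hence "sum (\<lambda>i. of_int (c i) * uea_binomial (\<iota> (hh K i) - uea_const (lam (hh K i))) 1) A
        \<in> verma_ideal K lam" if "A \<subseteq> {..rk K}" for A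
      using that
      by (induction A rule: infinite_finite_induct) (auto intro: verma_ideal_0 verma_ideal_add)
    thus ?thesis by blast
  qed
  finally show ?thesis .
qed

text \<open>Only generators need testing. For divided powers of e_j this is property (Z2) evaluated
  on the hyperplane; a binomial in h centred at mu becomes one centred at lambda when it is moved
  past \<open>Z\<close>.\<close>

lemma verma_ideal_mult_shapovalov:
  assumes "lam \<in> hyperplane K \<rho> \<gamma> D"
    and \<mu>: "\<mu> = (\<lambda>x. lam x - of_nat D * root_functional K \<gamma> x)"
    and Z: "integral_shapovalov K \<rho> ord rv \<gamma> D Z"
    and "x \<in> verma_ideal K \<mu>"
  shows "x * Z \<in> verma_ideal K lam"
proof -
  have lam: "lam \<in> cartan_dual K" "lam (coroot K \<gamma>) + \<rho> (coroot K \<gamma>) = of_nat D"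
    using assms(1) by (auto simp: hyperplane_def)
  have e: "divided_power (\<iota> (ee K j)) m * Z \<in> verma_ideal K lam" if "j \<le> rk K" "m \<ge> 1" for j m
  proof -
    from Z have "\<forall>i\<le>rk K. \<forall>n>0.
        \<exists>x\<in>left_ideal_gen (U_int K) {divided_power (\<iota> (ee K j)) m | j m. j \<le> rk K \<and> m \<ge> 1}.
        \<exists>u\<in>U_b_minus_int K. divided_power (\<iota> (ee K i)) n * Z =
          x + u * (\<iota> (coroot K \<gamma>) + uea_const (\<rho> (coroot K \<gamma>)) - of_nat D)"
      unfolding integral_shapovalov_def by (elim conjE)
    note Z2 = this[rule_format, OF that(1)]
    have "m > 0" using that(2) by simp
    from Z2[OF this] obtain x u
      where x: "x \<in> left_ideal_gen (U_int K) {divided_power (\<iota> (ee K j)) m | j m. j \<le> rk K \<and> m \<ge> 1}"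
      and u: "u \<in> U_b_minus_int K"
      and eq: "divided_power (\<iota> (ee K j)) m * Z =
        x + u * (\<iota> (coroot K \<gamma>) + uea_const (\<rho> (coroot K \<gamma>)) - of_nat D)"
      by (elim bexE)
    \<comment> \<open>The hyperplane equation, solved for the constant: the second summand in (Z2)
      becomes a left multiple of h_gamma - lambda(h_gamma).\<close>
    have "uea_const (\<rho> (coroot K \<gamma>)) - of_nat D = - uea_const (lam (coroot K \<gamma>))"
      unfolding uea_const_of_nat[symmetric] uea_const_diff[symmetric] uea_const_minus[symmetric]
      using lam(2) by (intro arg_cong[of _ _ uea_const]) (simp add: algebra_simps)
    hence coroot: "\<iota> (coroot K \<gamma>) + uea_const (\<rho> (coroot K \<gamma>)) - of_nat D =
        \<iota> (coroot K \<gamma>) - uea_const (lam (coroot K \<gamma>))"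
      by (simp add: add_diff_eq[symmetric])
    have "x \<in> verma_ideal K lam"
      unfolding verma_ideal_def by (rule left_ideal_gen_mono[OF Un_upper1 x])
    thus ?thesis
      unfolding eq coroot using u U_b_minus_int_subset[of K] lam(1)
      by (intro verma_ideal_add verma_ideal_mult coroot_minus_weight_in_verma_ideal) auto
  qed
  have h: "uea_binomial (\<iota> y - uea_const (\<mu> y)) m * Z \<in> verma_ideal K lam"
    if "y \<in> insert (dd K) (hh K ` {..rk K})" "m \<ge> 1" for y m
  proof -
    have "y \<in> cartan K" using that(1) by (auto intro: dd_in_cartan hh_in_cartan)
    have "uea_binomial (\<iota> y - uea_const (\<mu> y)) m * Z = Z * uea_binomial (\<iota> y - uea_const (lam y)) m"
      using uea_binomial_mult_ad_weight[OF ad_weight_shapovalov[OF Z \<open>y \<in> cartan K\<close>], of "lam y" m]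
      by (simp add: \<mu>)
    thus ?thesis
      using mult_uea_binomial_in_verma_ideal[OF shapovalov_in_U_int[OF Z] that] by simp
  qed
  show ?thesis
    using assms(4) unfolding verma_ideal_def
    by (rule left_ideal_gen_mult_right) (use e h in \<open>auto intro: U_int_mult simp: verma_ideal_def\<close>)
qed

end


section \<open>Triangular decomposition\<close>

lemma lie_0_left [simp]: "lie 0 x = 0" and lie_0_right [simp]: "lie x 0 = 0"
  using lie_add_left[of 0 0 x] lie_add_right[of x 0 0] by simp_all

lemma lie_skew: "lie y x = - lie x y"
  using lie_self[of "x + y"] lie_self[of x] lie_self[of y]
  by (simp add: lie_add_left lie_add_right eq_neg_iff_add_eq_0 add.commute)

lemma lie_uminus_right: "lie x (- y) = - lie x y"
  using lie_add_right[of x y "- y"] by (simp add: eq_neg_iff_add_eq_0 add.commute)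

lemma lie_lie: "lie x (lie y z) = lie (lie x y) z + lie y (lie x z)"
proof -
  have "lie x (lie y z) = - lie y (lie z x) - lie z (lie x y)"
    using lie_jacobi[of x y z] by (simp add: eq_neg_iff_add_eq_0 add_ac eq_diff_eq)
  thus ?thesis
    using lie_skew[of x z] lie_skew[of "lie x y" z] by (simp add: lie_uminus_right add.commute)
qed

lemma lie_subalgebra_gen_mono: "S \<subseteq> T \<Longrightarrow> lie_subalgebra_gen S \<subseteq> lie_subalgebra_gen T"
proof
  fix x assume "S \<subseteq> T" "x \<in> lie_subalgebra_gen S"
  from this(2,1) show "x \<in> lie_subalgebra_gen T"
    by induction (auto intro: lie_subalgebra_gen.intros)
qed

lemma lie_subalgebra_gen_uminus: "x \<in> lie_subalgebra_gen S \<Longrightarrow> - x \<in> lie_subalgebra_gen S"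
  using lie_subalgebra_gen.scale[of x S "-1"] by simp

lemma lie_subalgebra_gen_diff:
  "x \<in> lie_subalgebra_gen S \<Longrightarrow> y \<in> lie_subalgebra_gen S \<Longrightarrow> x - y \<in> lie_subalgebra_gen S"
  using lie_subalgebra_gen.add[OF _ lie_subalgebra_gen_uminus] by force

lemma lie_normalizes_subalgebra_gen:
  assumes "\<And>s. s \<in> S \<Longrightarrow> \<exists>c. lie h s = c *\<^sub>C s" and "x \<in> lie_subalgebra_gen S"
  shows "lie h x \<in> lie_subalgebra_gen S"
  using assms(2)
proof induction
  case (gen x)
  then obtain c where c: "lie h x = c *\<^sub>C x" using assms(1) by blast
  show ?case unfolding c by (intro lie_subalgebra_gen.scale lie_subalgebra_gen.gen gen)
next
  case (bracket x y)
  thus ?case unfolding lie_lie[of h x y]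
    by (blast intro: lie_subalgebra_gen.add lie_subalgebra_gen.bracket)
qed (simp_all add: lie_add_right lie_scale_right lie_subalgebra_gen.intros(2-4))

text \<open>Only the generators themselves contribute to \<open>H\<close>. For a bracket, the Jacobi
  identity lets the \<open>H\<close> part of one factor act on the other factor, and
  \<open>H\<close> normalizes the subalgebra generated by \<open>E\<close>.\<close>

lemma lie_opposite_generator:
  assumes H: "cvs.subspace H"
    and hE: "\<And>h e. h \<in> H \<Longrightarrow> e \<in> E \<Longrightarrow> \<exists>c. lie h e = c *\<^sub>C e"
    and f: "\<And>e. e \<in> E \<Longrightarrow> lie f e \<in> H"
    and "x \<in> lie_subalgebra_gen E"
  shows "\<exists>h\<in>H. \<exists>y\<in>lie_subalgebra_gen E. lie f x = h + y"
  using assms(4)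
proof induction
  case (gen x)
  show ?case using f[OF gen]
    by (intro bexI[of _ "lie f x"] bexI[of _ 0]) (auto intro: lie_subalgebra_gen.zero)
next
  case zero
  show ?case using cvs.subspace_0[OF H] by (intro bexI[of _ 0]) (auto intro: lie_subalgebra_gen.zero)
next
  case (add x y)
  then obtain h a h' a' where "h \<in> H" "h' \<in> H" "a \<in> lie_subalgebra_gen E" "a' \<in> lie_subalgebra_gen E"
    "lie f x = h + a" "lie f y = h' + a'" by blast
  thus ?case using cvs.subspace_add[OF H]
    by (intro bexI[of _ "h + h'"] bexI[of _ "a + a'"])
      (auto simp: lie_add_right intro: lie_subalgebra_gen.add)
next
  case (scale x c)
  then obtain h a where "h \<in> H" "a \<in> lie_subalgebra_gen E" "lie f x = h + a" by blast
  thus ?case using cvs.subspace_scale[OF H]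
    by (intro bexI[of _ "c *\<^sub>C h"] bexI[of _ "c *\<^sub>C a"])
      (auto simp: lie_scale_right scaleC_add_right intro: lie_subalgebra_gen.scale)
next
  case (bracket x y)
  then obtain h a h' a' where *: "h \<in> H" "h' \<in> H" "a \<in> lie_subalgebra_gen E" "a' \<in> lie_subalgebra_gen E"
    "lie f x = h + a" "lie f y = h' + a'" by blast
  have "lie f (lie x y) = 0 + (lie h y - lie h' x + lie a y + lie x a')"
    using * lie_skew[of x h'] by (simp add: lie_lie[of f x y] lie_add_left lie_add_right)
  moreover have "lie h y - lie h' x + lie a y + lie x a' \<in> lie_subalgebra_gen E"
  proof (intro lie_subalgebra_gen.add lie_subalgebra_gen_diff)
    show "lie h y \<in> lie_subalgebra_gen E" "lie h' x \<in> lie_subalgebra_gen E"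
      using * bracket.hyps by (auto intro: lie_normalizes_subalgebra_gen hE)
    show "lie a y \<in> lie_subalgebra_gen E" "lie x a' \<in> lie_subalgebra_gen E"
      using * bracket.hyps by (auto intro: lie_subalgebra_gen.bracket)
  qed
  ultimately show ?case using cvs.subspace_0[OF H] by blast
qed

text \<open>The sum of the three pieces is stable under brackets with generators, hence with all
  they generate, and it contains the generators. Directness is not claimed, and only brackets
  between generators and \<open>H\<close> enter the assumptions; this lets the lemma be applied to
  pairs of an element and an operator.\<close>

lemma triangular_decomposition:
  assumes H: "cvs.subspace H"
    and HH: "\<And>x y. x \<in> H \<Longrightarrow> y \<in> H \<Longrightarrow> lie x y = 0"
    and HE: "\<And>h e. h \<in> H \<Longrightarrow> e \<in> E \<Longrightarrow> \<exists>c. lie h e = c *\<^sub>C e"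
    and HF: "\<And>h f. h \<in> H \<Longrightarrow> f \<in> F \<Longrightarrow> \<exists>c. lie h f = c *\<^sub>C f"
    and EF: "\<And>e f. e \<in> E \<Longrightarrow> f \<in> F \<Longrightarrow> lie e f \<in> H"
    and "x \<in> lie_subalgebra_gen (H \<union> E \<union> F)"
  obtains a h b where "a \<in> lie_subalgebra_gen F" "h \<in> H" "b \<in> lie_subalgebra_gen E" "x = a + h + b"
proof -
  define S where "S = {a + h + b | a h b. a \<in> lie_subalgebra_gen F \<and> h \<in> H \<and> b \<in> lie_subalgebra_gen E}"
  have SI: "a + h + b \<in> S" if "a \<in> lie_subalgebra_gen F" "h \<in> H" "b \<in> lie_subalgebra_gen E" for a h b
    using that unfolding S_def by blast
  have S_add: "s + t \<in> S" if "s \<in> S" "t \<in> S" for s t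
  proof -
    from that obtain a h b a' h' b' where "s = a + h + b" "t = a' + h' + b'"
      "a \<in> lie_subalgebra_gen F" "h \<in> H" "b \<in> lie_subalgebra_gen E"
      "a' \<in> lie_subalgebra_gen F" "h' \<in> H" "b' \<in> lie_subalgebra_gen E"
      unfolding S_def by blast
    thus ?thesis
      using SI[of "a + a'" "h + h'" "b + b'"]
      by (simp add: lie_subalgebra_gen.add cvs.subspace_add[OF H] add_ac)
  qed
  have S_scale: "c *\<^sub>C s \<in> S" if "s \<in> S" for c s
  proof -
    from that obtain a h b where "s = a + h + b"
      "a \<in> lie_subalgebra_gen F" "h \<in> H" "b \<in> lie_subalgebra_gen E"
      unfolding S_def by blast
    thus ?thesis
      using SI[of "c *\<^sub>C a" "c *\<^sub>C h" "c *\<^sub>C b"]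
      by (simp add: lie_subalgebra_gen.scale cvs.subspace_scale[OF H] scaleC_add_right)
  qed
  have S_F: "a \<in> S" if "a \<in> lie_subalgebra_gen F" for a
    using SI[OF that cvs.subspace_0[OF H] lie_subalgebra_gen.zero] by simp
  have S_H: "h \<in> S" if "h \<in> H" for h
    using SI[OF lie_subalgebra_gen.zero that lie_subalgebra_gen.zero] by simp
  have S_E: "b \<in> S" if "b \<in> lie_subalgebra_gen E" for b
    using SI[OF lie_subalgebra_gen.zero cvs.subspace_0[OF H] that] by simp
  have FE: "lie f e \<in> H" if "e \<in> E" "f \<in> F" for e f
    using EF[OF that] lie_skew[of f e] cvs.subspace_neg[OF H] by simp
  have gen_S: "lie g s \<in> S" if g: "g \<in> H \<union> E \<union> F" and s: "s \<in> S" for g s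
  proof -
    from s obtain a h b where s: "s = a + h + b" and
      abh: "a \<in> lie_subalgebra_gen F" "h \<in> H" "b \<in> lie_subalgebra_gen E"
      unfolding S_def by blast
    have "lie g a \<in> S \<and> lie g h \<in> S \<and> lie g b \<in> S"
      using g
    proof (elim UnE)
      assume "g \<in> H"
      thus ?thesis
        using S_F[OF lie_normalizes_subalgebra_gen[OF HF abh(1)]]
          S_E[OF lie_normalizes_subalgebra_gen[OF HE abh(3)]] S_H[OF cvs.subspace_0[OF H]] abh(2)
        by (auto simp: HH)
    next
      assume "g \<in> E"
      hence *: "g \<in> lie_subalgebra_gen E" by (rule lie_subalgebra_gen.gen)
      obtain h' y where "h' \<in> H" "y \<in> lie_subalgebra_gen F" "lie g a = h' + y"
        using lie_opposite_generator[OF H HF EF[OF \<open>g \<in> E\<close>] abh(1)] by blast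
      hence "lie g a \<in> S" using S_add[OF S_H S_F] by simp
      moreover have "lie g h \<in> S"
        using lie_normalizes_subalgebra_gen[OF HE[OF abh(2)] *] lie_skew[of g h]
        by (auto intro!: S_E lie_subalgebra_gen_uminus)
      ultimately show ?thesis using * abh by (auto intro: S_E lie_subalgebra_gen.bracket)
    next
      assume "g \<in> F"
      hence *: "g \<in> lie_subalgebra_gen F" by (rule lie_subalgebra_gen.gen)
      obtain h' y where "h' \<in> H" "y \<in> lie_subalgebra_gen E" "lie g b = h' + y"
        using lie_opposite_generator[OF H HE FE[OF _ \<open>g \<in> F\<close>] abh(3)] by blast
      hence "lie g b \<in> S" using S_add[OF S_H S_E] by simp
      moreover have "lie g h \<in> S"
        using lie_normalizes_subalgebra_gen[OF HF[OF abh(2)] *] lie_skew[of g h]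
        by (auto intro!: S_F lie_subalgebra_gen_uminus)
      ultimately show ?thesis using * abh by (auto intro: S_F lie_subalgebra_gen.bracket)
    qed
    thus ?thesis unfolding s lie_add_right by (auto intro: S_add)
  qed
  \<comment> \<open>By the Jacobi identity, the elements whose bracket maps \<open>S\<close> into
    itself form a Lie subalgebra.\<close>
  have lie_S: "lie z s \<in> S" if "z \<in> lie_subalgebra_gen (H \<union> E \<union> F)" "s \<in> S" for z s
    using that
  proof (induction arbitrary: s)
    case (bracket x y)
    have "lie (lie x y) s = lie x (lie y s) + (-1) *\<^sub>C lie y (lie x s)"
      unfolding lie_lie[of x y s] by simp
    moreover have "lie x (lie y s) + (-1) *\<^sub>C lie y (lie x s) \<in> S"
      by (intro S_add S_scale bracket.IH bracket.prems)
    ultimately show ?case by (simp only:)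
  qed (simp_all add: lie_add_left lie_scale_left gen_S S_add S_scale S_H cvs.subspace_0[OF H])
  have "x \<in> S"
    using assms(6)
  proof induction
    case (gen x)
    thus ?case using S_F S_H S_E lie_subalgebra_gen.gen by blast
  qed (simp_all add: S_add S_scale lie_S S_H cvs.subspace_0[OF H])
  thus ?thesis using that unfolding S_def by blast
qed

section \<open>Pairs of elements of two Lie algebras\<close>

instantiation prod :: (complex_lie_algebra, complex_lie_algebra) complex_lie_algebra
begin
definition "c *\<^sub>C z = (c *\<^sub>C fst z, c *\<^sub>C snd z)"
definition "lie y z = (lie (fst y) (fst z), lie (snd y) (snd z))"
instance
  by standard
    (simp_all add: prod_eq_iff scaleC_prod_def lie_prod_def scaleC_add_right scaleC_add_left
      lie_add_left lie_add_right lie_scale_left lie_scale_right lie_self lie_jacobi)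
end

lemma fst_scaleC [simp]: "fst (c *\<^sub>C z) = c *\<^sub>C fst z" and snd_scaleC [simp]: "snd (c *\<^sub>C z) = c *\<^sub>C snd z"
  and fst_lie [simp]: "fst (lie y z) = lie (fst y) (fst z)" and snd_lie [simp]: "snd (lie y z) = lie (snd y) (snd z)"
  by (simp_all add: scaleC_prod_def lie_prod_def)

lemma fst_in_lie_subalgebra_gen:
  "z \<in> lie_subalgebra_gen S \<Longrightarrow> fst z \<in> lie_subalgebra_gen (fst ` S)"
  by (induction rule: lie_subalgebra_gen.induct) (auto intro: lie_subalgebra_gen.intros)

text \<open>Every construction step in the first component can be mirrored in the second. The
  partner \<open>y\<close> may depend on how \<open>x\<close> is built from generators, so a
  relation results and not a map.\<close>

lemma lie_subalgebra_gen_fst_lift: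
  "x \<in> lie_subalgebra_gen (fst ` S) \<Longrightarrow> \<exists>y. (x, y) \<in> lie_subalgebra_gen S"
proof (induction rule: lie_subalgebra_gen.induct)
  case (gen x)
  then obtain y where "(x, y) \<in> S" by auto
  thus ?case using lie_subalgebra_gen.gen by blast
next
  case zero
  show ?case using lie_subalgebra_gen.zero[of S] by (auto simp: zero_prod_def)
next
  case (add x y)
  thus ?case using lie_subalgebra_gen.add[of "(x, _)" S "(y, _)"] by auto
next
  case (scale x c)
  thus ?case using lie_subalgebra_gen.scale[of "(x, _)" S c] by (auto simp: scaleC_prod_def)
next
  case (bracket x y)
  thus ?case using lie_subalgebra_gen.bracket[of "(x, _)" S "(y, _)"] by (auto simp: lie_prod_def)
qed


section \<open>Operators on functions of words\<close>

text \<open>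
  Functions on words in the letters \<open>f\<^sub>0, \<dots>, f\<^sub>r\<close> are the dual of the free algebra, on which the enveloping
  algebra is to act from the right; therefore \<open>X * Y\<close> first applies \<open>X\<close> and then \<open>Y\<close>.
\<close>

typedef word_op = "{X :: (nat list \<Rightarrow> complex) \<Rightarrow> nat list \<Rightarrow> complex.
    (\<forall>\<phi> \<psi>. X (\<lambda>w. \<phi> w + \<psi> w) = (\<lambda>w. X \<phi> w + X \<psi> w)) \<and> (\<forall>c \<phi>. X (\<lambda>w. c * \<phi> w) = (\<lambda>w. c * X \<phi> w))}"
  morphisms app Word_op
  by (rule exI[of _ id]) simp

setup_lifting type_definition_word_op

lemma app_add: "app X (\<lambda>w. \<phi> w + \<psi> w) = (\<lambda>w. app X \<phi> w + app X \<psi> w)"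
  and app_scale: "app X (\<lambda>w. c * \<phi> w) = (\<lambda>w. c * app X \<phi> w)"
  using app[of X] by auto

lemma app_zero: "app X (\<lambda>w. 0) = (\<lambda>w. 0)"
  using app_scale[of X 0] by simp

instantiation word_op :: ring_1
begin
lift_definition zero_word_op :: word_op is "\<lambda>\<phi> w. 0" by simp
lift_definition one_word_op :: word_op is "\<lambda>\<phi>. \<phi>" by simp
lift_definition plus_word_op :: "word_op \<Rightarrow> word_op \<Rightarrow> word_op" is "\<lambda>X Y \<phi> w. X \<phi> w + Y \<phi> w"
  by (simp add: algebra_simps fun_eq_iff)
lift_definition minus_word_op :: "word_op \<Rightarrow> word_op \<Rightarrow> word_op" is "\<lambda>X Y \<phi> w. X \<phi> w - Y \<phi> w"
  by (simp add: algebra_simps fun_eq_iff)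
lift_definition uminus_word_op :: "word_op \<Rightarrow> word_op" is "\<lambda>X \<phi> w. - X \<phi> w"
  by (simp add: fun_eq_iff)
lift_definition times_word_op :: "word_op \<Rightarrow> word_op \<Rightarrow> word_op" is "\<lambda>X Y \<phi>. Y (X \<phi>)"
  by simp
instance
proof
  show "(0 :: word_op) \<noteq> 1"
    by transfer (auto simp: fun_eq_iff intro!: exI[of _ "\<lambda>w. 1"])
qed (transfer; auto simp: fun_eq_iff algebra_simps; fail)+
end

instantiation word_op :: complex_lie_algebra
begin
lift_definition scaleC_word_op :: "complex \<Rightarrow> word_op \<Rightarrow> word_op" is "\<lambda>c X \<phi> w. c * X \<phi> w"
  by (simp add: algebra_simps fun_eq_iff)
definition "lie X Y = X * Y - Y * (X :: word_op)"
instance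
proof
  fix X Y Z :: word_op and a b :: complex
  have scale_mult: "(a *\<^sub>C X) * Y = a *\<^sub>C (X * Y)" "X * (a *\<^sub>C Y) = a *\<^sub>C (X * Y)" for a and X Y :: word_op
    by (transfer; simp)+
  have scale_diff: "a *\<^sub>C (X - Y) = a *\<^sub>C X - a *\<^sub>C Y" for a and X Y :: word_op
    by transfer (simp add: algebra_simps)
  show "lie (a *\<^sub>C X) Y = a *\<^sub>C lie X Y" "lie X (a *\<^sub>C Y) = a *\<^sub>C lie X Y"
    by (simp_all add: lie_word_op_def scale_mult scale_diff)
  show "a *\<^sub>C (X + Y) = a *\<^sub>C X + a *\<^sub>C Y" "(a + b) *\<^sub>C X = a *\<^sub>C X + b *\<^sub>C X"
    "a *\<^sub>C b *\<^sub>C X = (a * b) *\<^sub>C X" "1 *\<^sub>C X = X"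
    by (transfer; simp add: algebra_simps)+
qed (simp_all add: lie_word_op_def algebra_simps)
end

lemma app_plus: "app (X + Y) \<phi> w = app X \<phi> w + app Y \<phi> w"
  and app_minus: "app (X - Y) \<phi> w = app X \<phi> w - app Y \<phi> w"
  and app_uminus: "app (- X) \<phi> w = - app X \<phi> w"
  and app_times: "app (X * Y) \<phi> = app Y (app X \<phi>)"
  and app_scaleC: "app (c *\<^sub>C X) \<phi> w = c * app X \<phi> w"
  and app_0: "app 0 \<phi> w = 0"
  and app_1: "app 1 \<phi> = \<phi>"
  by (transfer; simp)+

lemma app_lie: "app (lie X Y) \<phi> w = app Y (app X \<phi>) w - app X (app Y \<phi>) w"
  by (simp add: lie_word_op_def app_minus app_times)

lemma scaleC_word_op_mult:
  fixes X Y :: word_op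
  shows "(a *\<^sub>C X) * Y = a *\<^sub>C (X * Y)" "X * (a *\<^sub>C Y) = a *\<^sub>C (X * Y)"
  by (transfer; simp)+


section \<open>Root spaces\<close>

text \<open>\<open>root_functional\<close> sees only the coefficients up to the rank. Fixing the
  others at 0 makes the encoding of a weight unique, as the separation of weights requires.\<close>

definition root_lattice :: "('g::complex_lie_algebra, 'z) km_data_scheme \<Rightarrow> (nat \<Rightarrow> int) set" where
  "root_lattice K = {k. \<forall>i>rk K. k i = 0}"

definition graded_sum ::
  "('g::complex_lie_algebra, 'z) km_data_scheme \<Rightarrow> (nat \<Rightarrow> int) set \<Rightarrow> 'g set" where
  "graded_sum K P = cspan (\<Union>k\<in>P. root_space K k)"

lemma root_space_subset_graded_sum: "k \<in> P \<Longrightarrow> root_space K k \<subseteq> graded_sum K P"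
  unfolding graded_sum_def by (rule subset_trans[OF UN_upper cvs.span_superset])

lemma subspace_graded_sum: "cvs.subspace (graded_sum K P)"
  unfolding graded_sum_def by (rule cvs.subspace_span)

lemma graded_sum_mono: "P \<subseteq> Q \<Longrightarrow> graded_sum K P \<subseteq> graded_sum K Q"
  unfolding graded_sum_def by (intro cvs.span_mono) blast

lemma root_functional_add:
  "root_functional K (\<lambda>i. k i + l i) x = root_functional K k x + root_functional K l x"
  by (simp add: root_functional_def distrib_right sum.distrib)

lemma root_functional_simple_root: "i \<le> rk K \<Longrightarrow> root_functional K (simple_root i) x = alpha K i x"
  by (simp add: root_functional_def simple_root_def if_distrib[of of_int] if_distrib[of "\<lambda>c. c * _"] cong: if_cong)

lemma subspace_root_space: "cvs.subspace (root_space K k)"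
proof (rule cvs.subspaceI)
  show "x + y \<in> root_space K k" if "x \<in> root_space K k" "y \<in> root_space K k" for x y
    using that by (simp add: root_space_def lie_add_right scaleC_add_right)
  show "c *\<^sub>C x \<in> root_space K k" if "x \<in> root_space K k" for c x
    using that by (simp add: root_space_def lie_scale_right mult.commute)
qed (simp add: root_space_def)

lemma lie_root_space:
  assumes "x \<in> root_space K k" "y \<in> root_space K l"
  shows "lie x y \<in> root_space K (\<lambda>i. k i + l i)"
  unfolding root_space_def
proof (intro CollectI ballI)
  fix h assume "h \<in> cartan K"
  hence "lie h x = root_functional K k h *\<^sub>C x" "lie h y = root_functional K l h *\<^sub>C y"
    using assms by (auto simp: root_space_def)
  thus "lie h (lie x y) = root_functional K (\<lambda>i. k i + l i) h *\<^sub>C lie x y"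
    by (simp add: lie_lie[of h x y] lie_scale_left lie_scale_right root_functional_add scaleC_add_left)
qed

lemma lie_graded_sum:
  assumes "x \<in> graded_sum K P" "y \<in> graded_sum K Q"
    and "\<And>k l. k \<in> P \<Longrightarrow> l \<in> Q \<Longrightarrow> (\<lambda>i. k i + l i) \<in> R"
  shows "lie x y \<in> graded_sum K R"
proof -
  have *: "lie x y \<in> graded_sum K R" if x: "x \<in> root_space K k" and "k \<in> P" for x k
    using assms(2) unfolding graded_sum_def[of K Q]
  proof (induction rule: cvs.span_induct_alt)
    case (step c z y)
    then obtain l where "l \<in> Q" "z \<in> root_space K l" by blast
    hence "lie x z \<in> graded_sum K R"
      using lie_root_space[OF x] assms(3)[OF \<open>k \<in> P\<close>] root_space_subset_graded_sum by blast
    thus ?case using step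
      by (auto simp: lie_add_right lie_scale_right
          intro!: cvs.subspace_add[OF subspace_graded_sum] cvs.subspace_scale[OF subspace_graded_sum])
  qed (simp add: cvs.subspace_0[OF subspace_graded_sum])
  show ?thesis
    using assms(1) unfolding graded_sum_def[of K P]
  proof (induction rule: cvs.span_induct_alt)
    case (step c z x)
    hence "lie z y \<in> graded_sum K R" using * by blast
    thus ?case using step
      by (auto simp: lie_add_left lie_scale_left
          intro!: cvs.subspace_add[OF subspace_graded_sum] cvs.subspace_scale[OF subspace_graded_sum])
  qed (simp add: cvs.subspace_0[OF subspace_graded_sum])
qed

lemma lie_subalgebra_gen_subset_graded_sum:
  assumes "S \<subseteq> graded_sum K P" "\<And>k l. k \<in> P \<Longrightarrow> l \<in> P \<Longrightarrow> (\<lambda>i. k i + l i) \<in> P"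
  shows "lie_subalgebra_gen S \<subseteq> graded_sum K P"
proof
  fix x assume "x \<in> lie_subalgebra_gen S"
  thus "x \<in> graded_sum K P"
  proof induction
    case (bracket x y)
    thus ?case using assms(2) by (intro lie_graded_sum)
  qed (use assms(1) in \<open>auto intro: cvs.subspace_0[OF subspace_graded_sum]
      cvs.subspace_add[OF subspace_graded_sum] cvs.subspace_scale[OF subspace_graded_sum]\<close>)
qed

lemma graded_sum_decompose:
  assumes "z \<in> graded_sum K P"
  shows "\<exists>S x. finite S \<and> S \<subseteq> P \<and> (\<forall>k\<in>S. x k \<in> root_space K k) \<and> z = (\<Sum>k\<in>S. x k)"
  using assms unfolding graded_sum_def
proof (induction rule: cvs.span_induct_alt)
  case base
  show ?case by (intro exI[of _ "{}"]) simp
next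
  case (step c y z)
  then obtain S x k where S: "finite S" "S \<subseteq> P" "\<forall>k\<in>S. x k \<in> root_space K k" "z = (\<Sum>k\<in>S. x k)"
    and k: "k \<in> P" "y \<in> root_space K k" by blast
  define x' where "x' l = (if l \<in> S then x l else 0) + (if l = k then c *\<^sub>C y else 0)" for l
  have "x' l \<in> root_space K l" for l
    using S k by (auto simp: x'_def intro!: cvs.subspace_add[OF subspace_root_space]
        cvs.subspace_scale[OF subspace_root_space] cvs.subspace_0[OF subspace_root_space])
  moreover have "c *\<^sub>C y + z = (\<Sum>l\<in>insert k S. x' l)"
  proof -
    have "(\<Sum>l\<in>insert k S. if l \<in> S then x l else 0) = (\<Sum>l\<in>S. x l)"
      using S(1) by (intro sum.mono_neutral_cong_right) auto
    moreover have "(\<Sum>l\<in>insert k S. if l = k then c *\<^sub>C y else 0) = c *\<^sub>C y"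
      using S(1) by (subst sum.delta) auto
    ultimately show ?thesis unfolding x'_def sum.distrib S(4) by simp
  qed
  ultimately show ?case
    using S k by (intro exI[of _ "insert k S"] exI[of _ x']) auto
qed

section \<open>Null vectors of the Cartan matrix and independence of root spaces\<close>

context kac_moody
begin

text \<open>
  A nonzero nonnegative null vector of an indecomposable generalized Cartan matrix has no zero entry:
  at a zero entry adjacent to the support, the product would be negative.
\<close>

lemma gcm_null_vector_positive:
  fixes v :: "nat \<Rightarrow> real"
  assumes nonneg: "\<And>i. i \<le> rk K \<Longrightarrow> v i \<ge> 0"
    and null: "\<And>i. i \<le> rk K \<Longrightarrow> (\<Sum>j\<le>rk K. of_int (gcm K $$ (i, j)) * v j) = 0"
    and "i0 \<le> rk K" "v i0 \<noteq> 0" and "i1 \<le> rk K"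
  shows "v i1 \<noteq> 0"
proof
  assume "v i1 = 0"
  define S where "S = {i. i \<le> rk K \<and> v i \<noteq> 0}"
  have sub: "S \<subseteq> {..<Suc (rk K)}" unfolding S_def by (rule subsetI) simp
  have "i0 \<in> S" "i1 \<notin> S" "i1 \<in> {..<Suc (rk K)}"
    unfolding S_def using assms(3-5) \<open>v i1 = 0\<close> by simp_all
  hence "S \<noteq> {}" "S \<noteq> {..<Suc (rk K)}" by blast+
  with sub indecomposable have "\<exists>i\<in>S. \<exists>j\<in>{..<Suc (rk K)} - S. gcm K $$ (i, j) \<noteq> 0 \<or> gcm K $$ (j, i) \<noteq> 0"
    unfolding indecomposable_def by (simp only: simp_thms)
  then obtain i j where i: "i \<in> S" and j: "j \<in> {..<Suc (rk K)} - S"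
    and a: "gcm K $$ (i, j) \<noteq> 0 \<or> gcm K $$ (j, i) \<noteq> 0"
    by (elim bexE)
  have j': "j \<le> rk K" "v j = 0" using j by (auto simp: S_def)
  have i': "i \<le> rk K" "v i > 0" "i \<noteq> j" using i j nonneg[of i] by (auto simp: S_def less_eq_real_def)
  have gcm_nonpos: "gcm K $$ (a, b) \<le> 0" "gcm K $$ (a, b) = 0 \<Longrightarrow> gcm K $$ (b, a) = 0"
    if "a \<le> rk K" "b \<le> rk K" "a \<noteq> b" for a b
    using gcm that unfolding generalized_cartan_matrix_def by (auto simp: less_Suc_eq_le)
  \<comment> \<open>The zero pattern of the matrix is symmetric, so the entry in the row of
    \<open>j\<close> is nonzero whichever of the two was given.\<close>
  have "gcm K $$ (j, i) \<noteq> 0"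
    using a gcm_nonpos(2)[of j i] j' i' by auto
  hence "gcm K $$ (j, i) < 0"
    using gcm_nonpos(1)[of j i] j' i' by auto
  have "(\<Sum>l\<le>rk K. of_int (gcm K $$ (j, l)) * v l) < (\<Sum>l\<le>rk K. 0)"
  proof (rule sum_strict_mono_ex1)
    show "\<forall>l\<in>{..rk K}. of_int (gcm K $$ (j, l)) * v l \<le> 0"
    proof
      fix l assume "l \<in> {..rk K}"
      thus "of_int (gcm K $$ (j, l)) * v l \<le> 0"
        using gcm_nonpos(1)[of j l] j' nonneg[of l] by (cases "l = j") (auto intro: mult_nonpos_nonneg)
    qed
    show "\<exists>l\<in>{..rk K}. of_int (gcm K $$ (j, l)) * v l < 0"
      using i' \<open>gcm K $$ (j, i) < 0\<close> by (intro bexI[of _ i]) (auto intro: mult_neg_pos)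
  qed simp
  thus False using null[OF j'(1)] by simp
qed

lemma positive_null_vector:
  obtains u :: "nat \<Rightarrow> real" where "\<And>i. i \<le> rk K \<Longrightarrow> u i > 0"
    "\<And>i. i \<le> rk K \<Longrightarrow> (\<Sum>j\<le>rk K. of_int (gcm K $$ (i, j)) * u j) = 0"
proof -
  have "affine_type (rk K) (gcm K)"
    using affine_kac_moody unfolding affine_kac_moody_def by (rule conjunct1)
  hence "\<exists>u :: real vec. u \<in> carrier_vec (Suc (rk K)) \<and> (\<forall>i<Suc (rk K). vec_index u i > 0) \<and>
      map_mat of_int (gcm K) *\<^sub>v u = 0\<^sub>v (Suc (rk K))"
    unfolding affine_type_def by (elim conjE)
  then obtain u :: "real vec" where u: "u \<in> carrier_vec (Suc (rk K))"
    "\<forall>i<Suc (rk K). vec_index u i > 0" "map_mat of_int (gcm K) *\<^sub>v u = 0\<^sub>v (Suc (rk K))"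
    by (elim exE conjE)
  have dim: "gcm K \<in> carrier_mat (Suc (rk K)) (Suc (rk K))"
    using gcm by (simp add: generalized_cartan_matrix_def)
  have "(\<Sum>j\<le>rk K. of_int (gcm K $$ (i, j)) * vec_index u j) = 0" if "i \<le> rk K" for i
  proof -
    have "vec_index (map_mat of_int (gcm K) *\<^sub>v u) i = 0"
      unfolding u(3) using that by simp
    also have "vec_index (map_mat of_int (gcm K) *\<^sub>v u) i = (\<Sum>j\<in>{0..<Suc (rk K)}. of_int (gcm K $$ (i, j)) * vec_index u j)"
      using that u(1) dim by (simp add: scalar_prod_def del: sum.op_ivl_Suc)
    finally show ?thesis by (simp add: atLeast0LessThan lessThan_Suc_atMost)
  qed
  thus ?thesis using that[of "vec_index u"] u(2) by (simp add: less_Suc_eq_le)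
qed

text \<open>
  A null vector with a zero entry and a negative entry could be moved along the positive null vector
  to a nonnegative one that still has a zero entry.
\<close>

lemma null_vector_nonneg:
  fixes k :: "nat \<Rightarrow> real"
  assumes null: "\<And>i. i \<le> rk K \<Longrightarrow> (\<Sum>j\<le>rk K. of_int (gcm K $$ (i, j)) * k j) = 0"
    and k0: "k 0 = 0" and "i \<le> rk K"
  shows "k i \<ge> 0"
proof (rule ccontr)
  assume "\<not> k i \<ge> 0"
  obtain u :: "nat \<Rightarrow> real" where u: "\<And>i. i \<le> rk K \<Longrightarrow> u i > 0"
    "\<And>i. i \<le> rk K \<Longrightarrow> (\<Sum>j\<le>rk K. of_int (gcm K $$ (i, j)) * u j) = 0"
    by (rule positive_null_vector) blast
  define N where "N = {j. j \<le> rk K \<and> k j < 0}"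
  have "finite N" "i \<in> N" using \<open>\<not> k i \<ge> 0\<close> assms(3) by (auto simp: N_def)
  \<comment> \<open>The first time at which an entry of \<open>u + t * k\<close> reaches 0; only the
    negative entries of \<open>k\<close> can cause this.\<close>
  define t where "t = Min ((\<lambda>j. u j / - k j) ` N)"
  have "t \<in> (\<lambda>j. u j / - k j) ` N"
    unfolding t_def using \<open>finite N\<close> \<open>i \<in> N\<close> by (intro Min_in) auto
  then obtain j1 where j1: "j1 \<in> N" "t = u j1 / - k j1" by blast
  have "t > 0" unfolding j1(2) using j1(1) u(1) by (intro divide_pos_pos) (auto simp: N_def)
  have nonneg: "u j + t * k j \<ge> 0" if "j \<le> rk K" for j
  proof (cases "j \<in> N")
    case True
    hence "t \<le> u j / - k j" unfolding t_def using \<open>finite N\<close> by (intro Min_le) auto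
    thus ?thesis using True by (simp add: N_def field_simps)
  next
    case False
    thus ?thesis using that u(1)[of j] \<open>t > 0\<close> by (auto simp: N_def)
  qed
  have null': "(\<Sum>l\<le>rk K. of_int (gcm K $$ (j, l)) * (u l + t * k l)) = 0" if "j \<le> rk K" for j
    using u(2)[OF that] null[OF that] by (simp add: distrib_left sum.distrib mult.left_commute flip: sum_distrib_left)
  \<comment> \<open>Entry 0 does not move along \<open>k\<close> and stays positive, whereas entry
    \<open>j1\<close>, which attains the minimum, is 0.\<close>
  have "u 0 + t * k 0 \<noteq> 0" using u(1)[of 0] k0 by simp
  moreover have "j1 \<le> rk K" "t * k j1 = - u j1" using j1 by (auto simp: N_def)
  ultimately show False
    using gcm_null_vector_positive[of "\<lambda>j. u j + t * k j" 0 j1, OF nonneg null' le0] by simp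
qed

text \<open>Evaluation at the simple coroots makes the coefficients a null vector of the Cartan
  matrix, and evaluation at d reads off the coefficient at 0, which excludes multiples of the null
  root. Nonnegativity of such null vectors is then applied to \<open>k\<close> and to its
  negative.\<close>

lemma root_functional_eq_0:
  assumes k: "k \<in> root_lattice K" and 0: "\<And>y. y \<in> cartan K \<Longrightarrow> root_functional K k y = 0"
  shows "k = (\<lambda>_. 0)"
proof -
  have null: "(\<Sum>j\<le>rk K. of_int (gcm K $$ (i, j)) * of_int (k j)) = (0::real)" if "i \<le> rk K" for i
  proof -
    have "root_functional K k (hh K i) = of_int (\<Sum>j\<le>rk K. k j * gcm K $$ (i, j))"
      unfolding root_functional_def using that by (simp add: alpha_hh)
    hence "(\<Sum>j\<le>rk K. k j * gcm K $$ (i, j)) = 0"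
      using 0[OF hh_in_cartan[OF that]] by (simp del: of_int_sum of_int_mult)
    hence "of_int (\<Sum>j\<le>rk K. k j * gcm K $$ (i, j)) = (0::real)" by simp
    thus ?thesis by (simp add: mult.commute)
  qed
  have "root_functional K k (dd K) = (\<Sum>j\<le>rk K. if j = 0 then of_int (k j) else 0)"
    unfolding root_functional_def by (intro sum.cong) (auto simp: alpha_dd)
  hence "k 0 = 0" using 0[OF dd_in_cartan] by simp
  have "real_of_int (k i) \<ge> 0" "real_of_int (- k i) \<ge> 0" if "i \<le> rk K" for i
  proof -
    show "real_of_int (k i) \<ge> 0"
      using null_vector_nonneg[of "\<lambda>j. of_int (k j)" i] null \<open>k 0 = 0\<close> that by simp
    show "real_of_int (- k i) \<ge> 0"
      using null_vector_nonneg[of "\<lambda>j. - of_int (k j)" i] null \<open>k 0 = 0\<close> that by (simp add: sum_negf)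
  qed
  hence "k i = 0" for i
    using k by (cases "i \<le> rk K") (force simp: root_lattice_def)+
  thus ?thesis by blast
qed

lemma root_functional_separates:
  assumes "k \<in> root_lattice K" "l \<in> root_lattice K" "k \<noteq> l"
  obtains y where "y \<in> cartan K" "root_functional K k y \<noteq> root_functional K l y"
proof -
  have "(\<lambda>i. k i + - l i) \<noteq> (\<lambda>_. 0)" using assms(3) by (auto simp: fun_eq_iff)
  moreover have "(\<lambda>i. k i + - l i) \<in> root_lattice K" using assms by (simp add: root_lattice_def)
  ultimately obtain y where "y \<in> cartan K" "root_functional K (\<lambda>i. k i + - l i) y \<noteq> 0"
    using root_functional_eq_0 by blast
  moreover from this have "root_functional K k y \<noteq> root_functional K l y"
    by (simp only: root_functional_add root_functional_uminus) simp
  ultimately show ?thesis using that by blast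
qed

lemma root_spaces_independent:
  assumes "finite S" "S \<subseteq> root_lattice K" "\<And>k. k \<in> S \<Longrightarrow> x k \<in> root_space K k" "(\<Sum>k\<in>S. x k) = 0" "k \<in> S"
  shows "x k = 0"
  using assms
proof (induction S arbitrary: x k rule: finite_induct)
  case (insert l S)
  have xk: "x k = 0" if "k \<in> S" for k
  proof -
    have "k \<noteq> l" "k \<in> root_lattice K" "l \<in> root_lattice K" using insert that by auto
    then obtain y where y: "y \<in> cartan K" "root_functional K k y \<noteq> root_functional K l y"
      using root_functional_separates by blast
    have lie_y: "lie y (x j) = root_functional K j y *\<^sub>C x j" if "j \<in> insert l S" for j
      using insert.prems(2)[OF that] y(1) by (simp add: root_space_def)
    \<comment> \<open>The operator ad y minus the eigenvalue at \<open>l\<close> kills the summand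
      of weight \<open>l\<close> and rescales the others; \<open>y\<close> is chosen so that the
      factor at \<open>k\<close> is nonzero.\<close>
    define x' where "x' j = (root_functional K j y - root_functional K l y) *\<^sub>C x j" for j
    have lie_sum: "lie y (sum x A) = (\<Sum>j\<in>A. lie y (x j))" for A
      by (induction A rule: infinite_finite_induct) (simp_all add: lie_add_right)
    have "(\<Sum>j\<in>insert l S. x' j) = lie y (\<Sum>j\<in>insert l S. x j) - root_functional K l y *\<^sub>C (\<Sum>j\<in>insert l S. x j)"
      unfolding x'_def lie_sum cvs.scale_sum_right sum_subtractf[symmetric]
      by (intro sum.cong refl) (simp add: lie_y cvs.scale_left_diff_distrib)
    hence "(\<Sum>j\<in>S. x' j) = 0"
      using insert by (simp add: x'_def)
    hence "x' k = 0"
      using insert that by (intro insert.IH[of x']) (auto simp: x'_def intro: cvs.subspace_scale[OF subspace_root_space])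
    thus ?thesis using y(2) by (simp add: x'_def)
  qed
  hence "x l = 0" using insert by simp
  thus ?case using xk insert.prems by auto
qed simp

lemma graded_sum_disjoint:
  assumes "P \<subseteq> root_lattice K" "Q \<subseteq> root_lattice K" "P \<inter> Q = {}" "z \<in> graded_sum K P" "z \<in> graded_sum K Q"
  shows "z = 0"
proof -
  obtain S x where S: "finite S" "S \<subseteq> P" "\<forall>k\<in>S. x k \<in> root_space K k" "z = (\<Sum>k\<in>S. x k)"
    using graded_sum_decompose[OF assms(4)] by blast
  obtain T y where T: "finite T" "T \<subseteq> Q" "\<forall>k\<in>T. y k \<in> root_space K k" "z = (\<Sum>k\<in>T. y k)"
    using graded_sum_decompose[OF assms(5)] by blast
  have "S \<inter> T = {}" using S T assms(3) by blast
  define w where "w k = (if k \<in> S then x k else - y k)" for k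
  have "(\<Sum>k\<in>S \<union> T. w k) = (\<Sum>k\<in>S. w k) + (\<Sum>k\<in>T. w k)"
    by (rule sum.union_disjoint) fact+
  also have "(\<Sum>k\<in>S. w k) = z" unfolding S(4) by (rule sum.cong) (auto simp: w_def)
  also have "(\<Sum>k\<in>T. w k) = - z"
    unfolding T(4) sum_negf[symmetric] using \<open>S \<inter> T = {}\<close> by (intro sum.cong) (auto simp: w_def)
  finally have "(\<Sum>k\<in>S \<union> T. w k) = 0" by simp
  moreover have "w k \<in> root_space K k" if "k \<in> S \<union> T" for k
    using that S T by (auto simp: w_def intro: cvs.subspace_neg[OF subspace_root_space])
  ultimately have "w k = 0" if "k \<in> S \<union> T" for k
    using root_spaces_independent[of "S \<union> T" w k] that S T assms(1,2) by blast
  hence "(\<Sum>k\<in>S. w k) = 0" by simp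
  with \<open>(\<Sum>k\<in>S. w k) = z\<close> show ?thesis by simp
qed

end

section \<open>Operators from a highest weight module with basis the words\<close>

definition word_weight ::
  "('g::complex_lie_algebra, 'z) km_data_scheme \<Rightarrow> ('g \<Rightarrow> complex) \<Rightarrow> nat list \<Rightarrow> 'g \<Rightarrow> complex" where
  "word_weight K l w h = l h - (\<Sum>j\<leftarrow>w. if j \<le> rk K then alpha K j h else 0)"

lemma word_weight_Nil [simp]: "word_weight K l [] h = l h"
  and word_weight_Cons: "word_weight K l (j # w) h = word_weight K l w h - (if j \<le> rk K then alpha K j h else 0)"
  by (simp_all add: word_weight_def)

text \<open>
  \<open>raising K l i w \<phi>\<close> is the value of \<open>\<phi>\<close> at \<open>e\<^sub>i f\<^bsub>w\<^esub> v\<close>, where \<open>v\<close> has weight \<open>l\<close> and \<open>e\<^sub>i v = 0\<close>.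
\<close>

primrec raising ::
  "('g::complex_lie_algebra, 'z) km_data_scheme \<Rightarrow> ('g \<Rightarrow> complex) \<Rightarrow> nat \<Rightarrow> nat list \<Rightarrow>
     (nat list \<Rightarrow> complex) \<Rightarrow> complex" where
  "raising K l i [] \<phi> = 0"
| "raising K l i (j # w) \<phi> =
     (if i = j then word_weight K l w (hh K i) * \<phi> w else 0) + raising K l i w (\<lambda>v. \<phi> (j # v))"

lemma raising_add: "raising K l i w (\<lambda>v. \<phi> v + \<psi> v) = raising K l i w \<phi> + raising K l i w \<psi>"
  by (induction w arbitrary: \<phi> \<psi>) (simp_all add: algebra_simps)

lemma raising_scale: "raising K l i w (\<lambda>v. c * \<phi> v) = c * raising K l i w \<phi>"
  by (induction w arbitrary: \<phi>) (simp_all add: algebra_simps)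

text \<open>\<open>op_f\<close>, \<open>op_h\<close> and \<open>op_e\<close> are the transposes of
  the actions of f_j, h and e_i on the module with basis the vectors f_w v; prefixing a letter is
  multiplication by f_j.\<close>

lift_definition op_f :: "nat \<Rightarrow> word_op" is "\<lambda>j \<phi> w. \<phi> (j # w)" by simp

lift_definition op_h ::
  "('g::complex_lie_algebra, 'z) km_data_scheme \<Rightarrow> ('g \<Rightarrow> complex) \<Rightarrow> 'g \<Rightarrow> word_op" is
  "\<lambda>K l h \<phi> w. word_weight K l w h * \<phi> w"
  by (simp add: algebra_simps fun_eq_iff)

lift_definition op_e ::
  "('g::complex_lie_algebra, 'z) km_data_scheme \<Rightarrow> ('g \<Rightarrow> complex) \<Rightarrow> nat \<Rightarrow> word_op" is
  "\<lambda>K l i \<phi> w. raising K l i w \<phi>"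
  by (simp add: raising_add raising_scale)

lemma app_op_f: "app (op_f j) \<phi> = (\<lambda>w. \<phi> (j # w))"
  and app_op_h: "app (op_h K l h) \<phi> = (\<lambda>w. word_weight K l w h * \<phi> w)"
  and app_op_e: "app (op_e K l i) \<phi> = (\<lambda>w. raising K l i w \<phi>)"
  by (transfer; simp)+

lemma word_op_eqI: "(\<And>\<phi> w. app X \<phi> w = app Y \<phi> w) \<Longrightarrow> X = Y"
  by (metis app_inject ext)

text \<open>The recursion of \<open>raising\<close> encodes e_i f_j = f_j e_i + delta_ij h_i; in the
  commutator the tail term cancels and the Cartan term remains.\<close>

lemma lie_op_e_op_f: "lie (op_e K l i) (op_f j) = (if i = j then op_h K l (hh K i) else 0)"
  by (rule word_op_eqI) (simp add: app_lie app_op_e app_op_f app_op_h app_0)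

lemma lie_op_h_op_f: "j \<le> rk K \<Longrightarrow> lie (op_h K l h) (op_f j) = (- alpha K j h) *\<^sub>C op_f j"
  by (rule word_op_eqI) (simp add: app_lie app_op_f app_op_h app_scaleC app_uminus word_weight_Cons algebra_simps)

lemma lie_op_h_op_h: "lie (op_h K l h) (op_h K l h') = 0"
  by (rule word_op_eqI) (simp add: app_lie app_op_h app_0)

text \<open>Raising adds alpha_i to the weight. The term that removes the first letter
  \<open>j\<close> occurs only for i = j, and there the loss \<open>a\<close> caused by this letter
  cancels against alpha_i.\<close>

lemma raising_op_h:
  assumes "i \<le> rk K"
  shows "raising K l i w (\<lambda>v. word_weight K l v h * \<phi> v) =
    (word_weight K l w h + alpha K i h) * raising K l i w \<phi>"
proof (induction w arbitrary: \<phi>)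
  case (Cons j w)
  define a where "a = (if j \<le> rk K then alpha K j h else 0)"
  have "raising K l i w (\<lambda>v. word_weight K l (j # v) h * \<phi> (j # v)) =
      raising K l i w (\<lambda>v. word_weight K l v h * \<phi> (j # v) + (- a) * \<phi> (j # v))"
    by (simp add: word_weight_Cons a_def left_diff_distrib)
  also have "\<dots> = (word_weight K l w h + alpha K i h) * raising K l i w (\<lambda>v. \<phi> (j # v)) -
      a * raising K l i w (\<lambda>v. \<phi> (j # v))"
    unfolding raising_add raising_scale Cons.IH by simp
  finally have tail: "raising K l i w (\<lambda>v. word_weight K l (j # v) h * \<phi> (j # v)) =
      (word_weight K l w h - a + alpha K i h) * raising K l i w (\<lambda>v. \<phi> (j # v))"
    by (simp add: algebra_simps)
  have weight: "word_weight K l (j # w) h = word_weight K l w h - a"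
    by (simp add: word_weight_Cons a_def)
  have "i = j \<Longrightarrow> a = alpha K i h" using assms by (simp add: a_def)
  thus ?case
    unfolding raising.simps tail weight by (cases "i = j") (simp_all add: algebra_simps)
qed simp

lemma lie_op_h_op_e:
  assumes "i \<le> rk K"
  shows "lie (op_h K l h) (op_e K l i) = alpha K i h *\<^sub>C op_e K l i"
  by (rule word_op_eqI)
    (simp add: app_lie app_op_e app_op_h app_scaleC raising_op_h[OF assms] distrib_right)


section \<open>The action on the dual of the Verma module\<close>

text \<open>
  The generators of the Kac--Moody algebra act on functions of words, but the defining relations of the
  Lie algebra are not known to hold for these operators. The subalgebra \<open>op_graph\<close> generated by pairs of
  a generator and its operator is a graph only after restriction to the functions annihilated by all
  operators that are related to \<open>0\<close>.
\<close>

definition f_pairs :: "('g::complex_lie_algebra, 'z) km_data_scheme \<Rightarrow> ('g \<times> word_op) set" where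
  "f_pairs K = (\<lambda>i. (ff K i, op_f i)) ` {..rk K}"

definition e_pairs ::
  "('g::complex_lie_algebra, 'z) km_data_scheme \<Rightarrow> ('g \<Rightarrow> complex) \<Rightarrow> ('g \<times> word_op) set" where
  "e_pairs K l = (\<lambda>i. (ee K i, op_e K l i)) ` {..rk K}"

definition h_pairs ::
  "('g::complex_lie_algebra, 'z) km_data_scheme \<Rightarrow> ('g \<Rightarrow> complex) \<Rightarrow> ('g \<times> word_op) set" where
  "h_pairs K l = (\<lambda>h. (h, op_h K l h)) ` cartan K"

definition op_graph ::
  "('g::complex_lie_algebra, 'z) km_data_scheme \<Rightarrow> ('g \<Rightarrow> complex) \<Rightarrow> ('g \<times> word_op) set" where
  "op_graph K l = lie_subalgebra_gen (h_pairs K l \<union> e_pairs K l \<union> f_pairs K)"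

definition op_invariants ::
  "('g::complex_lie_algebra, 'z) km_data_scheme \<Rightarrow> ('g \<Rightarrow> complex) \<Rightarrow> (nat list \<Rightarrow> complex) set" where
  "op_invariants K l = {\<phi>. \<forall>X. (0, X) \<in> op_graph K l \<longrightarrow> app X \<phi> = (\<lambda>_. 0)}"

lemma op_graph_add: "(x, X) \<in> op_graph K l \<Longrightarrow> (y, Y) \<in> op_graph K l \<Longrightarrow> (x + y, X + Y) \<in> op_graph K l"
  and op_graph_scale: "(x, X) \<in> op_graph K l \<Longrightarrow> (c *\<^sub>C x, c *\<^sub>C X) \<in> op_graph K l"
  and op_graph_lie: "(x, X) \<in> op_graph K l \<Longrightarrow> (y, Y) \<in> op_graph K l \<Longrightarrow> (lie x y, lie X Y) \<in> op_graph K l"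
  and op_graph_diff: "(x, X) \<in> op_graph K l \<Longrightarrow> (y, Y) \<in> op_graph K l \<Longrightarrow> (x - y, X - Y) \<in> op_graph K l"
  unfolding op_graph_def
  using lie_subalgebra_gen.add[of "(x, X)" _ "(y, Y)"] lie_subalgebra_gen.scale[of "(x, X)" _ c]
    lie_subalgebra_gen.bracket[of "(x, X)" _ "(y, Y)"] lie_subalgebra_gen_diff[of "(x, X)" _ "(y, Y)"]
  by (simp_all add: scaleC_prod_def lie_prod_def)

lemma app_op_graph_unique:
  assumes "\<phi> \<in> op_invariants K l" "(x, X) \<in> op_graph K l" "(x, Y) \<in> op_graph K l"
  shows "app X \<phi> = app Y \<phi>"
proof -
  have "app (X - Y) \<phi> = (\<lambda>_. 0)"
    using op_graph_diff[OF assms(2,3)] assms(1) by (simp add: op_invariants_def)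
  hence "app (X - Y) \<phi> w = 0" for w by simp
  thus ?thesis by (simp add: app_minus fun_eq_iff)
qed

text \<open>The fibre over 0 is an ideal of \<open>op_graph\<close>: for \<open>Y\<close> in it, the
  bracket of \<open>X\<close> and \<open>Y\<close> is in it too. Applying \<open>X\<close> and then
  \<open>Y\<close> differs from the reverse order by this bracket, so the result is 0.\<close>

lemma app_in_op_invariants:
  assumes "\<phi> \<in> op_invariants K l" "(x, X) \<in> op_graph K l"
  shows "app X \<phi> \<in> op_invariants K l"
  unfolding op_invariants_def
proof (intro CollectI allI impI)
  fix Y assume Y: "(0, Y) \<in> op_graph K l"
  have "(0, lie X Y) \<in> op_graph K l"
    using op_graph_lie[OF assms(2) Y] by simp
  hence "app (lie X Y) \<phi> = (\<lambda>_. 0)" "app Y \<phi> = (\<lambda>_. 0)"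
    using assms(1) Y by (auto simp: op_invariants_def)
  thus "app Y (app X \<phi>) = (\<lambda>_. 0)"
    using app_lie[of X Y \<phi>] by (auto simp: fun_eq_iff app_zero)
qed

lemma op_invariants_add: "\<phi> \<in> op_invariants K l \<Longrightarrow> \<psi> \<in> op_invariants K l \<Longrightarrow> (\<lambda>w. \<phi> w + \<psi> w) \<in> op_invariants K l"
  and op_invariants_scale: "\<phi> \<in> op_invariants K l \<Longrightarrow> (\<lambda>w. c * \<phi> w) \<in> op_invariants K l"
  and op_invariants_0: "(\<lambda>w. 0) \<in> op_invariants K l"
  by (simp_all add: op_invariants_def app_add app_scale app_zero)

section \<open>From the free algebra to the enveloping algebra\<close>

definition free_action :: "('g \<Rightarrow> word_op) \<Rightarrow> 'g free_algebra \<Rightarrow> word_op" where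
  "free_action r p = (\<Sum>w\<in>Poly_Mapping.keys p. Poly_Mapping.lookup p w *\<^sub>C prod_list (map r (letters w)))"

lemma free_action_superset:
  assumes "finite A" "Poly_Mapping.keys p \<subseteq> A"
  shows "free_action r p = (\<Sum>w\<in>A. Poly_Mapping.lookup p w *\<^sub>C prod_list (map r (letters w)))"
  unfolding free_action_def using assms by (intro sum.mono_neutral_left) (auto simp: in_keys_iff)

lemma free_action_add: "free_action r (p + q) = free_action r p + free_action r q"
proof -
  let ?A = "Poly_Mapping.keys p \<union> Poly_Mapping.keys q"
  have "free_action r s = (\<Sum>w\<in>?A. Poly_Mapping.lookup s w *\<^sub>C prod_list (map r (letters w)))"
    if "s \<in> {p, q, p + q}" for s
    using that keys_add[of p q] by (intro free_action_superset) auto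
  thus ?thesis by (simp add: lookup_add scaleC_add_left sum.distrib)
qed

lemma free_action_0: "free_action r 0 = 0"
  by (simp add: free_action_def)

lemma free_action_uminus: "free_action r (- p) = - free_action r p"
  using free_action_add[of r p "- p"] by (simp add: free_action_0 eq_neg_iff_add_eq_0 add.commute)

lemma free_action_diff: "free_action r (p - q) = free_action r p - free_action r q"
  using free_action_add[of r p "- q"] by (simp add: free_action_uminus)

lemma free_action_single: "free_action r (Poly_Mapping.single w c) = c *\<^sub>C prod_list (map r (letters w))"
  by (subst free_action_superset[of "{w}"]) (auto simp: lookup_single)

lemma free_action_mult: "free_action r (p * q) = free_action r p * free_action r q"
proof (induction p rule: poly_mapping_add_induct)
  case (single w c)
  show ?case
  proof (induction q rule: poly_mapping_add_induct)
    case (single v d)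
    show ?case
      by (simp add: mult_single free_action_single plus_free_monoid_def scaleC_word_op_mult mult.commute)
  qed (simp_all add: free_action_0 free_action_add distrib_left)
qed (simp_all add: free_action_0 free_action_add distrib_right)

lemma free_action_letter: "free_action r (letter x) = r x"
  by (simp add: letter_def free_action_single)

lemma app_free_action_in_op_invariants:
  assumes r: "\<And>x. (x, r x) \<in> op_graph K l" and "\<phi> \<in> op_invariants K l"
  shows "app (free_action r p) \<phi> \<in> op_invariants K l"
proof (induction p rule: poly_mapping_add_induct)
  case zero
  have "app (free_action r 0) \<phi> = (\<lambda>w. 0)" by (simp add: free_action_0 app_0 fun_eq_iff)
  thus ?case by (simp add: op_invariants_0)
next
  case (single w c)
  have "app (prod_list (map r xs)) \<phi> \<in> op_invariants K l" for xs
    using assms(2)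
    by (induction xs arbitrary: \<phi>) (simp_all add: app_1 app_times app_in_op_invariants[OF _ r])
  moreover have "app (free_action r (Poly_Mapping.single w c)) \<phi> =
      (\<lambda>v. c * app (prod_list (map r (letters w))) \<phi> v)"
    by (simp add: free_action_single app_scaleC fun_eq_iff)
  ultimately show ?case by (simp add: op_invariants_scale)
next
  case (add p q)
  have "app (free_action r (p + q)) \<phi> = (\<lambda>v. app (free_action r p) \<phi> v + app (free_action r q) \<phi> v)"
    by (simp add: free_action_add app_plus fun_eq_iff)
  thus ?case using add by (simp add: op_invariants_add)
qed

text \<open>Each defining relation compares two operators related to the same Lie algebra element,
  and these agree on invariant functions. The induction is over all such functions, because a left
  factor acts first and replaces the function by another invariant one.\<close>

lemma free_action_uea_ideal:
  assumes r: "\<And>x. (x, r x) \<in> op_graph K l" and "a \<in> uea_ideal" "\<phi> \<in> op_invariants K l"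
  shows "app (free_action r a) \<phi> = (\<lambda>_. 0)"
  using assms(2,3)
proof (induction arbitrary: \<phi>)
  case (add_rel x y)
  have "app (r (x + y)) \<phi> = app (r x + r y) \<phi>"
    by (rule app_op_graph_unique[OF add_rel r op_graph_add[OF r r]])
  thus ?case by (simp add: free_action_diff free_action_letter app_minus app_plus fun_eq_iff)
next
  case (scale_rel c x)
  have "app (r (c *\<^sub>C x)) \<phi> = app (c *\<^sub>C r x) \<phi>"
    by (rule app_op_graph_unique[OF scale_rel r op_graph_scale[OF r]])
  moreover have "free_action r (Poly_Mapping.single 0 c) = c *\<^sub>C 1"
    by (simp add: free_action_single zero_free_monoid_def)
  ultimately show ?case
    by (simp add: free_action_diff free_action_letter free_action_mult scaleC_word_op_mult app_minus fun_eq_iff)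
next
  case (bracket_rel x y)
  have "app (r (lie x y)) \<phi> = app (lie (r x) (r y)) \<phi>"
    by (rule app_op_graph_unique[OF bracket_rel r op_graph_lie[OF r r]])
  thus ?case
    by (simp add: free_action_diff free_action_letter free_action_mult lie_word_op_def app_minus fun_eq_iff)
next
  case (mult_left a p)
  thus ?case
    using app_free_action_in_op_invariants[OF r] by (simp add: free_action_mult app_times)
next
  case (mult_right a p)
  thus ?case by (simp add: free_action_mult app_times app_zero)
qed (simp_all add: free_action_0 free_action_add app_0 app_plus fun_eq_iff)

text \<open>Two choices enter: an operator for each Lie algebra element and a representative in the
  free algebra. Neither matters on \<open>op_invariants\<close>, and only there is this a right
  action.\<close>

definition uea_action ::
  "('g::complex_lie_algebra, 'z) km_data_scheme \<Rightarrow> ('g \<Rightarrow> complex) \<Rightarrow> 'g uea \<Rightarrow>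
     (nat list \<Rightarrow> complex) \<Rightarrow> nat list \<Rightarrow> complex" where
  "uea_action K l u = app (free_action (\<lambda>x. SOME X. (x, X) \<in> op_graph K l) (rep_uea u))"

lemma uea_action_scale_arg: "uea_action K l u (\<lambda>w. c * \<phi> w) = (\<lambda>w. c * uea_action K l u \<phi> w)"
  and uea_action_zero_arg: "uea_action K l u (\<lambda>w. 0) = (\<lambda>w. 0)"
  unfolding uea_action_def by (rule app_scale app_zero)+

context kac_moody
begin

lemma op_graph_total: "\<exists>X. (x, X) \<in> op_graph K l"
proof -
  have "fst ` (h_pairs K l \<union> e_pairs K l \<union> f_pairs K) = cartan K \<union> ee K ` {..rk K} \<union> ff K ` {..rk K}"
    by (simp add: h_pairs_def e_pairs_def f_pairs_def image_Un image_image)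
  thus ?thesis
    unfolding op_graph_def using generated by (intro lie_subalgebra_gen_fst_lift) simp
qed

lemma some_op_graph: "(x, SOME X. (x, X) \<in> op_graph K l) \<in> op_graph K l"
  by (rule someI_ex[OF op_graph_total])

lemma uea_action_in_op_invariants: "\<phi> \<in> op_invariants K l \<Longrightarrow> uea_action K l u \<phi> \<in> op_invariants K l"
  unfolding uea_action_def by (rule app_free_action_in_op_invariants[OF some_op_graph])

lemma uea_action_abs:
  assumes "\<phi> \<in> op_invariants K l"
  shows "uea_action K l (abs_uea p) \<phi> = app (free_action (\<lambda>x. SOME X. (x, X) \<in> op_graph K l) p) \<phi>"
proof -
  have "rep_uea (abs_uea p) - p \<in> uea_ideal"
    using Quotient3_abs_rep[OF Quotient3_uea, of "abs_uea p"] uea.abs_eq_iff uea_eq_def by blast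
  from free_action_uea_ideal[OF some_op_graph this assms] show ?thesis
    by (simp add: uea_action_def free_action_diff app_minus fun_eq_iff)
qed

lemma uea_action_mult:
  assumes "\<phi> \<in> op_invariants K l"
  shows "uea_action K l (u * v) \<phi> = uea_action K l v (uea_action K l u \<phi>)"
proof -
  obtain p q where uv: "u = abs_uea p" "v = abs_uea q"
    using Quotient3_abs_rep[OF Quotient3_uea] by metis
  have "uea_action K l v (uea_action K l u \<phi>) =
      app (free_action (\<lambda>x. SOME X. (x, X) \<in> op_graph K l) q) (uea_action K l u \<phi>)"
    unfolding uv(2) by (rule uea_action_abs[OF uea_action_in_op_invariants[OF assms]])
  thus ?thesis
    unfolding uv by (simp add: times_uea.abs_eq uea_action_abs[OF assms] free_action_mult app_times)
qed

lemma uea_action_add: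
  assumes "\<phi> \<in> op_invariants K l"
  shows "uea_action K l (u + v) \<phi> w = uea_action K l u \<phi> w + uea_action K l v \<phi> w"
proof -
  obtain p q where uv: "u = abs_uea p" "v = abs_uea q"
    using Quotient3_abs_rep[OF Quotient3_uea] by metis
  thus ?thesis
    unfolding uv by (simp add: plus_uea.abs_eq uea_action_abs[OF assms] free_action_add app_plus)
qed

lemma uea_action_const:
  assumes "\<phi> \<in> op_invariants K l"
  shows "uea_action K l (uea_const c) \<phi> = (\<lambda>w. c * \<phi> w)"
  unfolding uea_const.abs_eq uea_action_abs[OF assms] free_action_single
  by (simp add: zero_free_monoid_def app_scaleC app_1 fun_eq_iff)

lemma uea_action_0: "\<phi> \<in> op_invariants K l \<Longrightarrow> uea_action K l 0 \<phi> = (\<lambda>w. 0)"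
  and uea_action_1: "\<phi> \<in> op_invariants K l \<Longrightarrow> uea_action K l 1 \<phi> = \<phi>"
  using uea_action_const[of \<phi> l 0] uea_action_const[of \<phi> l 1] by simp_all

lemma uea_action_diff:
  assumes "\<phi> \<in> op_invariants K l"
  shows "uea_action K l (u - v) \<phi> w = uea_action K l u \<phi> w - uea_action K l v \<phi> w"
  using uea_action_add[OF assms, of "u - v" v w] by simp

lemma uea_action_incl:
  assumes "\<phi> \<in> op_invariants K l" "(x, X) \<in> op_graph K l"
  shows "uea_action K l (\<iota> x) \<phi> = app X \<phi>"
  unfolding uea_incl.abs_eq uea_action_abs[OF assms(1)] free_action_letter
  by (rule app_op_graph_unique[OF assms(1) some_op_graph assms(2)])

text \<open>The value at the empty word is the pairing with the highest weight vector.\<close>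

lemma uea_action_divided_power_ee_Nil:
  assumes "\<phi> \<in> op_invariants K l" "j \<le> rk K" "m \<ge> 1"
  shows "uea_action K l (divided_power (\<iota> (ee K j)) m) \<phi> [] = 0"
proof -
  \<comment> \<open>Splitting off the rightmost e_j makes it act last, and \<open>raising\<close> at
    the empty word is 0.\<close>
  define u where "u = uea_const (1 / fact m) * \<iota> (ee K j) ^ (m - 1)"
  have "divided_power (\<iota> (ee K j)) m = u * \<iota> (ee K j)"
    using assms(3) power_Suc2[of "\<iota> (ee K j)" "m - 1"] by (simp add: divided_power_def u_def mult.assoc)
  moreover have "(ee K j, op_e K l j) \<in> op_graph K l"
    unfolding op_graph_def e_pairs_def using assms(2) by (auto intro: lie_subalgebra_gen.gen)
  ultimately show ?thesis
    by (simp add: uea_action_mult assms(1) uea_action_incl uea_action_in_op_invariants app_op_e)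
qed

text \<open>At the empty word h acts by l(h), so the k-th factor of the binomial multiplies the
  value by -k; for m at least 1 the factor with k = 0 is present.\<close>

lemma uea_action_binomial_Nil:
  assumes "\<phi> \<in> op_invariants K l" "h \<in> cartan K" "m \<ge> 1"
  shows "uea_action K l (uea_binomial (\<iota> h - uea_const (l h)) m) \<phi> [] = 0"
proof -
  have h: "(h, op_h K l h) \<in> op_graph K l"
    unfolding op_graph_def h_pairs_def using assms(2) by (auto intro: lie_subalgebra_gen.gen)
  have step: "uea_action K l (\<iota> h - uea_const (l h) - of_nat k) \<phi> [] = - of_nat k * \<phi> []"
    if "\<phi> \<in> op_invariants K l" for \<phi> k
    using uea_action_incl[OF that h] uea_action_const[OF that]
    by (simp add: uea_action_diff[OF that] app_op_h flip: uea_const_of_nat)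
  have "uea_action K l (prod_list (map (\<lambda>k. \<iota> h - uea_const (l h) - of_nat k) ks)) \<phi> [] =
      prod_list (map (\<lambda>k. - of_nat k) ks) * \<phi> []" if "\<phi> \<in> op_invariants K l" for \<phi> ks
    using that
  proof (induction ks arbitrary: \<phi>)
    case (Cons k ks)
    thus ?case
      by (simp add: uea_action_mult uea_action_in_op_invariants step)
  qed (simp add: uea_action_1)
  moreover have "prod_list (map (\<lambda>k. - of_nat k) [0..<m]) = (0 :: complex)"
    using assms(3) by (auto simp: prod_list_zero_iff intro!: image_eqI[of _ _ 0])
  ultimately show ?thesis
    unfolding uea_binomial_def
    by (simp add: uea_action_mult assms(1) uea_action_in_op_invariants)
qed

text \<open>In a product \<open>u * s\<close> the coefficient \<open>u\<close> acts first and only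
  moves \<phi> to another invariant function, and the generator \<open>s\<close> kills the value at
  the empty word for all of them. So every invariant function gives a functional on the Verma
  module.\<close>

lemma uea_action_verma_ideal_Nil:
  assumes "\<phi> \<in> op_invariants K l" "x \<in> verma_ideal K l"
  shows "uea_action K l x \<phi> [] = 0"
  using assms(2) unfolding verma_ideal_def
proof induction
  case zero
  show ?case by (simp add: uea_action_0 assms(1))
next
  case (add u s x)
  have "uea_action K l s \<psi> [] = 0" if "\<psi> \<in> op_invariants K l" for \<psi>
    using add.hyps(2) that uea_action_divided_power_ee_Nil uea_action_binomial_Nil dd_in_cartan hh_in_cartan
    by blast
  thus ?case
    using add.IH by (simp add: uea_action_add uea_action_mult uea_action_in_op_invariants assms(1))
qed

end

text \<open>This is the character of the free algebra with value 1 on every generator. Words with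
  letters beyond the rank get 0, since only the letters up to the rank have operators in
  \<open>op_graph\<close>.\<close>

definition letter_words :: "('g::complex_lie_algebra, 'z) km_data_scheme \<Rightarrow> nat list \<Rightarrow> complex" where
  "letter_words K w = (if set w \<subseteq> {..rk K} then 1 else 0)"

lemma app_op_f_letter_words: "i \<le> rk K \<Longrightarrow> app (op_f i) (letter_words K) = letter_words K"
  by (simp add: app_op_f letter_words_def fun_eq_iff)

section \<open>Weights of the positive and negative parts\<close>

definition negative_cone :: "('g::complex_lie_algebra, 'z) km_data_scheme \<Rightarrow> int \<Rightarrow> (nat \<Rightarrow> int) set" where
  "negative_cone K n = {k \<in> root_lattice K. (\<forall>i. k i \<le> 0) \<and> (\<Sum>i\<le>rk K. k i) \<le> - n}"

definition positive_cone :: "('g::complex_lie_algebra, 'z) km_data_scheme \<Rightarrow> (nat \<Rightarrow> int) set" where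
  "positive_cone K = {k \<in> root_lattice K. (\<forall>i. k i \<ge> 0) \<and> (\<Sum>i\<le>rk K. k i) \<ge> 1}"

lemma negative_cone_add:
  "k \<in> negative_cone K m \<Longrightarrow> l \<in> negative_cone K n \<Longrightarrow> (\<lambda>i. k i + l i) \<in> negative_cone K (m + n)"
  by (auto simp: negative_cone_def root_lattice_def sum.distrib add_nonpos_nonpos)

lemma negative_cone_antimono: "m \<le> n \<Longrightarrow> negative_cone K n \<subseteq> negative_cone K m"
  by (auto simp: negative_cone_def)

lemma positive_cone_add:
  "k \<in> positive_cone K \<Longrightarrow> l \<in> positive_cone K \<Longrightarrow> (\<lambda>i. k i + l i) \<in> positive_cone K"
  by (auto simp: positive_cone_def root_lattice_def sum.distrib)

lemma sum_simple_root: "i \<le> n \<Longrightarrow> (\<Sum>j\<le>n. simple_root i j) = 1"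
  by (simp add: simple_root_def)

lemma simple_root_in_positive_cone: "i \<le> rk K \<Longrightarrow> simple_root i \<in> positive_cone K"
  by (simp add: positive_cone_def root_lattice_def sum_simple_root) (simp add: simple_root_def)

lemma neg_simple_root_in_negative_cone: "i \<le> rk K \<Longrightarrow> (\<lambda>j. - simple_root i j) \<in> negative_cone K 1"
  by (simp add: negative_cone_def root_lattice_def sum_simple_root sum_negf) (simp add: simple_root_def)

lemma negative_cone_subset: "negative_cone K n \<subseteq> root_lattice K"
  unfolding negative_cone_def by (rule Collect_restrict)

lemma inj_simple_root: "inj simple_root"
  by (rule injI) (metis simple_root_def zero_neq_one)

lemma raising_vanish:
  assumes "i \<le> n" "\<not> set w \<subseteq> {..n}" "\<And>w. \<not> set w \<subseteq> {..n} \<Longrightarrow> \<phi> w = 0"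
  shows "raising K l i w \<phi> = 0"
  using assms(2,3)
proof (induction w arbitrary: \<phi>)
  case (Cons j w)
  have "raising K l i w (\<lambda>v. \<phi> (j # v)) = 0"
  proof (cases "j \<le> n")
    case True
    thus ?thesis using Cons.prems by (intro Cons.IH) auto
  next
    case False
    hence "(\<lambda>v. \<phi> (j # v)) = (\<lambda>v. 0)" using Cons.prems(2) by auto
    thus ?thesis using raising_scale[of K l i w 0] by simp
  qed
  moreover have "i = j \<Longrightarrow> \<phi> w = 0" using Cons.prems assms(1) by auto
  ultimately show ?case by auto
qed simp

lemma app_op_graph_vanish:
  assumes "z \<in> lie_subalgebra_gen (h_pairs K l \<union> e_pairs K l \<union> f_pairs K)"
    and "\<And>w. \<not> set w \<subseteq> {..rk K} \<Longrightarrow> \<phi> w = 0" and "\<not> set w \<subseteq> {..rk K}"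
  shows "app (snd z) \<phi> w = 0"
  using assms
proof (induction arbitrary: \<phi> w)
  case (gen z)
  from gen(1) consider h where "z = (h, op_h K l h)" | i where "i \<le> rk K" "z = (ee K i, op_e K l i)"
    | i where "i \<le> rk K" "z = (ff K i, op_f i)"
    by (auto simp: h_pairs_def e_pairs_def f_pairs_def)
  thus ?case
    using gen(2,3) by cases (auto simp: app_op_h app_op_e app_op_f intro!: raising_vanish)
next
  case (bracket x y)
  thus ?case by (simp add: app_lie)
qed (simp_all add: app_0 app_plus app_scaleC)

text \<open>The highest weight vector is killed by each e_i, whatever function is paired with it; in
  a bracket both orders end with such an operator.\<close>

lemma app_e_pairs_Nil: "z \<in> lie_subalgebra_gen (e_pairs K l) \<Longrightarrow> app (snd z) \<phi> [] = 0"
proof (induction arbitrary: \<phi> rule: lie_subalgebra_gen.induct)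
  case (gen z)
  thus ?case by (auto simp: e_pairs_def app_op_e)
qed (simp_all add: app_0 app_plus app_scaleC app_lie)

context kac_moody
begin

lemma ff_in_root_space: "i \<le> rk K \<Longrightarrow> ff K i \<in> root_space K (\<lambda>j. - simple_root i j)"
  by (simp add: root_space_def root_functional_uminus root_functional_simple_root lie_cartan_ff)

lemma ee_in_root_space: "i \<le> rk K \<Longrightarrow> ee K i \<in> root_space K (simple_root i)"
  by (simp add: root_space_def root_functional_simple_root lie_cartan_ee)

lemma ff_nonzero: "i \<le> rk K \<Longrightarrow> ff K i \<noteq> 0"
  using lie_ee_ff[of i i] hh_nonzero[of i] by auto

lemma cartan_subset_root_space: "cartan K \<subseteq> root_space K (\<lambda>_. 0)"
  by (auto simp: root_space_def root_functional_def lie_cartan_cartan)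

lemma fst_f_pairs: "z \<in> lie_subalgebra_gen (f_pairs K) \<Longrightarrow> fst z \<in> graded_sum K (negative_cone K 1)"
proof -
  assume "z \<in> lie_subalgebra_gen (f_pairs K)"
  hence "fst z \<in> lie_subalgebra_gen (fst ` f_pairs K)" by (rule fst_in_lie_subalgebra_gen)
  moreover have "fst ` f_pairs K \<subseteq> graded_sum K (negative_cone K 1)"
    by (auto simp: f_pairs_def intro!: neg_simple_root_in_negative_cone
        subsetD[OF root_space_subset_graded_sum ff_in_root_space])
  hence "lie_subalgebra_gen (fst ` f_pairs K) \<subseteq> graded_sum K (negative_cone K 1)"
    using negative_cone_add[of _ K 1 _ 1] negative_cone_antimono[of 1 2 K]
    by (intro lie_subalgebra_gen_subset_graded_sum) auto
  ultimately show ?thesis by blast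
qed

lemma fst_e_pairs: "z \<in> lie_subalgebra_gen (e_pairs K l) \<Longrightarrow> fst z \<in> graded_sum K (positive_cone K)"
proof -
  assume "z \<in> lie_subalgebra_gen (e_pairs K l)"
  hence "fst z \<in> lie_subalgebra_gen (fst ` e_pairs K l)" by (rule fst_in_lie_subalgebra_gen)
  moreover have "fst ` e_pairs K l \<subseteq> graded_sum K (positive_cone K)"
    by (auto simp: e_pairs_def intro!: simple_root_in_positive_cone
        subsetD[OF root_space_subset_graded_sum ee_in_root_space])
  hence "lie_subalgebra_gen (fst ` e_pairs K l) \<subseteq> graded_sum K (positive_cone K)"
    using positive_cone_add by (intro lie_subalgebra_gen_subset_graded_sum) auto
  ultimately show ?thesis by blast
qed

text \<open>A Lie polynomial in the f_j is a linear part plus brackets. Brackets have weights of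
  height at least 2, which explains \<open>negative_cone K 2\<close>, and they act by 0 because
  scalars commute. So the operator acts on \<open>letter_words\<close> by the sum of the linear
  coefficients, each f_j contributing 1.\<close>

lemma f_pairs_character:
  assumes "z \<in> lie_subalgebra_gen (f_pairs K)"
  shows "\<exists>c. fst z - (\<Sum>j\<le>rk K. c j *\<^sub>C ff K j) \<in> graded_sum K (negative_cone K 2) \<and>
    app (snd z) (letter_words K) = (\<lambda>w. (\<Sum>j\<le>rk K. c j) * letter_words K w)"
  using assms
proof induction
  case (gen z)
  then obtain i where i: "i \<le> rk K" "z = (ff K i, op_f i)" by (auto simp: f_pairs_def)
  have "(\<Sum>j\<le>rk K. (if j = i then 1 else 0) *\<^sub>C ff K j) = (\<Sum>j\<le>rk K. if j = i then ff K j else 0)"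
    by (intro sum.cong) auto
  also have "\<dots> = ff K i" using i by simp
  finally show ?case
    using i by (intro exI[of _ "\<lambda>j. if j = i then 1 else 0"])
      (simp add: cvs.subspace_0[OF subspace_graded_sum] app_op_f_letter_words)
next
  case zero
  show ?case
    by (intro exI[of _ "\<lambda>_. 0"]) (simp add: cvs.subspace_0[OF subspace_graded_sum] app_0 fun_eq_iff)
next
  case (add y z)
  then obtain c d where
    "fst y - (\<Sum>j\<le>rk K. c j *\<^sub>C ff K j) \<in> graded_sum K (negative_cone K 2)"
    "fst z - (\<Sum>j\<le>rk K. d j *\<^sub>C ff K j) \<in> graded_sum K (negative_cone K 2)" and app:
    "app (snd y) (letter_words K) = (\<lambda>w. (\<Sum>j\<le>rk K. c j) * letter_words K w)"
    "app (snd z) (letter_words K) = (\<lambda>w. (\<Sum>j\<le>rk K. d j) * letter_words K w)" by blast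
  from cvs.subspace_add[OF subspace_graded_sum this(1,2)]
  have "fst (y + z) - (\<Sum>j\<le>rk K. (c j + d j) *\<^sub>C ff K j) \<in> graded_sum K (negative_cone K 2)"
    by (simp add: sum.distrib algebra_simps)
  moreover have "app (snd (y + z)) (letter_words K) = (\<lambda>w. (\<Sum>j\<le>rk K. c j + d j) * letter_words K w)"
    by (simp add: fun_eq_iff app_plus app sum.distrib algebra_simps)
  ultimately show ?case by (intro exI[of _ "\<lambda>j. c j + d j"] conjI)
next
  case (scale z a)
  then obtain c where
    "fst z - (\<Sum>j\<le>rk K. c j *\<^sub>C ff K j) \<in> graded_sum K (negative_cone K 2)" and app:
    "app (snd z) (letter_words K) = (\<lambda>w. (\<Sum>j\<le>rk K. c j) * letter_words K w)" by blast
  from cvs.subspace_scale[OF subspace_graded_sum this(1), of a]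
  have "fst (a *\<^sub>C z) - (\<Sum>j\<le>rk K. (a * c j) *\<^sub>C ff K j) \<in> graded_sum K (negative_cone K 2)"
    by (simp add: cvs.scale_right_diff_distrib cvs.scale_sum_right)
  moreover have "app (snd (a *\<^sub>C z)) (letter_words K) = (\<lambda>w. (\<Sum>j\<le>rk K. a * c j) * letter_words K w)"
    by (simp add: fun_eq_iff app_scaleC app sum_distrib_left)
  ultimately show ?case by (intro exI[of _ "\<lambda>j. a * c j"] conjI)
next
  case (bracket y z)
  have "lie (fst y) (fst z) \<in> graded_sum K (negative_cone K 2)"
    using fst_f_pairs bracket.hyps negative_cone_add[of _ K 1 _ 1]
    by (intro lie_graded_sum[of _ K "negative_cone K 1" _ "negative_cone K 1"]) auto
  moreover have "app (snd (lie y z)) (letter_words K) w = 0" for w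
    using bracket.IH by (auto simp: app_lie app_scale)
  ultimately show ?case
    by (intro exI[of _ "\<lambda>_. 0"]) (simp add: fun_eq_iff)
qed

text \<open>The weight -alpha_j occurs neither in \<open>P\<close>, nor in height at least 2, nor
  among the other f_i. So \<open>c j *\<^sub>C ff K j\<close> is a sum of vectors of other weights
  and vanishes by independence of the root spaces.\<close>

lemma simple_coefficient_zero:
  assumes "a \<in> graded_sum K P" "P \<subseteq> root_lattice K" "(\<lambda>i. - simple_root j i) \<notin> P" and j: "j \<le> rk K"
    and rest: "a - (\<Sum>j\<le>rk K. c j *\<^sub>C ff K j) \<in> graded_sum K (negative_cone K 2)"
  shows "c j = 0"
proof -
  let ?k = "\<lambda>i. - simple_root j i" and ?Q = "root_lattice K - {\<lambda>i. - simple_root j i}"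
  have lattice: "(\<lambda>m. - simple_root i m) \<in> root_lattice K" if "i \<le> rk K" for i
    using negative_cone_subset neg_simple_root_in_negative_cone[OF that] by (rule subsetD)
  have ffk: "ff K i \<in> graded_sum K ?Q" if "i \<le> rk K" "i \<noteq> j" for i
  proof -
    have "(\<lambda>m. - simple_root i m) \<noteq> ?k"
      using that(2) by (metis (no_types) simple_root_def neg_equal_iff_equal zero_neq_one)
    with lattice[OF that(1)] have "(\<lambda>m. - simple_root i m) \<in> ?Q" by simp
    from subsetD[OF root_space_subset_graded_sum[OF this] ff_in_root_space[OF that(1)]]
    show ?thesis .
  qed
  have "?k \<notin> negative_cone K 2"
    using j by (simp add: negative_cone_def sum_negf sum_simple_root)
  hence "negative_cone K 2 \<subseteq> ?Q" "P \<subseteq> ?Q"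
    using assms(2,3) negative_cone_subset[of K 2] by blast+
  note Q = subsetD[OF graded_sum_mono[OF this(1)] rest] subsetD[OF graded_sum_mono[OF this(2)] assms(1)]
  have "(\<Sum>i\<in>{..rk K} - {j}. c i *\<^sub>C ff K i) \<in> graded_sum K ?Q"
    using ffk by (intro cvs.subspace_sum[OF subspace_graded_sum] cvs.subspace_scale[OF subspace_graded_sum]) auto
  from cvs.subspace_diff[OF subspace_graded_sum cvs.subspace_diff[OF subspace_graded_sum Q(2,1)] this]
  have "c j *\<^sub>C ff K j \<in> graded_sum K ?Q"
    using j by (simp add: sum.remove[of "{..rk K}" j])
  moreover have "c j *\<^sub>C ff K j \<in> graded_sum K {?k}"
    using ff_in_root_space[OF j] root_space_subset_graded_sum[of ?k "{?k}" K]
    by (auto intro: cvs.subspace_scale[OF subspace_graded_sum])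
  ultimately have "c j *\<^sub>C ff K j = 0"
    using lattice[OF j] by (intro graded_sum_disjoint[of ?Q "{?k}"]) auto
  thus ?thesis using ff_nonzero[OF j] by simp
qed

lemma word_weight_add:
  assumes "l \<in> cartan_dual K" "x \<in> cartan K" "y \<in> cartan K"
  shows "word_weight K l w (x + y) = word_weight K l w x + word_weight K l w y"
  using assms by (induction w)
    (auto simp: word_weight_Cons cartan_dual_add[OF assms(1)] cartan_dual_add[OF alpha_in_cartan_dual])

lemma word_weight_scale:
  assumes "l \<in> cartan_dual K" "x \<in> cartan K"
  shows "word_weight K l w (c *\<^sub>C x) = c * word_weight K l w x"
  using assms by (induction w)
    (auto simp: word_weight_Cons cartan_dual_scale[OF assms(1)] cartan_dual_scale[OF alpha_in_cartan_dual]
      right_diff_distrib)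

lemma subspace_h_pairs:
  assumes "l \<in> cartan_dual K"
  shows "cvs.subspace (h_pairs K l)"
proof (rule cvs.subspaceI)
  have scale: "c *\<^sub>C z \<in> h_pairs K l" if z: "z \<in> h_pairs K l" for c z
  proof -
    from z obtain x where x: "x \<in> cartan K" "z = (x, op_h K l x)" by (auto simp: h_pairs_def)
    have "c *\<^sub>C op_h K l x = op_h K l (c *\<^sub>C x)"
      by (rule word_op_eqI) (simp add: app_scaleC app_op_h word_weight_scale[OF assms x(1)])
    thus ?thesis
      using x cvs.subspace_scale[OF subspace_cartan x(1)] by (auto simp: h_pairs_def scaleC_prod_def)
  qed
  show "c *\<^sub>C z \<in> h_pairs K l" if "z \<in> h_pairs K l" for c z
    using that by (rule scale)
  have "(0, op_h K l 0) \<in> h_pairs K l"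
    using cvs.subspace_0[OF subspace_cartan] by (auto simp: h_pairs_def)
  from scale[OF this, of 0] show "0 \<in> h_pairs K l" by simp
  show "y + z \<in> h_pairs K l" if yz: "y \<in> h_pairs K l" "z \<in> h_pairs K l" for y z
  proof -
    from yz obtain x x' where x: "x \<in> cartan K" "y = (x, op_h K l x)" "x' \<in> cartan K" "z = (x', op_h K l x')"
      by (auto simp: h_pairs_def)
    have "op_h K l x + op_h K l x' = op_h K l (x + x')"
      by (rule word_op_eqI) (simp add: app_plus app_op_h word_weight_add[OF assms x(1,3)] distrib_right)
    thus ?thesis
      using x cvs.subspace_add[OF subspace_cartan x(1,3)] by (auto simp: h_pairs_def)
  qed
qed

lemma op_graph_decomposition:
  assumes l: "l \<in> cartan_dual K" and z: "z \<in> op_graph K l"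
  obtains a h b where "a \<in> lie_subalgebra_gen (f_pairs K)" "h \<in> h_pairs K l"
    "b \<in> lie_subalgebra_gen (e_pairs K l)" "z = a + h + b"
proof (rule triangular_decomposition[OF subspace_h_pairs[OF l]])
  show "z \<in> lie_subalgebra_gen (h_pairs K l \<union> e_pairs K l \<union> f_pairs K)"
    using z by (simp add: op_graph_def)
  show "lie x y = 0" if "x \<in> h_pairs K l" "y \<in> h_pairs K l" for x y
    using that by (auto simp: h_pairs_def lie_prod_def lie_op_h_op_h lie_cartan_cartan zero_prod_def)
  show "\<exists>c. lie h e = c *\<^sub>C e" if "h \<in> h_pairs K l" "e \<in> e_pairs K l" for h e
    using that by (auto simp: h_pairs_def e_pairs_def lie_prod_def scaleC_prod_def lie_op_h_op_e lie_cartan_ee)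
  show "\<exists>c. lie h f = c *\<^sub>C f" if h: "h \<in> h_pairs K l" and f: "f \<in> f_pairs K" for h f
  proof -
    obtain x where x: "x \<in> cartan K" "h = (x, op_h K l x)"
      using h by (auto simp: h_pairs_def)
    obtain i where i: "i \<le> rk K" "f = (ff K i, op_f i)"
      using f by (auto simp: f_pairs_def)
    have "lie h f = (- alpha K i x) *\<^sub>C f"
      unfolding x i lie_prod_def scaleC_prod_def fst_conv snd_conv
      using lie_op_h_op_f[OF i(1)] lie_cartan_ff[OF x(1) i(1)] by (rule_tac prod_eqI) (simp_all only: fst_conv snd_conv)
    thus ?thesis by blast
  qed
  show "lie e f \<in> h_pairs K l" if "e \<in> e_pairs K l" "f \<in> f_pairs K" for e f
  proof -
    have "(hh K i, op_h K l (hh K i)) \<in> h_pairs K l" if "i \<le> rk K" for i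
      unfolding h_pairs_def by (rule imageI[OF hh_in_cartan[OF that]])
    thus ?thesis
      using that cvs.subspace_0[OF subspace_h_pairs[OF l]]
      by (auto simp: e_pairs_def f_pairs_def lie_prod_def lie_op_e_op_f lie_ee_ff zero_prod_def)
  qed
qed (use that in blast)

text \<open>The first components of the three parts of a pair over 0 have weights in disjoint sets,
  so each of them is 0. Then the Cartan operator is 0 at the empty word, the e-part vanishes there
  in any case, and the f-part acts by its linear coefficients, which must be 0. The operators
  themselves need not vanish.\<close>

lemma op_graph_zero_Nil:
  assumes l: "l \<in> cartan_dual K" and "(0, X) \<in> op_graph K l"
  shows "app X (letter_words K) [] = 0"
proof -
  obtain a h b where a: "a \<in> lie_subalgebra_gen (f_pairs K)" and h: "h \<in> h_pairs K l"
    and b: "b \<in> lie_subalgebra_gen (e_pairs K l)" and eq: "(0, X) = a + h + b"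
    using op_graph_decomposition[OF assms] by blast
  obtain y where y: "y \<in> cartan K" "h = (y, op_h K l y)" using h by (auto simp: h_pairs_def)
  let ?N = "negative_cone K 1" and ?P = "positive_cone K" and ?O = "{\<lambda>_. 0} :: (nat \<Rightarrow> int) set"
  have sub: "?N \<subseteq> root_lattice K" "?O \<union> ?P \<subseteq> root_lattice K" "?N \<inter> (?O \<union> ?P) = {}" "?O \<inter> ?P = {}"
    by (auto simp: negative_cone_def positive_cone_def root_lattice_def)
  have sum: "fst a + y + fst b = 0" using eq y by (simp add: prod_eq_iff)
  have y0: "y \<in> graded_sum K ?O"
    using y(1) cartan_subset_root_space root_space_subset_graded_sum[of "\<lambda>_. 0" ?O K] by blast
  have "- y - fst b \<in> graded_sum K (?O \<union> ?P)"
    using y0 fst_e_pairs[OF b] graded_sum_mono[of ?O "?O \<union> ?P" K] graded_sum_mono[of ?P "?O \<union> ?P" K]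
    by (intro cvs.subspace_diff[OF subspace_graded_sum] cvs.subspace_neg[OF subspace_graded_sum]) auto
  moreover have fa: "fst a = - y - fst b" using sum by (simp add: eq_diff_eq eq_neg_iff_add_eq_0 add_ac)
  ultimately have a0: "fst a = 0"
    using graded_sum_disjoint[OF sub(1-3) fst_f_pairs[OF a]] by simp
  hence "y = - fst b" using sum by (simp add: eq_neg_iff_add_eq_0)
  hence "y \<in> graded_sum K ?P"
    using fst_e_pairs[OF b] by (simp add: cvs.subspace_neg[OF subspace_graded_sum])
  hence "y = 0"
    using graded_sum_disjoint[of ?O ?P y] y0 sub by blast
  obtain c where c: "fst a - (\<Sum>j\<le>rk K. c j *\<^sub>C ff K j) \<in> graded_sum K (negative_cone K 2)"
    "app (snd a) (letter_words K) = (\<lambda>w. (\<Sum>j\<le>rk K. c j) * letter_words K w)"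
    using f_pairs_character[OF a] by blast
  \<comment> \<open>The zero vector lies in the graded sum over no weights, so \<open>P\<close> can
    be empty.\<close>
  have "c j = 0" if "j \<le> rk K" for j
    using simple_coefficient_zero[of "fst a" "{}", OF _ _ _ that c(1)] a0
    by (simp add: cvs.subspace_0[OF subspace_graded_sum])
  hence "app (snd a) (letter_words K) [] = 0" using c(2) by simp
  moreover have "app (snd h) (letter_words K) [] = 0"
    using y(2) \<open>y = 0\<close> cartan_dual_0[OF l] by (simp add: app_op_h)
  moreover have "X = snd a + snd h + snd b" using eq by (simp add: prod_eq_iff)
  ultimately show ?thesis by (simp add: app_plus app_e_pairs_Nil[OF b])
qed

text \<open>Bracketing with the pair of f_i stays over 0, and \<open>letter_words\<close> is fixed
  by \<open>op_f i\<close>; hence the value of \<open>app X (letter_words K)\<close> at a word does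
  not change when the first letter i is dropped. This leads down to the empty word, with
  \<open>X\<close> arbitrary in the induction.\<close>

lemma letter_words_in_op_invariants:
  assumes l: "l \<in> cartan_dual K"
  shows "letter_words K \<in> op_invariants K l"
  unfolding op_invariants_def
proof (intro CollectI allI impI ext)
  fix X w assume "(0, X) \<in> op_graph K l"
  thus "app X (letter_words K) w = 0"
  proof (induction w arbitrary: X)
    case Nil
    thus ?case by (rule op_graph_zero_Nil[OF l])
  next
    case (Cons i w)
    show ?case
    proof (cases "i \<le> rk K")
      case True
      hence "(ff K i, op_f i) \<in> op_graph K l"
        unfolding op_graph_def f_pairs_def by (auto intro: lie_subalgebra_gen.gen)
      from op_graph_lie[OF Cons.prems this] have "(0, lie X (op_f i)) \<in> op_graph K l" by simp
      from Cons.IH[OF this] have "app (op_f i) (app X (letter_words K)) w = app X (letter_words K) w"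
        using True by (simp add: app_lie app_op_f_letter_words)
      thus ?thesis using Cons.IH[OF Cons.prems] by (simp add: app_op_f)
    next
      case False
      have "app (snd (0 :: 'g, X)) (letter_words K) (i # w) = 0"
        by (rule app_op_graph_vanish[OF Cons.prems[unfolded op_graph_def]])
          (use False in \<open>auto simp: letter_words_def\<close>)
      thus ?thesis by simp
    qed
  qed
qed

text \<open>On products of the f_i this is the value of the character. Elements of the Cartan
  subalgebra in general scale different words differently and have no such scalar, so a constant
  leading coefficient matters.\<close>

definition acts_by :: "'g uea \<Rightarrow> ('g \<Rightarrow> complex) \<Rightarrow> complex \<Rightarrow> bool" where
  "acts_by u l c \<longleftrightarrow> uea_action K l u (letter_words K) = (\<lambda>w. c * letter_words K w)"

end

locale kac_moody_weight = kac_moody K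
  for K :: "('g::complex_lie_algebra, 'z) km_data_scheme" +
  fixes l :: "'g \<Rightarrow> complex"
  assumes weight: "l \<in> cartan_dual K"
begin

lemmas letter_words_invariant = letter_words_in_op_invariants[OF weight]

lemma acts_by_const: "acts_by (uea_const c) l c"
  by (simp add: acts_by_def uea_action_const letter_words_invariant)

lemma acts_by_0: "acts_by 0 l 0" and acts_by_1: "acts_by 1 l 1"
  using acts_by_const[of 0] acts_by_const[of 1] by simp_all

lemma acts_by_add: "acts_by u l a \<Longrightarrow> acts_by v l b \<Longrightarrow> acts_by (u + v) l (a + b)"
  by (simp add: acts_by_def fun_eq_iff uea_action_add letter_words_invariant distrib_right)

lemma acts_by_mult: "acts_by u l a \<Longrightarrow> acts_by v l b \<Longrightarrow> acts_by (u * v) l (a * b)"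
  by (simp add: acts_by_def uea_action_mult letter_words_invariant uea_action_scale_arg mult.assoc)

lemma acts_by_power: "acts_by u l a \<Longrightarrow> acts_by (u ^ n) l (a ^ n)"
  by (induction n) (simp_all add: acts_by_1 acts_by_mult)

lemma acts_by_sum_0: "(\<And>x. x \<in> A \<Longrightarrow> acts_by (f x) l 0) \<Longrightarrow> acts_by (sum f A) l 0"
proof (induction A rule: infinite_finite_induct)
  case (insert x A)
  thus ?case using acts_by_add[of "f x" 0 "sum f A" 0] by simp
qed (simp_all add: acts_by_0)

lemma acts_by_prod_list:
  "(\<And>x. x \<in> set xs \<Longrightarrow> acts_by (f x) l (c x)) \<Longrightarrow> acts_by (\<Prod>x\<leftarrow>xs. f x) l (\<Prod>x\<leftarrow>xs. c x)"
  by (induction xs) (simp_all add: acts_by_1 acts_by_mult)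

lemma n_minus_lift:
  assumes "x \<in> n_minus K"
  obtains X where "(x, X) \<in> lie_subalgebra_gen (f_pairs K)" "(x, X) \<in> op_graph K l"
proof -
  have "fst ` f_pairs K = ff K ` {..rk K}" by (simp add: f_pairs_def image_image)
  then obtain X where "(x, X) \<in> lie_subalgebra_gen (f_pairs K)"
    using assms lie_subalgebra_gen_fst_lift[of x "f_pairs K"] by (auto simp: n_minus_def)
  moreover from this have "(x, X) \<in> op_graph K l"
    unfolding op_graph_def by (rule subsetD[OF lie_subalgebra_gen_mono, rotated]) blast
  ultimately show ?thesis using that by blast
qed

lemma acts_by_ff:
  assumes "i \<le> rk K"
  shows "acts_by (\<iota> (ff K i)) l 1"
proof -
  have "(ff K i, op_f i) \<in> op_graph K l"
    unfolding op_graph_def f_pairs_def using assms by (auto intro: lie_subalgebra_gen.gen)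
  from uea_action_incl[OF letter_words_invariant this] show ?thesis
    using assms by (simp add: acts_by_def app_op_f_letter_words)
qed

lemma acts_by_n_minus:
  assumes "x \<in> n_minus K"
  obtains c where "acts_by (\<iota> x) l c"
proof -
  obtain X where X: "(x, X) \<in> lie_subalgebra_gen (f_pairs K)" "(x, X) \<in> op_graph K l"
    using n_minus_lift[OF assms] .
  then obtain c where "app X (letter_words K) = (\<lambda>w. c * letter_words K w)"
    using f_pairs_character[OF X(1)] by auto
  thus ?thesis
    using that uea_action_incl[OF letter_words_invariant X(2)] by (simp add: acts_by_def)
qed

text \<open>A vector of weight -beta with beta not simple has no component in any weight -alpha_j,
  so all its linear coefficients vanish.\<close>

lemma acts_by_nonsimple_root_vector:
  assumes "x \<in> n_minus K" "x \<in> root_space K (\<lambda>j. - \<beta> j)" "\<beta> \<in> root_lattice K"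
    and "\<And>j. j \<le> rk K \<Longrightarrow> \<beta> \<noteq> simple_root j"
  shows "acts_by (\<iota> x) l 0"
proof -
  obtain X where X: "(x, X) \<in> lie_subalgebra_gen (f_pairs K)" "(x, X) \<in> op_graph K l"
    using n_minus_lift[OF assms(1)] .
  then obtain c where c: "x - (\<Sum>j\<le>rk K. c j *\<^sub>C ff K j) \<in> graded_sum K (negative_cone K 2)"
    "app X (letter_words K) = (\<lambda>w. (\<Sum>j\<le>rk K. c j) * letter_words K w)"
    using f_pairs_character[OF X(1)] by auto
  have "c j = 0" if "j \<le> rk K" for j
  proof (rule simple_coefficient_zero[OF _ _ _ that c(1)])
    show "x \<in> graded_sum K {\<lambda>j. - \<beta> j}"
      by (rule subsetD[OF root_space_subset_graded_sum assms(2)]) simp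
    show "{\<lambda>j. - \<beta> j} \<subseteq> root_lattice K" using assms(3) by (simp add: root_lattice_def)
    have "\<beta> \<noteq> simple_root j" using assms(4) that .
    thus "(\<lambda>i. - simple_root j i) \<notin> {\<lambda>j. - \<beta> j}" by (simp add: fun_eq_iff eq_commute)
  qed
  thus ?thesis
    using uea_action_incl[OF letter_words_invariant X(2)] c(2) by (simp add: acts_by_def)
qed

end


section \<open>Nonvanishing of the Shapovalov vector\<close>

lemma simple_root_in_real_roots: "i \<le> rk K \<Longrightarrow> simple_root i \<in> real_roots K"
  unfolding real_roots_def by (blast intro: root_coroot.simple)

lemma positive_roots_in_root_lattice: "\<beta> \<in> positive_roots K \<Longrightarrow> \<beta> \<in> root_lattice K"
  by (simp add: positive_roots_def roots_def root_lattice_def)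

lemma simple_root_not_multiple:
  assumes "(\<lambda>k. int m * \<beta> k) = simple_root i"
  shows "\<beta> = simple_root i"
proof -
  have "int m * \<beta> i = 1" using fun_cong[OF assms, of i] by (simp add: simple_root_def)
  hence "m = 1" by (simp add: zmult_eq_1_iff)
  thus ?thesis using assms by simp
qed

locale kac_moody_weight_root_vectors = kac_moody_weight K l + kac_moody_root_vectors K ord rv
  for K :: "('g::complex_lie_algebra, 'z) km_data_scheme"
    and l :: "'g \<Rightarrow> complex" and ord :: "root_index rel" and rv :: "(nat \<Rightarrow> int) \<Rightarrow> nat \<Rightarrow> 'g"
begin

lemma acts_by_nonsimple_rv:
  assumes "(\<beta>, i) \<in> root_indices K" "\<And>j. j \<le> rk K \<Longrightarrow> \<beta> \<noteq> simple_root j"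
  shows "acts_by (\<iota> (rv \<beta> i)) l 0"
proof (rule acts_by_nonsimple_root_vector[OF _ rv_in_root_space[OF assms(1)] _ assms(2)])
  show "rv \<beta> i \<in> n_minus K" using rv_in_n_minus_int[OF assms(1)] by (simp add: n_minus_int_def)
  show "\<beta> \<in> root_lattice K"
    using assms(1) by (auto simp: root_indices_def positive_roots_in_root_lattice)
qed

text \<open>For s > 0 the polynomial Lambda_s has no constant term: sum j m_j = s forces some
  variable to occur in each monomial.\<close>

lemma acts_by_Lambda:
  assumes "\<And>j. acts_by (x j) l 0" "s > 0"
  shows "acts_by (Lambda s x) l 0"
  unfolding Lambda_def
proof (rule acts_by_sum_0)
  fix m :: "nat \<Rightarrow> nat"
  assume "m \<in> {m. (\<forall>j. m j \<noteq> 0 \<longrightarrow> j \<in> {1..s}) \<and> (\<Sum>j=1..s. j * m j) = s}"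
  hence "(\<Sum>j=1..s. j * m j) \<noteq> 0" using assms(2) by simp
  then obtain j where "j \<in> {1..s}" "j * m j \<noteq> 0" by (rule sum.not_neutral_contains_not_neutral)
  hence j: "j \<in> {1..s}" "m j \<noteq> 0" by simp_all
  have "acts_by (uea_const (\<Prod>j=1..s. 1 / (of_nat j ^ m j * fact (m j))) * (\<Prod>j\<leftarrow>[1..<Suc s]. x j ^ m j)) l
      ((\<Prod>j=1..s. 1 / (of_nat j ^ m j * fact (m j))) * (\<Prod>j\<leftarrow>[1..<Suc s]. 0 ^ m j))"
    by (intro acts_by_mult acts_by_const acts_by_prod_list acts_by_power assms(1))
  moreover have "(0::complex) ^ m j = 0" using j(2) by simp
  hence "(0::complex) \<in> set (map (\<lambda>j. 0 ^ m j) [1..<Suc s])"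
    unfolding set_map set_upt atLeastLessThanSuc_atLeastAtMost using j(1) by (intro rev_image_eqI[of j]) simp_all
  hence "(\<Prod>j\<leftarrow>[1..<Suc s]. 0 ^ m j) = (0::complex)" unfolding prod_list_zero_iff .
  ultimately show "acts_by (uea_const (\<Prod>j=1..s. 1 / (of_nat j ^ m j * fact (m j))) *
      (\<Prod>j\<leftarrow>[1..<Suc s]. x j ^ m j)) l 0"
    by (simp only: mult_zero_right)
qed

lemma acts_by_root_divided_power:
  assumes "b \<in> root_indices K" "s > 0"
  shows "\<exists>c. acts_by (of_nat (fact s) * root_divided_power K rv b s) l c \<and>
    ((\<forall>j\<le>rk K. fst b \<noteq> simple_root j) \<longrightarrow> c = 0) \<and> ((\<exists>j\<le>rk K. b = (simple_root j, 1)) \<longrightarrow> c = 1)"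
proof -
  obtain \<beta> i where b: "b = (\<beta>, i)" by (cases b)
  note idx = assms(1)[unfolded b]
  show ?thesis
  proof (cases "\<beta> \<in> real_roots K")
    case True
    have eq: "of_nat (fact s) * root_divided_power K rv b s = \<iota> (rv \<beta> i) ^ s"
      unfolding b root_divided_power_def using True by (simp add: of_nat_fact_mult_divided_power)
    consider (nonsimple) "\<forall>j\<le>rk K. \<beta> \<noteq> simple_root j"
      | (base) j where "j \<le> rk K" "\<beta> = simple_root j" "i = 1"
      | (other) j where "j \<le> rk K" "\<beta> = simple_root j" "i \<noteq> 1" by blast
    thus ?thesis
    proof cases
      case nonsimple
      hence "acts_by (\<iota> (rv \<beta> i) ^ s) l (0 ^ s)"
        by (intro acts_by_power acts_by_nonsimple_rv idx) auto
      hence "acts_by (\<iota> (rv \<beta> i) ^ s) l 0" using assms(2) by (simp add: zero_power)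
      thus ?thesis unfolding eq using nonsimple by (intro exI[of _ 0]) (auto simp: b)
    next
      case base
      hence "acts_by (\<iota> (rv \<beta> i) ^ s) l (1 ^ s)"
        by (intro acts_by_power) (simp only: rv_simple_root acts_by_ff)
      thus ?thesis unfolding eq using base by (intro exI[of _ 1]) (auto simp: b)
    next
      \<comment> \<open>The scalar is left open here. The leading monomial contains no such index,
        and every other monomial of the Shapovalov element has a nonsimple factor.\<close>
      case other
      have "rv \<beta> i \<in> n_minus K" using rv_in_n_minus_int[OF idx] by (simp add: n_minus_int_def)
      then obtain c where "acts_by (\<iota> (rv \<beta> i)) l c" by (rule acts_by_n_minus)
      hence "acts_by (\<iota> (rv \<beta> i) ^ s) l (c ^ s)" by (rule acts_by_power)
      thus ?thesis unfolding eq using other by (intro exI[of _ "c ^ s"]) (auto simp: b)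
    qed
  next
    case False
    hence nonsimple: "\<beta> \<noteq> simple_root j" if "j \<le> rk K" for j
      using simple_root_in_real_roots[OF that] by blast
    define x where "x j = (let \<beta>' = \<lambda>k. int j * \<beta> k in
      if (\<beta>', i) \<in> root_indices K then \<iota> (rv \<beta>' i) else 0)" for j :: nat
    \<comment> \<open>If a multiple of \<open>\<beta>\<close> were simple, then
      \<open>\<beta>\<close> itself would be simple and hence real.\<close>
    have "acts_by (x j) l 0" for j
    proof (cases "((\<lambda>k. int j * \<beta> k), i) \<in> root_indices K")
      case True
      thus ?thesis
        using acts_by_nonsimple_rv[OF True] simple_root_not_multiple[of j \<beta>] nonsimple
        by (auto simp: x_def Let_def)
    qed (simp add: x_def acts_by_0)
    hence "acts_by (Lambda s x) l 0" using assms(2) by (rule acts_by_Lambda)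
    hence "acts_by (of_nat (fact s) * Lambda s x) l (of_nat (fact s) * 0)"
      unfolding uea_const_of_nat[symmetric] by (intro acts_by_mult acts_by_const)
    moreover have "root_divided_power K rv b s = Lambda s x"
      using False by (simp add: b root_divided_power_def x_def[abs_def])
    ultimately show ?thesis using nonsimple by (intro exI[of _ 0]) (auto simp: b)
  qed
qed

lemma acts_by_pbw:
  assumes p: "p \<in> kparts K"
  shows acts_by_nonsimple_pbw: "b \<in> kpart_supp p \<Longrightarrow> (\<And>j. j \<le> rk K \<Longrightarrow> fst b \<noteq> simple_root j) \<Longrightarrow>
      acts_by (pbw K ord rv p) l 0"
    and acts_by_simple_pbw: "(\<And>b. b \<in> kpart_supp p \<Longrightarrow> \<exists>j\<le>rk K. b = (simple_root j, 1)) \<Longrightarrow>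
      acts_by (pbw K ord rv p) l 1"
proof -
  have "\<exists>c. acts_by (of_nat (fact (p b)) * root_divided_power K rv b (p b)) l c \<and>
      ((\<forall>j\<le>rk K. fst b \<noteq> simple_root j) \<longrightarrow> c = 0) \<and> ((\<exists>j\<le>rk K. b = (simple_root j, 1)) \<longrightarrow> c = 1)"
    if "b \<in> kpart_supp p" for b
    using that p by (intro acts_by_root_divided_power) (auto simp: kparts_def kpart_supp_def)
  hence "\<forall>b\<in>kpart_supp p. \<exists>c. acts_by (of_nat (fact (p b)) * root_divided_power K rv b (p b)) l c \<and>
      ((\<forall>j\<le>rk K. fst b \<noteq> simple_root j) \<longrightarrow> c = 0) \<and> ((\<exists>j\<le>rk K. b = (simple_root j, 1)) \<longrightarrow> c = 1)"
    by (rule ballI)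
  from bchoice[OF this] obtain c where c: "\<forall>b\<in>kpart_supp p.
      acts_by (of_nat (fact (p b)) * root_divided_power K rv b (p b)) l (c b) \<and>
      ((\<forall>j\<le>rk K. fst b \<noteq> simple_root j) \<longrightarrow> c b = 0) \<and> ((\<exists>j\<le>rk K. b = (simple_root j, 1)) \<longrightarrow> c b = 1)"
    by (elim exE)
  have pbw: "acts_by (pbw K ord rv p) l (\<Prod>b\<leftarrow>ordered_list ord (kpart_supp p). c b)"
    unfolding pbw_def using c by (intro acts_by_prod_list) (simp only: set_ordered_list_kpart[OF p])
  show "acts_by (pbw K ord rv p) l 0"
    if "b \<in> kpart_supp p" "\<And>j. j \<le> rk K \<Longrightarrow> fst b \<noteq> simple_root j"
  proof -
    have "0 \<in> set (map c (ordered_list ord (kpart_supp p)))"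
      unfolding set_map set_ordered_list_kpart[OF p]
      using c that by (intro rev_image_eqI[OF that(1)]) simp
    hence "(\<Prod>b\<leftarrow>ordered_list ord (kpart_supp p). c b) = 0" unfolding prod_list_zero_iff .
    thus ?thesis using pbw by (simp only:)
  qed
  show "acts_by (pbw K ord rv p) l 1"
    if "\<And>b. b \<in> kpart_supp p \<Longrightarrow> \<exists>j\<le>rk K. b = (simple_root j, 1)"
  proof -
    have "map c (ordered_list ord (kpart_supp p)) = map (\<lambda>_. 1) (ordered_list ord (kpart_supp p))"
      using c that by (intro map_cong refl) (simp only: set_ordered_list_kpart[OF p])
    moreover have "prod_list (map (\<lambda>_. 1 :: complex) bs) = 1" for bs :: "root_index list"
      by (induction bs) simp_all
    ultimately show ?thesis using pbw by (simp only:)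
  qed
qed

end

section \<open>Degree of the leading monomial\<close>

lemma leading_kpart_simple: "i \<le> rk K \<Longrightarrow> leading_kpart K \<gamma> D (simple_root i, 1) = D * nat (\<gamma> i)"
proof -
  assume "i \<le> rk K"
  have "leading_kpart K \<gamma> D (simple_root i, 1) = (\<Sum>j\<le>rk K. if i = j then D * nat (\<gamma> j) else 0)"
    unfolding leading_kpart_def using inj_simple_root by (intro sum.cong) (auto dest: injD)
  thus ?thesis using \<open>i \<le> rk K\<close> by simp
qed

lemma leading_kpart_supp:
  assumes "b \<in> kpart_supp (leading_kpart K \<gamma> D)"
  shows "\<exists>j\<le>rk K. b = (simple_root j, 1)"
proof (rule ccontr)
  assume "\<not> ?thesis"
  hence "leading_kpart K \<gamma> D b = 0" unfolding leading_kpart_def by (intro sum.neutral) auto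
  thus False using assms by (simp add: kpart_supp_def)
qed

lemma kpart_deg_leading_kpart: "kpart_deg (leading_kpart K \<gamma> D) = (\<Sum>i\<le>rk K. D * nat (\<gamma> i))"
proof -
  let ?p = "leading_kpart K \<gamma> D" and ?s = "\<lambda>i. (simple_root i, 1::nat)"
  have "kpart_deg ?p = (\<Sum>b\<in>?s ` {..rk K}. ?p b)"
    unfolding kpart_deg_def
  proof (rule sum.mono_neutral_left)
    show "kpart_supp ?p \<subseteq> ?s ` {..rk K}" using leading_kpart_supp by blast
  qed (auto simp: kpart_supp_def)
  also have "\<dots> = (\<Sum>i\<le>rk K. ?p (?s i))"
    using inj_simple_root by (intro sum.reindex_cong[of ?s]) (auto simp: inj_on_def dest: injD)
  also have "\<dots> = (\<Sum>i\<le>rk K. D * nat (\<gamma> i))"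
    by (intro sum.cong refl leading_kpart_simple) simp
  finally show ?thesis .
qed

text \<open>Simple roots have height 1, so a partition into simple roots has degree equal to the
  height of its weight, here D times the height of gamma.\<close>

lemma kpart_deg_simple:
  assumes wt: "kpart_wt p = (\<lambda>k. int D * \<gamma> k)" and nonneg: "\<And>i. \<gamma> i \<ge> 0"
    and simple: "\<And>b. b \<in> kpart_supp p \<Longrightarrow> \<exists>j\<le>rk K. fst b = simple_root j"
  shows "kpart_deg p = kpart_deg (leading_kpart K \<gamma> D)"
proof -
  have "int (kpart_deg p) = (\<Sum>b\<in>kpart_supp p. int (p b) * (\<Sum>k\<le>rk K. fst b k))"
    unfolding kpart_deg_def of_nat_sum
  proof (rule sum.cong)
    fix b assume "b \<in> kpart_supp p"
    then obtain j where "j \<le> rk K" "fst b = simple_root j" using simple by blast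
    thus "int (p b) = int (p b) * (\<Sum>k\<le>rk K. fst b k)" by (simp add: sum_simple_root)
  qed simp
  also have "\<dots> = (\<Sum>k\<le>rk K. kpart_wt p k)"
    unfolding kpart_wt_def by (simp add: sum_distrib_left, subst sum.swap, rule refl)
  also have "\<dots> = int (\<Sum>i\<le>rk K. D * nat (\<gamma> i))"
    unfolding wt using nonneg by simp
  finally show ?thesis by (simp only: kpart_deg_leading_kpart of_nat_eq_iff)
qed

text \<open>Evaluation at the empty word after acting on \<open>letter_words\<close> kills the Verma
  ideal, while on \<open>Z\<close> it gives the nonzero integer coefficient of the leading
  monomial.\<close>

lemma (in kac_moody_weight_root_vectors) shapovalov_not_in_verma_ideal:
  assumes Z: "integral_shapovalov K \<rho> ord rv \<gamma> D Z" and \<gamma>: "\<gamma> \<in> positive_roots K"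
  shows "Z \<notin> verma_ideal K l"
proof
  assume "Z \<in> verma_ideal K l"
  let ?p0 = "leading_kpart K \<gamma> D" and ?\<psi> = "letter_words K"
  from Z obtain q where fin: "finite {p. q p \<noteq> 0}"
    and q: "\<And>p. q p \<noteq> 0 \<Longrightarrow> p \<in> kparts K \<and> kpart_wt p = (\<lambda>k. int D * \<gamma> k)"
    and Zq: "Z = (\<Sum>p | q p \<noteq> 0. pbw K ord rv p * q p)"
    and lead: "\<exists>c::int. c \<noteq> 0 \<and> q ?p0 = of_int c"
    and deg: "\<And>p. q p \<noteq> 0 \<Longrightarrow> p \<noteq> ?p0 \<Longrightarrow> kpart_deg p < kpart_deg ?p0"
    unfolding integral_shapovalov_def by blast
  obtain c :: int where c: "c \<noteq> 0" "q ?p0 = of_int c" using lead by blast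
  have lead_acts: "acts_by (q ?p0) l (of_int c)"
    unfolding c(2) uea_const_of_int[symmetric] by (rule acts_by_const)
  have "?\<psi> [] = 1" by (simp add: letter_words_def)
  \<comment> \<open>That a nonzero integer stays nonzero in the enveloping algebra is read off from
    its action on \<open>letter_words\<close>.\<close>
  have "q ?p0 \<noteq> 0"
  proof
    assume "q ?p0 = 0"
    hence "(\<lambda>w. of_int c * ?\<psi> w) = (\<lambda>w. 0 * ?\<psi> w)"
      using lead_acts acts_by_0 by (simp add: acts_by_def)
    from fun_cong[OF this, of "[]"] show False using c(1) \<open>?\<psi> [] = 1\<close> by simp
  qed
  have lead_term: "acts_by (pbw K ord rv ?p0 * q ?p0) l (1 * of_int c)"
    using q[OF \<open>q ?p0 \<noteq> 0\<close>] leading_kpart_supp lead_acts by (intro acts_by_mult acts_by_simple_pbw) auto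
  have other_term: "acts_by (pbw K ord rv p * q p) l 0" if p: "q p \<noteq> 0" "p \<noteq> ?p0" for p
  proof -
    \<comment> \<open>Otherwise all factors belong to simple roots and the degree equals that of the
      leading monomial.\<close>
    have "\<exists>b\<in>kpart_supp p. \<forall>j\<le>rk K. fst b \<noteq> simple_root j"
    proof (rule ccontr)
      assume "\<not> ?thesis"
      hence "kpart_deg p = kpart_deg ?p0"
        using q[OF p(1)] \<gamma> by (intro kpart_deg_simple) (auto simp: positive_roots_def)
      thus False using deg[OF p] by simp
    qed
    then obtain b where "b \<in> kpart_supp p" "\<And>j. j \<le> rk K \<Longrightarrow> fst b \<noteq> simple_root j" by blast
    hence "acts_by (pbw K ord rv p) l 0" using q[OF p(1)] by (intro acts_by_nonsimple_pbw) auto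
    \<comment> \<open>The Cartan coefficient acts after the monomial, hence on the zero function, so
      it need not act by a scalar.\<close>
    thus ?thesis
      by (simp add: acts_by_def uea_action_mult letter_words_invariant uea_action_zero_arg)
  qed
  have "Z = pbw K ord rv ?p0 * q ?p0 + (\<Sum>p\<in>{p. q p \<noteq> 0} - {?p0}. pbw K ord rv p * q p)"
    unfolding Zq using fin \<open>q ?p0 \<noteq> 0\<close> by (intro sum.remove) auto
  moreover have "acts_by (\<Sum>p\<in>{p. q p \<noteq> 0} - {?p0}. pbw K ord rv p * q p) l 0"
    using other_term by (intro acts_by_sum_0) auto
  note acts_by_add[OF lead_term this]
  ultimately have "acts_by Z l (1 * of_int c + 0)" by (simp only:)
  hence "uea_action K l Z ?\<psi> [] = of_int c"
    using \<open>?\<psi> [] = 1\<close> by (simp add: acts_by_def)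
  thus False
    using uea_action_verma_ideal_Nil[OF letter_words_invariant \<open>Z \<in> verma_ideal K l\<close>] c(1) by simp
qed

theorem corollary3p11:
  fixes K :: "'g::complex_lie_algebra km_data"
    and ord :: "root_index rel"
    and rv :: "(nat \<Rightarrow> int) \<Rightarrow> nat \<Rightarrow> 'g"
    and \<rho> lam \<mu> :: "'g \<Rightarrow> complex"
    and \<gamma> :: "nat \<Rightarrow> int" and D :: nat and Z :: "'g uea"
  assumes "affine_kac_moody K"
    and "is_rho K \<rho>"
    and "linear_order_on (root_indices K) ord"
    and "integral_root_vectors K rv"
    and "polynomial_exchange K ord rv"
    and "\<gamma> \<in> positive_real_roots K"
    and "D > 0"
    and "lam \<in> integral_weights K"
    and "lam \<in> hyperplane K \<rho> \<gamma> D"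
    and "\<mu> = (\<lambda>x. lam x - of_nat D * root_functional K \<gamma> x)"
    and "integral_shapovalov K \<rho> ord rv \<gamma> D Z"
  shows "\<exists>\<phi>. verma_hom K \<mu> lam \<phi> \<and>
           \<phi> (verma_vec K \<mu>) = verma_act K lam Z (verma_vec K lam) \<and>
           (\<exists>X \<in> verma K \<mu>. \<phi> X \<noteq> verma_zero K lam)"
proof -
  interpret kac_moody_weight_root_vectors K lam ord rv
    using assms by unfold_locales (auto simp: integral_weights_def)
  have Z: "Z \<in> U_int K" by (rule shapovalov_in_U_int[OF assms(11)])
  obtain \<phi> where \<phi>: "verma_hom K \<mu> lam \<phi>" "\<And>u. \<phi> (verma_coset K \<mu> u) = verma_coset K lam (u * Z)"
    using verma_hom_right_mult[OF Z verma_ideal_mult_shapovalov[OF assms(9-11)]] by blast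
  have "Z \<notin> verma_ideal K lam"
    using assms(6) by (intro shapovalov_not_in_verma_ideal[OF assms(11)]) (simp add: positive_real_roots_def)
  hence "verma_coset K lam Z \<noteq> verma_zero K lam"
    using verma_coset_self[of Z K lam] by (auto simp: verma_zero_def mem_verma_coset)
  moreover have "verma_vec K \<mu> \<in> verma K \<mu>"
    unfolding verma_vec_def verma_def using U_int_1 by blast
  moreover have "\<phi> (verma_vec K \<mu>) = verma_coset K lam Z"
    by (simp add: verma_vec_def \<phi>(2))
  moreover have "verma_act K lam Z (verma_vec K lam) = verma_coset K lam Z"
    by (simp add: verma_vec_def verma_act_verma_coset[OF Z])
  ultimately show ?thesis using \<phi>(1) by metis
qed

end
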